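(* Let $m,n\ge1$, $\theta\in\{1,-1\}$ and $A=U(\mathfrak{gl}_m)\otimes H(U)$ with $U=\mathbb C^m\otimes\mathbb C^n$. (i) One can define a homomorphism $Y(\mathfrak{gl}_n)\to U(\mathfrak{gl}_m)\otimes H(U)$ by mapping $$T_{ij}(x)\mapsto\delta_{ij}+\sum_{a,b=1}^m\big(x+\theta\tfrac m2+\theta E\big)^{-1}_{ab}\otimes x_{ai}\,\partial_{bj}.$$ (ii) The subalgebra of $\mathrm{GL}_m$-invariant elements in $A$ coincides with the subalgebra generated by $U(\mathfrak{gl}_m)^{\mathrm{GL}_m}\otimes1$ and by the image of the homomorphism in (i).
   Context: $Y(\mathfrak{gl}_n)$ is the unital associative complex algebra with generators $T^{(1)}_{ij},T^{(2)}_{ij},\dots$ ($1\le i,j\le n$) and relations $(x-y)[T_{ij}(x),T_{kl}(y)]=T_{kj}(x)T_{il}(y)-T_{kj}(y)T_{il}(x)$, where $T_{ij}(x)=\delta_{ij}+\sum_{s\ge1}T^{(s)}_{ij}x^{-s}$. $H(U)$ is the Weyl algebra ($\theta=1$) or the Clifford algebra ($\theta=-1$) of $U\oplus U^*$: it is generated by $x_{ai},\partial_{ai}$ ($1\le a\le m$, $1\le i\le n$; $x_{ai}=e_a\otimes f_i$ is the standard basis of $U$ and $\partial_{ai}$ the dual basis of $U^*$) with relations $x_{bj}x_{ai}=\theta x_{ai}x_{bj}$, $\partial_{bj}\partial_{ai}=\theta\partial_{ai}\partial_{bj}$, $\partial_{bj}x_{ai}-\theta x_{ai}\partial_{bj}=\delta_{ab}\delta_{ij}$.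 $\mathrm{GL}_m$ acts diagonally on $A$ by automorphisms: by the adjoint action on $U(\mathfrak{gl}_m)$ and on $H(U)$ through its natural action on $U=\mathbb C^m\otimes\mathbb C^n$ (via $\mathbb C^m$) and on $U^*$. $U(\mathfrak{gl}_m)^{\mathrm{GL}_m}$ is the subalgebra of invariants (the centre of $U(\mathfrak{gl}_m)$). $E$ is the $m\times m$ matrix whose $(a,b)$ entry is the matrix unit $E_{ba}\in\mathfrak{gl}_m$ (note the transposition). For a scalar $c$, the inverse matrix $(x+c+\theta E)^{-1}$ is regarded as a formal power series in $x^{-1}$ with coefficients in $m\times m$ matrices over $U(\mathfrak{gl}_m)$, and the subscript $ab$ denotes its $(a,b)$ entry. The assignment in (i) is a correspondence between the respective coefficients of series in $x^{-1}$. *)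

theory Defs
  imports
    "HOL-Analysis.Analysis"
    "HOL-Library.Poly_Mapping"
    "HOL-Computational_Algebra.Formal_Laurent_Series"
begin

no_notation fps_nth (infixl \<open>$\<close> 75)

section \<open>Unital associative complex algebras\<close>

text \<open>
  The class \<^class>\<open>ring_1\<close> demands \<open>0 \<noteq> 1\<close>; a quotient of an algebra may be trivial, hence
  \<^class>\<open>ring\<close> and \<^class>\<open>monoid_mult\<close> here.
\<close>

class complex_algebra = ring + monoid_mult +
  fixes scaleC :: "complex \<Rightarrow> 'a \<Rightarrow> 'a"  (infixr \<open>*\<^sub>C\<close> 75)
  assumes scaleC_add_right: "c *\<^sub>C (x + y) = c *\<^sub>C x + c *\<^sub>C y"
    and scaleC_add_left: "(c + d) *\<^sub>C x = c *\<^sub>C x + d *\<^sub>C x"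
    and scaleC_scaleC: "c *\<^sub>C d *\<^sub>C x = (c * d) *\<^sub>C x"
    and scaleC_one: "1 *\<^sub>C x = x"
    and mult_scaleC_left: "(c *\<^sub>C x) * y = c *\<^sub>C (x * y)"
    and mult_scaleC_right: "x * (c *\<^sub>C y) = c *\<^sub>C (x * y)"
begin

lemma scaleC_zero_left [simp]: "0 *\<^sub>C x = 0"
  using scaleC_add_left[of 0 0 x] by simp

lemma scaleC_zero_right [simp]: "c *\<^sub>C 0 = 0"
  using scaleC_add_right[of c 0 0] by simp

lemma scaleC_minus_left: "(- c) *\<^sub>C x = - (c *\<^sub>C x)"
  using scaleC_add_left[of c "- c" x] by (simp add: eq_neg_iff_add_eq_0 add.commute)

lemma scaleC_minus_right: "c *\<^sub>C (- x) = - (c *\<^sub>C x)"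
  using scaleC_add_right[of c x "- x"] by (simp add: eq_neg_iff_add_eq_0 add.commute)

lemma scaleC_diff_right: "c *\<^sub>C (x - y) = c *\<^sub>C x - c *\<^sub>C y"
  using scaleC_add_right[of c x "- y"] by (simp add: scaleC_minus_right)

lemma scaleC_sum_right: "c *\<^sub>C sum f I = (\<Sum>i\<in>I. c *\<^sub>C f i)"
  by (induction I rule: infinite_finite_induct) (simp_all add: scaleC_add_right)

lemma scaleC_sum_left: "sum f I *\<^sub>C x = (\<Sum>i\<in>I. f i *\<^sub>C x)"
  by (induction I rule: infinite_finite_induct) (simp_all add: scaleC_add_left)

end

instantiation complex :: complex_algebra
begin

definition scaleC_complex :: "complex \<Rightarrow> complex \<Rightarrow> complex" where
  "scaleC_complex = (*)"

instance by standard (simp_all add: scaleC_complex_def algebra_simps)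

end

definition alg_hom :: "('a::complex_algebra \<Rightarrow> 'b::complex_algebra) \<Rightarrow> bool" where
  "alg_hom f \<longleftrightarrow>
     (\<forall>x y. f (x + y) = f x + f y) \<and> (\<forall>c x. f (c *\<^sub>C x) = c *\<^sub>C f x) \<and>
     (\<forall>x y. f (x * y) = f x * f y) \<and> f 1 = 1"

definition complex_subalgebra :: "'a::complex_algebra set \<Rightarrow> bool" where
  "complex_subalgebra B \<longleftrightarrow>
     1 \<in> B \<and> (\<forall>x\<in>B. \<forall>y\<in>B. x + y \<in> B \<and> x * y \<in> B) \<and> (\<forall>c. \<forall>x\<in>B. c *\<^sub>C x \<in> B)"

inductive_set two_sided_ideal :: "'a::ring_1 set \<Rightarrow> 'a set" for R where
  zero: "0 \<in> two_sided_ideal R"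
| mem: "r \<in> R \<Longrightarrow> u * r * v \<in> two_sided_ideal R"
| add: "x \<in> two_sided_ideal R \<Longrightarrow> y \<in> two_sided_ideal R \<Longrightarrow> x + y \<in> two_sided_ideal R"

lemma two_sided_ideal_mult_left:
  "x \<in> two_sided_ideal R \<Longrightarrow> a * x \<in> two_sided_ideal R"
proof (induction rule: two_sided_ideal.induct)
  case (mem r u v)
  then show ?case using two_sided_ideal.mem[of r R "a * u" v] by (simp add: mult.assoc)
qed (auto simp: distrib_left intro: two_sided_ideal.intros)

lemma two_sided_ideal_mult_right:
  "x \<in> two_sided_ideal R \<Longrightarrow> x * a \<in> two_sided_ideal R"
proof (induction rule: two_sided_ideal.induct)
  case (mem r u v)
  then show ?case using two_sided_ideal.mem[of r R u "v * a"] by (simp add: mult.assoc)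
qed (auto simp: distrib_right intro: two_sided_ideal.intros)

lemma two_sided_ideal_uminus:
  "x \<in> two_sided_ideal R \<Longrightarrow> - x \<in> two_sided_ideal R"
  using two_sided_ideal_mult_left[of x R "- 1"] by simp

lemma two_sided_ideal_diff:
  "x \<in> two_sided_ideal R \<Longrightarrow> y \<in> two_sided_ideal R \<Longrightarrow> x - y \<in> two_sided_ideal R"
  using two_sided_ideal.add[of x R "- y"] two_sided_ideal_uminus[of y R] by simp


section \<open>Quotients of monoid algebras\<close>

text \<open>
  For a monoid \<open>'w\<close>, written additively, \<open>'w \<Rightarrow>\<^sub>0 complex\<close> with the convolution product of
  \<^theory>\<open>HOL-Library.Poly_Mapping\<close> is the complex monoid algebra of \<open>'w\<close>: \<open>single w 1\<close> is the
  basis element of \<open>w\<close>, and \<open>single 0 c\<close> is the scalar \<open>c\<close>. The class fixes the relations by which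
  it is divided.
\<close>

class alg_relations = monoid_add +
  fixes alg_relations :: "('a \<Rightarrow>\<^sub>0 complex) set"

definition lin_ext :: "('w \<Rightarrow> 'b::complex_algebra) \<Rightarrow> ('w \<Rightarrow>\<^sub>0 complex) \<Rightarrow> 'b" where
  "lin_ext f p = (\<Sum>w\<in>Poly_Mapping.keys p. Poly_Mapping.lookup p w *\<^sub>C f w)"

lemma poly_mapping_sum_single:
  "p = (\<Sum>k\<in>Poly_Mapping.keys p. Poly_Mapping.single k (Poly_Mapping.lookup p k))" for p :: "'w \<Rightarrow>\<^sub>0 complex"
proof (rule poly_mapping_eqI)
  fix k
  have "(\<Sum>x\<in>Poly_Mapping.keys p. if x = k then Poly_Mapping.lookup p x else 0) = Poly_Mapping.lookup p k"
    by (simp add: sum.delta in_keys_iff)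
  then show "Poly_Mapping.lookup p k = Poly_Mapping.lookup (\<Sum>x\<in>Poly_Mapping.keys p. Poly_Mapping.single x (Poly_Mapping.lookup p x)) k"
    by (simp add: lookup_sum lookup_single when_def)
qed

lemma single_zero_central:
  "Poly_Mapping.single 0 c * p = p * Poly_Mapping.single 0 (c :: complex)"
  for p :: "'w::monoid_add \<Rightarrow>\<^sub>0 complex"
  by (subst (1 2) poly_mapping_sum_single[of p])
    (simp add: sum_distrib_left sum_distrib_right mult_single mult.commute)

lemma lin_ext_superset:
  assumes "finite S" "Poly_Mapping.keys p \<subseteq> S"
  shows "lin_ext f p = (\<Sum>w\<in>S. Poly_Mapping.lookup p w *\<^sub>C f w)"
  unfolding lin_ext_def using assms by (intro sum.mono_neutral_left) (auto simp: in_keys_iff)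

lemma lin_ext_zero [simp]: "lin_ext f 0 = 0"
  by (simp add: lin_ext_def)

lemma lin_ext_add: "lin_ext f (p + q) = lin_ext f p + lin_ext f q"
proof -
  let ?S = "Poly_Mapping.keys p \<union> Poly_Mapping.keys q"
  have "lin_ext f r = (\<Sum>w\<in>?S. Poly_Mapping.lookup r w *\<^sub>C f w)" if "r \<in> {p, q, p + q}" for r
    using that keys_add[of p q] by (intro lin_ext_superset) auto
  then show ?thesis by (simp add: lookup_add scaleC_add_left sum.distrib)
qed

lemma lin_ext_diff: "lin_ext f (p - q) = lin_ext f p - lin_ext f q"
  using lin_ext_add[of f "p - q" q] by simp

lemma lin_ext_sum: "lin_ext f (\<Sum>i\<in>I. p i) = (\<Sum>i\<in>I. lin_ext f (p i))"
  by (induction I rule: infinite_finite_induct) (simp_all add: lin_ext_add)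

lemma lin_ext_single: "lin_ext f (Poly_Mapping.single w c) = c *\<^sub>C f w"
  by (simp add: lin_ext_def)

lemma lin_ext_mult:
  assumes "\<And>u v. f (u + v) = f u * f v"
  shows "lin_ext f (p * q) = lin_ext f p * lin_ext f q"
proof -
  have "p * q = (\<Sum>k\<in>Poly_Mapping.keys p. \<Sum>l\<in>Poly_Mapping.keys q.
      Poly_Mapping.single (k + l) (Poly_Mapping.lookup p k * Poly_Mapping.lookup q l))"
    by (subst (1) poly_mapping_sum_single[of p], subst (1) poly_mapping_sum_single[of q])
      (simp only: sum_product mult_single)
  then have "lin_ext f (p * q) = (\<Sum>k\<in>Poly_Mapping.keys p. \<Sum>l\<in>Poly_Mapping.keys q.
      (Poly_Mapping.lookup p k * Poly_Mapping.lookup q l) *\<^sub>C (f k * f l))"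
    by (simp only: lin_ext_sum lin_ext_single assms)
  also have "\<dots> = lin_ext f p * lin_ext f q"
    unfolding lin_ext_def sum_product
    by (simp add: mult_scaleC_left mult_scaleC_right scaleC_scaleC mult.commute)
  finally show ?thesis .
qed

lemma lin_ext_two_sided_ideal:
  assumes "\<And>u v. f (u + v) = f u * f v" "\<And>r. r \<in> R \<Longrightarrow> lin_ext f r = 0"
    and "p \<in> two_sided_ideal R"
  shows "lin_ext f p = 0"
  using assms(3)
  by (induction rule: two_sided_ideal.induct) (simp_all add: lin_ext_add lin_ext_mult assms(1,2))

quotient_type (overloaded) 'w alg_quot = "'w::alg_relations \<Rightarrow>\<^sub>0 complex" /
  "\<lambda>p q. p - q \<in> two_sided_ideal alg_relations"
proof (rule equivpI)
  let ?I = "two_sided_ideal (alg_relations :: ('w \<Rightarrow>\<^sub>0 complex) set)"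
  show "reflp (\<lambda>p q. p - q \<in> ?I)"
    by (auto simp: reflp_def intro: two_sided_ideal.intros)
  show "symp (\<lambda>p q. p - q \<in> ?I)"
  proof (rule sympI)
    fix p q assume "p - q \<in> ?I"
    from two_sided_ideal_uminus[OF this] show "q - p \<in> ?I" by simp
  qed
  show "transp (\<lambda>p q. p - q \<in> ?I)"
  proof (rule transpI)
    fix p q r assume "p - q \<in> ?I" "q - r \<in> ?I"
    from two_sided_ideal.add[OF this] show "p - r \<in> ?I" by simp
  qed
qed

instantiation alg_quot :: (alg_relations) complex_algebra
begin

lift_definition zero_alg_quot :: "'a alg_quot" is 0 .
lift_definition one_alg_quot :: "'a alg_quot" is 1 .
lift_definition plus_alg_quot :: "'a alg_quot \<Rightarrow> 'a alg_quot \<Rightarrow> 'a alg_quot" is "(+)"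
  by (metis two_sided_ideal.add add_diff_add)
lift_definition minus_alg_quot :: "'a alg_quot \<Rightarrow> 'a alg_quot \<Rightarrow> 'a alg_quot" is "(-)"
proof -
  fix p q r s :: "'a \<Rightarrow>\<^sub>0 complex"
  assume "p - q \<in> two_sided_ideal alg_relations" "r - s \<in> two_sided_ideal alg_relations"
  from two_sided_ideal_diff[OF this]
  show "p - r - (q - s) \<in> two_sided_ideal alg_relations" by (simp add: algebra_simps)
qed
lift_definition uminus_alg_quot :: "'a alg_quot \<Rightarrow> 'a alg_quot" is uminus
  by (metis two_sided_ideal_uminus minus_diff_minus)
lift_definition times_alg_quot :: "'a alg_quot \<Rightarrow> 'a alg_quot \<Rightarrow> 'a alg_quot" is "(*)"
proof -
  fix p q r s :: "'a \<Rightarrow>\<^sub>0 complex"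
  assume *: "p - q \<in> two_sided_ideal alg_relations" "r - s \<in> two_sided_ideal alg_relations"
  have "p * r - q * s = (p - q) * r + q * (r - s)" by (simp add: algebra_simps)
  then show "p * r - q * s \<in> two_sided_ideal alg_relations"
    using * by (auto intro: two_sided_ideal.add two_sided_ideal_mult_left two_sided_ideal_mult_right)
qed
lift_definition scaleC_alg_quot :: "complex \<Rightarrow> 'a alg_quot \<Rightarrow> 'a alg_quot"
  is "\<lambda>c p. Poly_Mapping.single 0 c * p"
  by (metis two_sided_ideal_mult_left right_diff_distrib)

instance
proof
  have refl: "x = y \<Longrightarrow> x - y \<in> two_sided_ideal alg_relations" for x y :: "'a \<Rightarrow>\<^sub>0 complex"
    by (simp add: two_sided_ideal.zero)
  fix a b c :: "'a alg_quot" and s t :: complex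
  show "a * b * c = a * (b * c)" by transfer (rule refl, simp add: mult.assoc)
  show "1 * a = a" by transfer (rule refl, simp)
  show "a * 1 = a" by transfer (rule refl, simp)
  show "a + b + c = a + (b + c)" by transfer (rule refl, simp add: add.assoc)
  show "a + b = b + a" by transfer (rule refl, simp add: add.commute)
  show "0 + a = a" by transfer (rule refl, simp)
  show "- a + a = 0" by transfer (rule refl, simp)
  show "a - b = a + - b" by transfer (rule refl, simp)
  show "(a + b) * c = a * c + b * c" by transfer (rule refl, simp add: distrib_right)
  show "a * (b + c) = a * b + a * c" by transfer (rule refl, simp add: distrib_left)
  show "s *\<^sub>C (a + b) = s *\<^sub>C a + s *\<^sub>C b" by transfer (rule refl, simp add: distrib_left)
  show "(s + t) *\<^sub>C a = s *\<^sub>C a + t *\<^sub>C a"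
    by transfer (rule refl, simp add: distrib_right single_add)
  show "s *\<^sub>C t *\<^sub>C a = (s * t) *\<^sub>C a"
    by transfer (rule refl, simp add: mult.assoc[symmetric] mult_single)
  show "1 *\<^sub>C a = a" by transfer (rule refl, simp)
  show "(s *\<^sub>C a) * b = s *\<^sub>C (a * b)" by transfer (rule refl, simp add: mult.assoc)
  show "a * (s *\<^sub>C b) = s *\<^sub>C (a * b)"
    by transfer (rule refl, metis mult.assoc single_zero_central)
qed

end

text \<open>
  The linear map on the quotient that takes the values \<open>f w\<close> on the basis elements. It is well
  defined whenever \<open>f\<close> is multiplicative and its linear extension kills the relations.
\<close>

definition quot_lift :: "('w::alg_relations \<Rightarrow> 'b::complex_algebra) \<Rightarrow> 'w alg_quot \<Rightarrow> 'b" where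
  "quot_lift f x = lin_ext f (rep_alg_quot x)"

definition basis_elem :: "'w::alg_relations \<Rightarrow> 'w alg_quot" where
  "basis_elem w = abs_alg_quot (Poly_Mapping.single w 1)"

lemma abs_alg_quot_eq_iff:
  "abs_alg_quot p = abs_alg_quot q \<longleftrightarrow> p - q \<in> two_sided_ideal alg_relations"
  using Quotient_rel[OF Quotient_alg_quot, of p q]
  by (simp add: two_sided_ideal.zero)

lemma
  fixes f :: "'w::alg_relations \<Rightarrow> 'b::complex_algebra"
  assumes f: "\<And>u v. f (u + v) = f u * f v" "f 0 = 1"
    and rels: "\<And>r. r \<in> alg_relations \<Longrightarrow> lin_ext f r = 0"
  shows quot_lift_abs: "quot_lift f (abs_alg_quot p) = lin_ext f p"
    and quot_lift_basis_elem: "quot_lift f (basis_elem w) = f w"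
    and quot_lift_alg_hom: "alg_hom (quot_lift f)"
proof -
  show *: "quot_lift f (abs_alg_quot p) = lin_ext f p" for p
  proof -
    have "abs_alg_quot (rep_alg_quot (abs_alg_quot p)) = abs_alg_quot p"
      by (rule Quotient_abs_rep[OF Quotient_alg_quot])
    then have "lin_ext f (rep_alg_quot (abs_alg_quot p) - p) = 0"
      unfolding abs_alg_quot_eq_iff
      using lin_ext_two_sided_ideal[of f alg_relations] f(1) rels by blast
    then show ?thesis by (simp add: quot_lift_def lin_ext_diff)
  qed
  show "quot_lift f (basis_elem w) = f w"
    by (simp add: basis_elem_def * lin_ext_single scaleC_one)
  show "alg_hom (quot_lift f)"
    unfolding alg_hom_def
  proof (intro conjI allI)
    fix x y :: "'w alg_quot" and c
    obtain p q where pq: "x = abs_alg_quot p" "y = abs_alg_quot q"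
      by (metis Quotient_abs_rep[OF Quotient_alg_quot])
    show "quot_lift f (x + y) = quot_lift f x + quot_lift f y"
      by (simp add: pq plus_alg_quot.abs_eq * lin_ext_add)
    show "quot_lift f (x * y) = quot_lift f x * quot_lift f y"
      by (simp add: pq times_alg_quot.abs_eq * lin_ext_mult f)
    show "quot_lift f (c *\<^sub>C x) = c *\<^sub>C quot_lift f x"
      by (simp add: pq scaleC_alg_quot.abs_eq * lin_ext_mult f lin_ext_single mult_scaleC_left)
  next
    show "quot_lift f 1 = 1"
      using lin_ext_single[of f 0 1]
      by (simp add: one_alg_quot_def * f scaleC_one)
  qed
qed

text \<open>A character that kills the relations shows that the quotient is not trivial.\<close>

class augmented_relations = alg_relations +
  fixes augmentation :: "'a \<Rightarrow> complex"
  assumes augmentation_add: "augmentation (u + v) = augmentation u * augmentation v"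
    and augmentation_zero: "augmentation 0 = 1"
    and augmentation_relation: "r \<in> alg_relations \<Longrightarrow> lin_ext augmentation r = 0"

instance alg_quot :: (augmented_relations) ring_1
proof
  let ?f = "quot_lift (augmentation :: 'a \<Rightarrow> complex)"
  have "alg_hom ?f"
    by (rule quot_lift_alg_hom)
      (simp_all add: augmentation_add augmentation_zero augmentation_relation)
  then have "?f 0 = 0" "?f 1 = 1"
    by (metis alg_hom_def add_cancel_right_right, simp add: alg_hom_def)
  then show "(0 :: 'a alg_quot) \<noteq> 1" by auto
qed


section \<open>Algebras given by generators and relations\<close>

text \<open>Words over \<open>'g\<close> form the free monoid, so \<open>'g free_word \<Rightarrow>\<^sub>0 complex\<close> is the free algebra.\<close>

datatype 'g free_word = Free_Word (letters: "'g list")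

instantiation free_word :: (type) monoid_add
begin

definition zero_free_word :: "'a free_word" where "0 = Free_Word []"
definition plus_free_word :: "'a free_word \<Rightarrow> 'a free_word \<Rightarrow> 'a free_word" where
  "u + v = Free_Word (letters u @ letters v)"

instance by standard (auto simp: zero_free_word_def plus_free_word_def)

end

type_synonym 'g free_algebra = "'g free_word \<Rightarrow>\<^sub>0 complex"

definition free_gen :: "'g \<Rightarrow> 'g free_algebra" where
  "free_gen g = Poly_Mapping.single (Free_Word [g]) 1"

definition free_scalar :: "complex \<Rightarrow> 'g free_algebra" where
  "free_scalar c = Poly_Mapping.single 0 c"

class presentation =
  fixes presentation_relations :: "'a free_algebra set"

instantiation free_word :: (presentation) alg_relations
begin
definition alg_relations_free_word :: "'a free_algebra set" where
  "alg_relations_free_word = presentation_relations"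
instance ..
end

type_synonym 'g presented = "'g free_word alg_quot"

definition gen :: "'g::presentation \<Rightarrow> 'g presented" where
  "gen g = basis_elem (Free_Word [g])"

definition word_eval :: "('g \<Rightarrow> 'b::monoid_mult) \<Rightarrow> 'g free_word \<Rightarrow> 'b" where
  "word_eval f w = prod_list (map f (letters w))"

lemma word_eval_simps [simp]:
  "word_eval f (u + v) = word_eval f u * word_eval f v" "word_eval f 0 = 1"
  "word_eval f (Free_Word gs) = prod_list (map f gs)"
  by (simp_all add: word_eval_def plus_free_word_def zero_free_word_def)

text \<open>The homomorphism out of a presented algebra with prescribed values on the generators.\<close>

definition present_lift :: "('g::presentation \<Rightarrow> 'b::complex_algebra) \<Rightarrow> 'g presented \<Rightarrow> 'b" where
  "present_lift f = quot_lift (word_eval f)"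

definition free_eval :: "('g \<Rightarrow> 'b::complex_algebra) \<Rightarrow> 'g free_algebra \<Rightarrow> 'b" where
  "free_eval f = lin_ext (word_eval f)"

lemma free_eval_simps [simp]:
  "free_eval f (p + q) = free_eval f p + free_eval f q"
  "free_eval f (p - q) = free_eval f p - free_eval f q"
  "free_eval f (p * q) = free_eval f p * free_eval f q"
  "free_eval f (free_gen g) = f g"
  "free_eval f (free_scalar c) = c *\<^sub>C 1"
  "free_eval f 0 = 0"
  "free_eval f 1 = 1"
  using lin_ext_single[of "word_eval f" 0 1]
  by (simp_all add: free_eval_def lin_ext_add lin_ext_diff lin_ext_mult lin_ext_single scaleC_one
      free_gen_def free_scalar_def)

lemma
  assumes "\<And>r. r \<in> presentation_relations \<Longrightarrow> free_eval f r = 0"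
  shows present_lift_gen: "present_lift f (gen g) = f g"
    and present_lift_alg_hom: "alg_hom (present_lift f)"
proof -
  have rels: "lin_ext (word_eval f) r = 0" if "r \<in> alg_relations" for r
    using assms[of r] that by (simp add: alg_relations_free_word_def free_eval_def)
  show "present_lift f (gen g) = f g"
    unfolding present_lift_def gen_def
    by (subst quot_lift_basis_elem) (simp_all add: rels)
  show "alg_hom (present_lift f)"
    unfolding present_lift_def by (rule quot_lift_alg_hom) (simp_all add: rels)
qed

lemma abs_alg_quot_free_gen: "abs_alg_quot (free_gen g) = gen g"
  by (simp add: free_gen_def gen_def basis_elem_def)

lemma abs_alg_quot_free_scalar: "abs_alg_quot (free_scalar c) = c *\<^sub>C 1"
  by (simp add: free_scalar_def scaleC_alg_quot.abs_eq one_alg_quot_def)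

lemma relation_zero: "r \<in> presentation_relations \<Longrightarrow> abs_alg_quot r = 0"
  using two_sided_ideal.mem[of r alg_relations 1 1]
  by (simp add: zero_alg_quot_def abs_alg_quot_eq_iff alg_relations_free_word_def)

text \<open>A presentation whose relations have no constant term defines a nontrivial algebra.\<close>

class augmented_presentation = presentation +
  assumes augmentation_relation_free: "r \<in> presentation_relations \<Longrightarrow> free_eval (\<lambda>_. 0 :: complex) r = 0"

instantiation free_word :: (augmented_presentation) augmented_relations
begin

definition augmentation_free_word :: "'a free_word \<Rightarrow> complex" where
  "augmentation_free_word = word_eval (\<lambda>_. 0)"

instance
proof
  fix r :: "'a free_algebra"
  assume "r \<in> alg_relations"
  then show "lin_ext augmentation r = 0"
    using augmentation_relation_free[of r]
    by (simp add: alg_relations_free_word_def augmentation_free_word_def free_eval_def)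
qed (simp_all add: augmentation_free_word_def)

end


section \<open>Tensor products of algebras\<close>

text \<open>
  The multiplicative monoid of pairs, written additively. Its monoid algebra is the free vector space
  on pairs with \<open>(a, b) (a', b') = (a a', b b')\<close>. Multiplying a bilinearity relation by a pair yields
  a bilinearity relation again, so that the ideal below is the linear span of these relations and the
  quotient is the usual tensor product (without a sign in the multiplication).
\<close>

datatype ('a, 'b) tensor_pair = Tensor_Pair (pair_fst: 'a) (pair_snd: 'b)

instantiation tensor_pair :: (monoid_mult, monoid_mult) monoid_add
begin

definition zero_tensor_pair :: "('a, 'b) tensor_pair" where "0 = Tensor_Pair 1 1"
definition plus_tensor_pair :: "('a, 'b) tensor_pair \<Rightarrow> ('a, 'b) tensor_pair \<Rightarrow> ('a, 'b) tensor_pair" where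
  "u + v = Tensor_Pair (pair_fst u * pair_fst v) (pair_snd u * pair_snd v)"

instance by standard (auto simp: zero_tensor_pair_def plus_tensor_pair_def mult.assoc)

end

definition free_pair :: "'a \<Rightarrow> 'b \<Rightarrow> ('a, 'b) tensor_pair \<Rightarrow>\<^sub>0 complex" where
  "free_pair a b = Poly_Mapping.single (Tensor_Pair a b) 1"

instantiation tensor_pair :: (complex_algebra, complex_algebra) alg_relations
begin

definition alg_relations_tensor_pair :: "(('a, 'b) tensor_pair \<Rightarrow>\<^sub>0 complex) set" where
  "alg_relations_tensor_pair =
     {free_pair (a + a') b - free_pair a b - free_pair a' b | a a' b. True} \<union>
     {free_pair a (b + b') - free_pair a b - free_pair a b' | a b b'. True} \<union>
     {free_pair (c *\<^sub>C a) b - Poly_Mapping.single 0 c * free_pair a b | c a b. True} \<union>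
     {free_pair a (c *\<^sub>C b) - Poly_Mapping.single 0 c * free_pair a b | c a b. True}"

instance ..

end

type_synonym ('a, 'b) tensor = "('a, 'b) tensor_pair alg_quot"

definition pure_tensor ::
    "'a::complex_algebra \<Rightarrow> 'b::complex_algebra \<Rightarrow> ('a, 'b) tensor"  (infixr \<open>\<otimes>\<close> 76) where
  "a \<otimes> b = basis_elem (Tensor_Pair a b)"

lemma tensor_relation_zero:
  "r \<in> alg_relations \<Longrightarrow> abs_alg_quot r = 0"
  using two_sided_ideal.mem[of r alg_relations 1 1]
  by (simp add: zero_alg_quot_def abs_alg_quot_eq_iff)

lemma abs_free_pair: "abs_alg_quot (free_pair a b) = a \<otimes> b"
  by (simp add: free_pair_def pure_tensor_def basis_elem_def)

lemma
  fixes a a' :: "'a::complex_algebra" and b b' :: "'b::complex_algebra"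
  shows tensor_add_left: "(a + a') \<otimes> b = a \<otimes> b + a' \<otimes> b"
    and tensor_add_right: "a \<otimes> (b + b') = a \<otimes> b + a \<otimes> b'"
    and tensor_scaleC_left: "(c *\<^sub>C a) \<otimes> b = c *\<^sub>C (a \<otimes> b)"
    and tensor_scaleC_right: "a \<otimes> (c *\<^sub>C b) = c *\<^sub>C (a \<otimes> b)"
    and tensor_mult: "(a \<otimes> b) * (a' \<otimes> b') = (a * a') \<otimes> (b * b')"
    and tensor_one: "1 \<otimes> 1 = (1 :: ('a, 'b) tensor)"
proof -
  have 1: "free_pair (a + a') b - free_pair a b - free_pair a' b \<in> alg_relations"
    unfolding alg_relations_tensor_pair_def by blast
  show "(a + a') \<otimes> b = a \<otimes> b + a' \<otimes> b"
    using tensor_relation_zero[OF 1]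
    by (simp add: minus_alg_quot.abs_eq[symmetric] plus_alg_quot.abs_eq[symmetric] abs_free_pair algebra_simps)
  have 2: "free_pair a (b + b') - free_pair a b - free_pair a b' \<in> alg_relations"
    unfolding alg_relations_tensor_pair_def by blast
  show "a \<otimes> (b + b') = a \<otimes> b + a \<otimes> b'"
    using tensor_relation_zero[OF 2]
    by (simp add: minus_alg_quot.abs_eq[symmetric] plus_alg_quot.abs_eq[symmetric] abs_free_pair algebra_simps)
  have 3: "free_pair (c *\<^sub>C a) b - Poly_Mapping.single 0 c * free_pair a b \<in> alg_relations"
    unfolding alg_relations_tensor_pair_def by blast
  show "(c *\<^sub>C a) \<otimes> b = c *\<^sub>C (a \<otimes> b)"
    using tensor_relation_zero[OF 3]
    by (simp add: minus_alg_quot.abs_eq[symmetric] plus_alg_quot.abs_eq[symmetric] scaleC_alg_quot.abs_eq[symmetric] abs_free_pair)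
  have 4: "free_pair a (c *\<^sub>C b) - Poly_Mapping.single 0 c * free_pair a b \<in> alg_relations"
    unfolding alg_relations_tensor_pair_def by blast
  show "a \<otimes> (c *\<^sub>C b) = c *\<^sub>C (a \<otimes> b)"
    using tensor_relation_zero[OF 4]
    by (simp add: minus_alg_quot.abs_eq[symmetric] plus_alg_quot.abs_eq[symmetric] scaleC_alg_quot.abs_eq[symmetric] abs_free_pair)
  show "(a \<otimes> b) * (a' \<otimes> b') = (a * a') \<otimes> (b * b')"
    by (simp add: pure_tensor_def basis_elem_def times_alg_quot.abs_eq mult_single plus_tensor_pair_def)
  have "free_pair 1 1 = (1 :: ('a, 'b) tensor_pair \<Rightarrow>\<^sub>0 complex)"
    by (simp add: free_pair_def zero_tensor_pair_def[symmetric])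
  then show "1 \<otimes> 1 = (1 :: ('a, 'b) tensor)"
    by (simp add: abs_free_pair[symmetric] one_alg_quot_def)
qed

definition tensor_map ::
    "('a::complex_algebra \<Rightarrow> 'c::complex_algebra) \<Rightarrow> ('b::complex_algebra \<Rightarrow> 'd::complex_algebra) \<Rightarrow>
     ('a, 'b) tensor \<Rightarrow> ('c, 'd) tensor" where
  "tensor_map f g = quot_lift (\<lambda>u. f (pair_fst u) \<otimes> g (pair_snd u))"

lemma
  assumes f: "alg_hom f" and g: "alg_hom g"
  shows tensor_map_pure: "tensor_map f g (a \<otimes> b) = f a \<otimes> g b"
    and tensor_map_alg_hom: "alg_hom (tensor_map f g)"
proof -
  let ?h = "\<lambda>u. f (pair_fst u) \<otimes> g (pair_snd u)"
  have mult: "?h (u + v) = ?h u * ?h v" for u v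
    using f g by (simp add: plus_tensor_pair_def tensor_mult alg_hom_def)
  have one: "?h 0 = 1"
    using f g by (simp add: zero_tensor_pair_def tensor_one alg_hom_def)
  have rels: "lin_ext ?h r = 0" if "r \<in> alg_relations" for r
    using that f g
    by (auto simp: alg_relations_tensor_pair_def free_pair_def lin_ext_diff lin_ext_mult[OF mult]
        lin_ext_single one scaleC_one mult_scaleC_left tensor_add_left tensor_add_right
        tensor_scaleC_left tensor_scaleC_right alg_hom_def)
  show "tensor_map f g (a \<otimes> b) = f a \<otimes> g b"
    unfolding tensor_map_def pure_tensor_def[of a b]
    using quot_lift_basis_elem[of ?h, OF mult one rels] by simp
  show "alg_hom (tensor_map f g)"
    unfolding tensor_map_def by (rule quot_lift_alg_hom[of ?h, OF mult one rels])
qed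


section \<open>The universal enveloping algebra of \<open>gl_m\<close>\<close>

text \<open>
  The generators are all elements of the Lie algebra \<open>gl_m\<close>. The first two families of relations
  turn the free algebra on the set \<open>gl_m\<close> into the tensor algebra of the vector space \<open>gl_m\<close>.
\<close>

datatype ('m::finite) gl_gen = GL_Gen "complex^'m^'m"

definition scale_mat :: "complex \<Rightarrow> complex^'m^'m \<Rightarrow> complex^'m^'m" where
  "scale_mat c M = (\<chi> a b. c * M $ a $ b)"

instantiation gl_gen :: (finite) augmented_presentation
begin

definition presentation_relations_gl_gen :: "'a gl_gen free_algebra set" where
  "presentation_relations_gl_gen =
     {free_gen (GL_Gen (M + N)) - free_gen (GL_Gen M) - free_gen (GL_Gen N) | M N. True} \<union>
     {free_gen (GL_Gen (scale_mat c M)) - free_scalar c * free_gen (GL_Gen M) | c M. True} \<union>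
     {free_gen (GL_Gen M) * free_gen (GL_Gen N) - free_gen (GL_Gen N) * free_gen (GL_Gen M)
        - free_gen (GL_Gen (M ** N - N ** M)) | M N. True}"

instance by standard (auto simp: presentation_relations_gl_gen_def)

end

type_synonym 'm Ugl = "'m gl_gen presented"

definition gl_incl :: "complex^'m^'m \<Rightarrow> ('m::finite) Ugl" where
  "gl_incl M = gen (GL_Gen M)"

definition mat_unit :: "'m \<Rightarrow> 'm \<Rightarrow> complex^'m^'m" where
  "mat_unit a b = (\<chi> c d. if c = a \<and> d = b then 1 else 0)"

definition U_E :: "'m::finite \<Rightarrow> 'm \<Rightarrow> 'm Ugl" where
  "U_E a b = gl_incl (mat_unit a b)"

lemma gl_incl_add: "gl_incl (M + N) = gl_incl M + gl_incl N"
  and gl_incl_scale: "gl_incl (scale_mat c M) = c *\<^sub>C gl_incl M"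
  and gl_incl_bracket: "gl_incl (M ** N - N ** M) = gl_incl M * gl_incl N - gl_incl N * gl_incl M"
proof -
  have 1: "free_gen (GL_Gen (M + N)) - free_gen (GL_Gen M) - free_gen (GL_Gen N)
      \<in> presentation_relations"
    unfolding presentation_relations_gl_gen_def by blast
  show "gl_incl (M + N) = gl_incl M + gl_incl N"
    using relation_zero[OF 1] by (simp add: minus_alg_quot.abs_eq[symmetric] plus_alg_quot.abs_eq[symmetric]
        abs_alg_quot_free_gen gl_incl_def algebra_simps)
  have 2: "free_gen (GL_Gen (scale_mat c M)) - free_scalar c * free_gen (GL_Gen M)
      \<in> presentation_relations"
    unfolding presentation_relations_gl_gen_def by blast
  show "gl_incl (scale_mat c M) = c *\<^sub>C gl_incl M"
    using relation_zero[OF 2] by (simp add: minus_alg_quot.abs_eq[symmetric] plus_alg_quot.abs_eq[symmetric]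
        times_alg_quot.abs_eq[symmetric] abs_alg_quot_free_gen abs_alg_quot_free_scalar
        gl_incl_def mult_scaleC_left)
  have 3: "free_gen (GL_Gen M) * free_gen (GL_Gen N) - free_gen (GL_Gen N) * free_gen (GL_Gen M)
        - free_gen (GL_Gen (M ** N - N ** M)) \<in> presentation_relations"
    unfolding presentation_relations_gl_gen_def by blast
  show "gl_incl (M ** N - N ** M) = gl_incl M * gl_incl N - gl_incl N * gl_incl M"
    using relation_zero[OF 3] by (simp add: minus_alg_quot.abs_eq[symmetric] plus_alg_quot.abs_eq[symmetric]
        times_alg_quot.abs_eq[symmetric] abs_alg_quot_free_gen gl_incl_def)
qed


section \<open>Weyl and Clifford algebras\<close>

text \<open>
  The sign \<open>\<theta>\<close> is carried by a type, because the algebra depends on it. Both values occur, and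
  quantifying over all types of the class amounts to quantifying over \<open>\<theta> \<in> {1, -1}\<close>.
\<close>

class theta_sign =
  fixes theta :: "'a itself \<Rightarrow> complex"
  assumes theta_cases: "theta TYPE('a) \<in> {1, -1}"

datatype weyl = Weyl
datatype clifford = Clifford

instantiation weyl :: theta_sign
begin
definition theta_weyl :: "weyl itself \<Rightarrow> complex" where "theta_weyl _ = 1"
instance by standard (simp add: theta_weyl_def)
end

instantiation clifford :: theta_sign
begin
definition theta_clifford :: "clifford itself \<Rightarrow> complex" where "theta_clifford _ = -1"
instance by standard (simp add: theta_clifford_def)
end

datatype ('s, 'm, 'n) H_gen = X_Gen 'm 'n | D_Gen 'm 'n

instantiation H_gen :: (theta_sign, type, type) presentation
begin

definition presentation_relations_H_gen :: "('a, 'b, 'c) H_gen free_algebra set" where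
  "presentation_relations_H_gen =
     {free_gen (X_Gen b j) * free_gen (X_Gen a i)
        - free_scalar (theta TYPE('a)) * free_gen (X_Gen a i) * free_gen (X_Gen b j)
      | a b i j. True} \<union>
     {free_gen (D_Gen b j) * free_gen (D_Gen a i)
        - free_scalar (theta TYPE('a)) * free_gen (D_Gen a i) * free_gen (D_Gen b j)
      | a b i j. True} \<union>
     {free_gen (D_Gen b j) * free_gen (X_Gen a i)
        - free_scalar (theta TYPE('a)) * free_gen (X_Gen a i) * free_gen (D_Gen b j)
        - (if a = b \<and> i = j then 1 else 0)
      | a b i j. True}"

instance ..

end

type_synonym ('s, 'm, 'n) HU = "('s, 'm, 'n) H_gen presented"

definition H_x :: "'m \<Rightarrow> 'n \<Rightarrow> ('s::theta_sign, 'm, 'n) HU" where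
  "H_x a i = gen (X_Gen a i)"

definition H_d :: "'m \<Rightarrow> 'n \<Rightarrow> ('s::theta_sign, 'm, 'n) HU" where
  "H_d a i = gen (D_Gen a i)"

lemma
  fixes a b :: 'm and i j :: 'n
  defines "t \<equiv> theta TYPE('s::theta_sign)"
  shows H_x_H_x: "H_x b j * H_x a i = t *\<^sub>C (H_x a i * H_x b j :: ('s, 'm, 'n) HU)"
    and H_d_H_d: "H_d b j * H_d a i = t *\<^sub>C (H_d a i * H_d b j :: ('s, 'm, 'n) HU)"
    and H_d_H_x: "H_d b j * H_x a i = t *\<^sub>C (H_x a i * H_d b j :: ('s, 'm, 'n) HU)
           + (if a = b \<and> i = j then 1 else 0)"
proof -
  have 1: "free_gen (X_Gen b j) * free_gen (X_Gen a i)
        - free_scalar t * free_gen (X_Gen a i) * free_gen (X_Gen b j)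
      \<in> (presentation_relations :: ('s, 'm, 'n) H_gen free_algebra set)"
    unfolding presentation_relations_H_gen_def t_def by blast
  show "H_x b j * H_x a i = t *\<^sub>C (H_x a i * H_x b j :: ('s, 'm, 'n) HU)"
    using relation_zero[OF 1] by (simp add: minus_alg_quot.abs_eq[symmetric] plus_alg_quot.abs_eq[symmetric]
        times_alg_quot.abs_eq[symmetric] abs_alg_quot_free_gen abs_alg_quot_free_scalar
        H_x_def mult_scaleC_left)
  have 2: "free_gen (D_Gen b j) * free_gen (D_Gen a i)
        - free_scalar t * free_gen (D_Gen a i) * free_gen (D_Gen b j)
      \<in> (presentation_relations :: ('s, 'm, 'n) H_gen free_algebra set)"
    unfolding presentation_relations_H_gen_def t_def by blast
  show "H_d b j * H_d a i = t *\<^sub>C (H_d a i * H_d b j :: ('s, 'm, 'n) HU)"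
    using relation_zero[OF 2] by (simp add: minus_alg_quot.abs_eq[symmetric] plus_alg_quot.abs_eq[symmetric]
        times_alg_quot.abs_eq[symmetric] abs_alg_quot_free_gen abs_alg_quot_free_scalar
        H_d_def mult_scaleC_left)
  have 3: "free_gen (D_Gen b j) * free_gen (X_Gen a i)
        - free_scalar t * free_gen (X_Gen a i) * free_gen (D_Gen b j)
        - (if a = b \<and> i = j then 1 else 0)
      \<in> (presentation_relations :: ('s, 'm, 'n) H_gen free_algebra set)"
    unfolding presentation_relations_H_gen_def t_def by blast
  show "H_d b j * H_x a i = t *\<^sub>C (H_x a i * H_d b j :: ('s, 'm, 'n) HU)
           + (if a = b \<and> i = j then 1 else 0)"
    using relation_zero[OF 3] by (cases "a = b \<and> i = j") (auto simp: minus_alg_quot.abs_eq[symmetric] plus_alg_quot.abs_eq[symmetric]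
        times_alg_quot.abs_eq[symmetric] abs_alg_quot_free_gen abs_alg_quot_free_scalar
        H_x_def H_d_def mult_scaleC_left zero_alg_quot_def[symmetric] one_alg_quot_def[symmetric]
        algebra_simps)
qed


section \<open>The Yangian of \<open>gl_n\<close>\<close>

text \<open>\<open>T_Gen s i j\<close> is the generator \<open>T\<^sub>i\<^sub>j\<close> with upper index \<open>s + 1\<close>.\<close>

datatype 'n Y_gen = T_Gen nat 'n 'n

definition free_T :: "nat \<Rightarrow> 'n \<Rightarrow> 'n \<Rightarrow> 'n Y_gen free_algebra" where
  "free_T s i j = (case s of 0 \<Rightarrow> if i = j then 1 else 0 | Suc r \<Rightarrow> free_gen (T_Gen r i j))"

text \<open>
  The relations are obtained by comparing coefficients at \<open>x\<^bsup>-r\<^esup> y\<^bsup>-s\<^esup>\<close>. The left-hand side also has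
  terms in which \<open>x\<close> or \<open>y\<close> occurs with exponent 1; these are commutators with the scalar
  \<open>free_T 0 i j\<close> and vanish identically.
\<close>

instantiation Y_gen :: (type) presentation
begin

definition presentation_relations_Y_gen :: "'a Y_gen free_algebra set" where
  "presentation_relations_Y_gen =
     {(free_T (Suc r) i j * free_T s k l - free_T s k l * free_T (Suc r) i j)
        - (free_T r i j * free_T (Suc s) k l - free_T (Suc s) k l * free_T r i j)
        - (free_T r k j * free_T s i l - free_T s k j * free_T r i l)
      | r s i j k l. True}"

instance ..

end

type_synonym 'n Yangian = "'n Y_gen presented"

definition Y_T :: "nat \<Rightarrow> 'n \<Rightarrow> 'n \<Rightarrow> 'n Yangian" where
  "Y_T s i j = (case s of 0 \<Rightarrow> if i = j then 1 else 0 | Suc r \<Rightarrow> gen (T_Gen r i j))"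

text \<open>Series in \<open>x\<^bsup>-1\<^esup>\<close> are formal Laurent series in the variable \<open>x\<^bsup>-1\<^esup>\<close>; thus \<open>x\<close> itself is \<^const>\<open>fls_X_inv\<close>.\<close>

definition T_series :: "'n \<Rightarrow> 'n \<Rightarrow> 'n Yangian fls" where
  "T_series i j = fps_to_fls (Abs_fps (\<lambda>s. Y_T s i j))"

text \<open>The matrix \<open>x + c + \<theta> E\<close>, where the \<open>(a, b)\<close> entry of \<open>E\<close> is the matrix unit \<open>E\<^sub>b\<^sub>a\<close>.\<close>

definition shifted_E_matrix :: "complex \<Rightarrow> complex \<Rightarrow> ('m::finite) Ugl fls ^'m^'m" where
  "shifted_E_matrix c t =
     mat (fls_X_inv + fls_const (c *\<^sub>C 1)) + (\<chi> a b. fls_const (t *\<^sub>C U_E b a))"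

type_synonym ('s, 'm, 'n) A = "('m Ugl, ('s, 'm, 'n) HU) tensor"

text \<open>Coefficientwise application of \<open>_ \<otimes> h\<close> to a series.\<close>

definition tensor_series ::
    "'a::complex_algebra fls \<Rightarrow> 'b::complex_algebra \<Rightarrow> ('a, 'b) tensor fls" where
  "tensor_series F h = Abs_fls (\<lambda>k. fls_nth F k \<otimes> h)"

lemma tensor_zero_left [simp]: "0 \<otimes> h = 0"
  using tensor_add_left[of 0 0 h] by simp

lemma tensor_series_nth [simp]: "fls_nth (tensor_series F h) k = fls_nth F k \<otimes> h"
  unfolding tensor_series_def
  by (rule nth_Abs_fls_lower_bound[of "fls_subdegree F"]) simp

definition image_series :: "'n \<Rightarrow> 'n \<Rightarrow> ('s::theta_sign, 'm::finite, 'n) A fls" where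
  "image_series i j =
     (let t = theta TYPE('s); R = matrix_inv (shifted_E_matrix (t * of_nat CARD('m) / 2) t)
      in (if i = j then 1 else 0)
         + (\<Sum>a\<in>UNIV. \<Sum>b\<in>UNIV. tensor_series (R $ a $ b) (H_x a i * H_d b j)))"


section \<open>The action of \<open>GL_m\<close>\<close>

definition act_Ugl :: "complex^'m^'m \<Rightarrow> ('m::finite) Ugl \<Rightarrow> 'm Ugl" where
  "act_Ugl g = present_lift (\<lambda>u. case u of GL_Gen M \<Rightarrow> gl_incl (g ** M ** matrix_inv g))"

lemma matrix_inv_left: "invertible g \<Longrightarrow> matrix_inv g ** g = mat 1"
  unfolding invertible_def matrix_inv_def by (metis (mono_tags, lifting) someI_ex)

lemma scale_mat_mult:
  "M ** scale_mat c N = scale_mat c (M ** N)" "scale_mat c M ** N = scale_mat c (M ** N)"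
  by (simp_all add: scale_mat_def matrix_matrix_mult_def vec_eq_iff sum_distrib_left mult_ac)

lemma matrix_add_rdistrib_ring: "(M + N) ** P = M ** P + N ** P" for M N P :: "complex^'m^'m"
  by (simp add: matrix_matrix_mult_def vec_eq_iff distrib_right sum.distrib)

lemma matrix_diff_distrib:
  "(M - N) ** P = M ** P - N ** P" "P ** (M - N) = P ** M - P ** N" for M N P :: "complex^'m^'m"
  by (simp_all add: matrix_matrix_mult_def vec_eq_iff algebra_simps sum_subtractf)

lemma
  assumes "invertible g"
  shows act_Ugl_gl_incl: "act_Ugl g (gl_incl M) = gl_incl (g ** M ** matrix_inv g)"
    and act_Ugl_alg_hom: "alg_hom (act_Ugl g)"
proof -
  have inv: "matrix_inv g ** (g ** N) = N" for N
    using assms by (simp add: matrix_mul_assoc matrix_inv_left)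
  let ?f = "\<lambda>u. case u of GL_Gen M \<Rightarrow> gl_incl (g ** M ** matrix_inv g)"
  have minus: "gl_incl (M - N) = gl_incl M - gl_incl N" for M N
    using gl_incl_add[of "M - N" N] by simp
  have rels: "free_eval ?f r = 0" if "r \<in> presentation_relations" for r
    using that unfolding presentation_relations_gl_gen_def
    by (auto simp: matrix_add_ldistrib matrix_add_rdistrib_ring gl_incl_add scale_mat_mult gl_incl_scale
        mult_scaleC_left matrix_diff_distrib minus
        gl_incl_bracket[symmetric] matrix_mul_assoc[symmetric] inv)
  show "act_Ugl g (gl_incl M) = gl_incl (g ** M ** matrix_inv g)"
    unfolding act_Ugl_def gl_incl_def[of M] using present_lift_gen[of ?f, OF rels] by simp
  show "alg_hom (act_Ugl g)"
    unfolding act_Ugl_def by (rule present_lift_alg_hom[of ?f, OF rels])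
qed

text \<open>On \<open>U\<^sup>*\<close> the group acts by the contragredient representation.\<close>

definition act_H :: "complex^'m^'m \<Rightarrow> ('s::theta_sign, 'm::finite, 'n) HU \<Rightarrow> ('s, 'm, 'n) HU" where
  "act_H g = present_lift (\<lambda>u. case u of
       X_Gen a i \<Rightarrow> \<Sum>b\<in>UNIV. (g $ b $ a) *\<^sub>C H_x b i
     | D_Gen a i \<Rightarrow> \<Sum>b\<in>UNIV. (matrix_inv g $ a $ b) *\<^sub>C H_d b i)"

lemma
  fixes g :: "complex^'m^'m"
  assumes "invertible g"
  shows act_H_x: "act_H g (H_x a i :: ('s::theta_sign, 'm::finite, 'n) HU) =
           (\<Sum>b\<in>UNIV. (g $ b $ a) *\<^sub>C H_x b i)"
    and act_H_d: "act_H g (H_d a i :: ('s::theta_sign, 'm::finite, 'n) HU) =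
           (\<Sum>b\<in>UNIV. (matrix_inv g $ a $ b) *\<^sub>C H_d b i)"
    and act_H_alg_hom: "alg_hom (act_H g :: ('s, 'm, 'n) HU \<Rightarrow> ('s, 'm, 'n) HU)"
proof -
  let ?t = "theta TYPE('s)"
  let ?X = "\<lambda>a i. \<Sum>b\<in>UNIV. (g $ b $ a) *\<^sub>C (H_x b i :: ('s, 'm, 'n) HU)"
  let ?D = "\<lambda>a i. \<Sum>b\<in>UNIV. (matrix_inv g $ a $ b) *\<^sub>C (H_d b i :: ('s, 'm, 'n) HU)"
  let ?f = "\<lambda>u :: ('s, 'm, 'n) H_gen. case u of X_Gen a i \<Rightarrow> ?X a i | D_Gen a i \<Rightarrow> ?D a i"
  have prod: "(\<Sum>c\<in>UNIV. p c *\<^sub>C y c) * (\<Sum>d\<in>UNIV. q d *\<^sub>C z d) =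
      (\<Sum>c\<in>UNIV. \<Sum>d\<in>UNIV. (p c * q d) *\<^sub>C (y c * z d))"
    for p q :: "'m \<Rightarrow> complex" and y z :: "'m \<Rightarrow> ('s, 'm, 'n) HU"
    by (simp add: sum_product mult_scaleC_left mult_scaleC_right scaleC_scaleC mult.commute)
  have swap: "?t *\<^sub>C ((\<Sum>c\<in>UNIV. p c *\<^sub>C y c) * (\<Sum>d\<in>UNIV. q d *\<^sub>C z d)) =
      (\<Sum>d\<in>UNIV. \<Sum>c\<in>UNIV. (q d * p c) *\<^sub>C ?t *\<^sub>C (y c * z d))"
    for p q :: "'m \<Rightarrow> complex" and y z :: "'m \<Rightarrow> ('s, 'm, 'n) HU"
    unfolding prod by (subst sum.swap) (simp add: scaleC_sum_right scaleC_scaleC mult_ac)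
  have XX: "?X b j * ?X a i = ?t *\<^sub>C (?X a i * ?X b j)" for a b i j
    by (simp only: swap, simp only: prod H_x_H_x[of _ j _ i])
  have DD: "?D b j * ?D a i = ?t *\<^sub>C (?D a i * ?D b j)" for a b i j
    by (simp only: swap, simp only: prod H_d_H_d[of _ j _ i])
  have inv: "(\<Sum>c\<in>UNIV. matrix_inv g $ b $ c * g $ c $ a) = (if b = a then 1 else 0)" for a b
  proof -
    have "matrix_inv g ** g = mat 1" using assms by (simp add: matrix_inv_left)
    then have "(matrix_inv g ** g) $ b $ a = mat 1 $ b $ a" by simp
    then show ?thesis by (simp add: matrix_matrix_mult_def mat_def)
  qed
  have sum_one: "(\<Sum>c\<in>UNIV. p c *\<^sub>C y) = (\<Sum>c\<in>UNIV. p c) *\<^sub>C y"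
    for p :: "'m \<Rightarrow> complex" and y :: "('s, 'm, 'n) HU"
    by (simp add: scaleC_sum_left)
  have delta: "(\<Sum>c\<in>UNIV. \<Sum>d\<in>UNIV. (matrix_inv g $ b $ c * g $ d $ a) *\<^sub>C
      (if d = c \<and> i = j then 1 else (0 :: ('s, 'm, 'n) HU))) = (if a = b \<and> i = j then 1 else 0)"
    for a b i j
  proof (cases "i = j")
    case True
    have "(\<Sum>d\<in>UNIV. (matrix_inv g $ b $ c * g $ d $ a) *\<^sub>C
        (if d = c then 1 else (0 :: ('s, 'm, 'n) HU))) = (matrix_inv g $ b $ c * g $ c $ a) *\<^sub>C 1" for c
      by (subst sum.remove[of _ c]) (auto intro!: sum.neutral)
    then show ?thesis using True inv[of b a] by (simp add: sum_one scaleC_one)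
  qed simp
  have DX: "?D b j * ?X a i = ?t *\<^sub>C (?X a i * ?D b j) + (if a = b \<and> i = j then 1 else 0)" for a b i j
    by (simp only: swap, simp only: prod H_d_H_x[of _ j _ i] scaleC_add_right sum.distrib delta)
  have aux: "p = q + r \<Longrightarrow> p - q - r = 0" for p q r :: "('s, 'm, 'n) HU"
    by simp
  have ev: "free_eval ?f (free_scalar ?t * free_gen u * free_gen v) = ?t *\<^sub>C (?f u * ?f v)" for u v
    by (simp add: mult_scaleC_left)
  have rels: "free_eval ?f r = 0" if "r \<in> presentation_relations" for r
    using that unfolding presentation_relations_H_gen_def
  proof (elim UnE CollectE exE conjE)
    fix a b i j
    assume "r = free_gen (X_Gen b j) * free_gen (X_Gen a i)
        - free_scalar ?t * free_gen (X_Gen a i) * free_gen (X_Gen b j)"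
    then have "free_eval ?f r = ?X b j * ?X a i - ?t *\<^sub>C (?X a i * ?X b j)"
      by (simp only: free_eval_simps(2) ev) (simp only: free_eval_simps H_gen.case)
    then show ?thesis by (rule trans) (rule right_minus_eq[THEN iffD2, OF XX])
  next
    fix a b i j
    assume "r = free_gen (D_Gen b j) * free_gen (D_Gen a i)
        - free_scalar ?t * free_gen (D_Gen a i) * free_gen (D_Gen b j)"
    then have "free_eval ?f r = ?D b j * ?D a i - ?t *\<^sub>C (?D a i * ?D b j)"
      by (simp only: free_eval_simps(2) ev) (simp only: free_eval_simps H_gen.case)
    then show ?thesis by (rule trans) (rule right_minus_eq[THEN iffD2, OF DD])
  next
    fix a b i j
    assume "r = free_gen (D_Gen b j) * free_gen (X_Gen a i)
        - free_scalar ?t * free_gen (X_Gen a i) * free_gen (D_Gen b j)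
        - (if a = b \<and> i = j then 1 else 0)"
    then have "free_eval ?f r = ?D b j * ?X a i - ?t *\<^sub>C (?X a i * ?D b j)
        - (if a = b \<and> i = j then 1 else 0)"
      by (simp only: free_eval_simps(2) ev)
        (simp only: free_eval_simps H_gen.case if_distrib[of "free_eval ?f"])
    then show ?thesis
      by (rule trans) (rule aux, rule DX)
  qed
  show "act_H g (H_x a i) = ?X a i" "act_H g (H_d a i) = ?D a i"
    unfolding act_H_def H_x_def[of a i] H_d_def[of a i]
    using present_lift_gen[of ?f, OF rels] by simp_all
  show "alg_hom (act_H g :: ('s, 'm, 'n) HU \<Rightarrow> ('s, 'm, 'n) HU)"
    unfolding act_H_def by (rule present_lift_alg_hom[of ?f, OF rels])
qed

definition act_A :: "complex^'m^'m \<Rightarrow> ('s::theta_sign, 'm::finite, 'n) A \<Rightarrow> ('s, 'm, 'n) A" where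
  "act_A g = tensor_map (act_Ugl g) (act_H g)"

lemma
  assumes "invertible g"
  shows act_A_pure_tensor: "act_A g (u \<otimes> h) = act_Ugl g u \<otimes> act_H g h"
    and act_A_alg_hom: "alg_hom (act_A g)"
  unfolding act_A_def
  using tensor_map_pure[OF act_Ugl_alg_hom act_H_alg_hom] assms
    tensor_map_alg_hom[OF act_Ugl_alg_hom act_H_alg_hom] by blast+

definition GL_invariants :: "(complex^'m^'m \<Rightarrow> 'v \<Rightarrow> 'v) \<Rightarrow> 'v set" where
  "GL_invariants act = {v. \<forall>g. invertible g \<longrightarrow> act g v = v}"

end

theory Submission
  imports Defs "HOL-Combinatorics.Permutations" "HOL-Library.Multiset"
begin

text \<open>
  Write \<open>t\<close> for the sign \<open>\<theta>\<close>, \<open>c = t m / 2\<close>, and let \<open>w = - (c + t E)\<close>, an \<open>m \<times> m\<close> matrix over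
  \<open>U(gl\<^sub>m)\<close>. The inverse of \<open>x + c + t E = x - w\<close> is the geometric series, so that \<open>T\<^sub>i\<^sub>j\<close> with upper
  index \<open>s + 1\<close> is sent to \<open>\<Sum>\<^sub>a\<^sub>b (w\<^bsup>s\<^esup>)\<^sub>a\<^sub>b \<otimes> x\<^sub>a\<^sub>i \<partial>\<^sub>b\<^sub>j\<close> (\<open>t_coeff\<close>).

  Part (i). Since \<open>[w\<^sub>a\<^sub>b, w\<^sub>c\<^sub>d] = - t (\<delta>\<^sub>a\<^sub>d w\<^sub>c\<^sub>b - \<delta>\<^sub>b\<^sub>c w\<^sub>a\<^sub>d)\<close>, the commutators \<open>C(r, s)\<close> of entries of
  \<open>w\<^bsup>r\<^esup>\<close> and \<open>w\<^bsup>s\<^esup>\<close> satisfy \<open>C(r + 1, s) - C(r, s + 1) = - t (w\<^bsup>r\<^esup>\<^sub>a\<^sub>d w\<^bsup>s\<^esup>\<^sub>c\<^sub>b - w\<^bsup>s\<^esup>\<^sub>a\<^sub>d w\<^bsup>r\<^esup>\<^sub>c\<^sub>b)\<close>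
  (\<open>comm_telescope\<close>), a Yangian relation for \<open>w\<close> itself, and \<open>C(r, s) = C(s, r)\<close>
  (\<open>comm_symmetric\<close>). Moving \<open>\<partial>\<close> past \<open>x\<close> in a product of two images produces a contracted term,
  which accounts for the part of the Yangian relation linear in the images, and a term
  \<open>x x \<partial> \<partial>\<close> with coefficients \<open>C(r, s)\<close>, which accounts for the quadratic part.

  Part (ii). Filter the algebra \<open>A\<close> by the length of words in the letters \<open>w\<^sub>a\<^sub>b\<close>, \<open>x\<^sub>a\<^sub>i\<close>,
  \<open>\<partial>\<^sub>b\<^sub>j\<close>. An invariant of degree \<open>d\<close> is shown to lie in the subalgebra generated by the centre and
  the image by induction on \<open>d\<close>, in three steps.

  \<^item> Words of bounded length, with their \<open>GL\<^sub>m\<close>-indices left free, span a finite-dimensional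
    representation \<open>V\<close> that maps equivariantly onto the filtered piece. The matrices by which
    \<open>GL\<^sub>m\<close> acts on \<open>V\<close> are closed under the adjoint, so orthogonal complements of invariant
    subspaces are invariant and an invariant of \<open>A\<close> lifts to an invariant of \<open>V\<close>
    (\<open>invariant_lift\<close>, \<open>invariant_coefficients\<close>).

  \<^item> An invariant of \<open>V\<close> is a family of tensors, one for each shape of a word. Scalar matrices force
    as many upper as lower indices (\<open>balanced_or_zero\<close>). Then the tensor commutes with \<open>g \<otimes> \<dots> \<otimes> g\<close>
    for all \<open>g\<close> and is a combination of permutations of the tensor factors
    (\<open>tensor_first_fundamental_theorem\<close>). So the invariant is a combination of complete contractions,
    in which every index occurs once as an upper and once as a lower one.

  \<^item> Letters commute up to sign modulo shorter words. Hence, modulo shorter words, a complete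
    contraction can be rearranged so that contracted letters are neighbours; its cycles become traces
    of powers of \<open>w\<close>, which are invariants of \<open>U(gl\<^sub>m)\<close>, and its chains from an \<open>x\<close> to a \<open>\<partial>\<close>
    become images of Yangian generators (\<open>contract_in_S_plus\<close>).

  Subtracting the resulting element leaves an invariant of smaller degree.
\<close>

section \<open>Lifting invariants along equivariant surjections\<close>

text \<open>
  Gram-Schmidt, by induction on the index set: the vectors of \<open>N\<close> that vanish at one coordinate
  form a subspace of codimension at most one, to which the induction hypothesis applies. Vectors are
  functions that matter only on \<open>\<Omega>\<close>, so that index sets can vary.
\<close>

lemma orthogonal_decomposition:
  fixes N :: "('w \<Rightarrow> complex) set"
  assumes "finite \<Omega>"
    and "(\<lambda>_. 0) \<in> N" "\<And>x y. x \<in> N \<Longrightarrow> y \<in> N \<Longrightarrow> (\<lambda>i. x i + y i) \<in> N"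
      "\<And>c x. x \<in> N \<Longrightarrow> (\<lambda>i. c * x i) \<in> N"
  shows "\<exists>n\<in>N. \<forall>y\<in>N. (\<Sum>x\<in>\<Omega>. (w x - n x) * cnj (y x)) = 0"
  using assms
proof (induction \<Omega> arbitrary: N w rule: finite_induct)
  case empty
  then show ?case by auto
next
  case (insert a \<Omega> N w)
  note N = insert.prems
  show ?case
  proof (cases "\<forall>y\<in>N. y a = 0")
    case True
    obtain n where n: "n \<in> N" "\<And>y. y \<in> N \<Longrightarrow> (\<Sum>x\<in>\<Omega>. (w x - n x) * cnj (y x)) = 0"
      using insert.IH[OF N, of w] by blast
    have "(\<Sum>x\<in>insert a \<Omega>. (w x - n x) * cnj (y x)) = 0" if "y \<in> N" for y
      using True that n(2)[OF that] insert.hyps by simp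
    then show ?thesis using n(1) by blast
  next
    case False
    then obtain y0 where y0: "y0 \<in> N" "y0 a \<noteq> 0" by blast
    define y1 where "y1 = (\<lambda>i. (1 / y0 a) * y0 i)"
    have y1: "y1 \<in> N" "y1 a = 1" unfolding y1_def using N(3)[OF y0(1), of "1 / y0 a"] y0 by auto
    define N0 where "N0 = {y \<in> N. y a = 0}"
    have N0: "(\<lambda>_. 0) \<in> N0" "\<And>x y. x \<in> N0 \<Longrightarrow> y \<in> N0 \<Longrightarrow> (\<lambda>i. x i + y i) \<in> N0"
      "\<And>c x. x \<in> N0 \<Longrightarrow> (\<lambda>i. c * x i) \<in> N0"
      unfolding N0_def using N by auto
    obtain n1 where n1: "n1 \<in> N0" "\<And>y. y \<in> N0 \<Longrightarrow> (\<Sum>x\<in>\<Omega>. (y1 x - n1 x) * cnj (y x)) = 0"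
      using insert.IH[OF N0, of y1] by blast
    obtain n0 where n0: "n0 \<in> N0" "\<And>y. y \<in> N0 \<Longrightarrow> (\<Sum>x\<in>\<Omega>. (w x - n0 x) * cnj (y x)) = 0"
      using insert.IH[OF N0, of w] by blast
    \<comment> \<open>\<open>N\<close> is spanned by \<open>N0\<close> and \<open>z\<close>, which is orthogonal to \<open>N0\<close>.\<close>
    define z where "z = (\<lambda>i. y1 i + (-1) * n1 i)"
    have zN: "z \<in> N" unfolding z_def using N(2)[OF y1(1) N(3)[of n1 "-1"]] n1(1) by (simp add: N0_def)
    have za: "z a = 1" using y1 n1 by (simp add: z_def N0_def)
    let ?ip = "\<lambda>u v. \<Sum>x\<in>insert a \<Omega>. u x * cnj (v x)"
    have ip0: "?ip u v = (\<Sum>x\<in>\<Omega>. u x * cnj (v x))" if "v \<in> N0" for u v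
      using that insert.hyps by (simp add: N0_def)
    have zz: "?ip z z \<noteq> 0"
    proof -
      have eq: "?ip z z = of_real (\<Sum>x\<in>insert a \<Omega>. (cmod (z x))\<^sup>2)"
        unfolding of_real_sum complex_norm_square ..
      have "(\<Sum>x\<in>insert a \<Omega>. (cmod (z x))\<^sup>2) \<ge> (\<Sum>x\<in>{a}. (cmod (z x))\<^sup>2)"
        using insert.hyps by (intro sum_mono2) auto
      then have "(\<Sum>x\<in>insert a \<Omega>. (cmod (z x))\<^sup>2) \<noteq> 0" using za by simp
      then show ?thesis unfolding eq of_real_eq_0_iff .
    qed
    define c where "c = ?ip w z / ?ip z z"
    define n where "n = (\<lambda>i. n0 i + c * z i)"
    have nN: "n \<in> N" unfolding n_def using N(2)[OF _ N(3)[OF zN]] n0(1) by (simp add: N0_def)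
    have lin: "?ip (\<lambda>x. w x - n x) v = ?ip (\<lambda>x. w x - n0 x) v - c * ?ip z v" for v
      by (simp add: n_def sum_distrib_left sum_subtractf[symmetric] algebra_simps del: sum.insert
           cong: sum.cong)
    have z_orth: "?ip z v = 0" if "v \<in> N0" for v
      unfolding ip0[OF that] using n1(2)[OF that] by (simp add: z_def)
    have orth0: "?ip (\<lambda>x. w x - n x) v = 0" if "v \<in> N0" for v
      unfolding lin z_orth[OF that] unfolding ip0[OF that] using n0(2)[OF that] by simp
    have n0z: "?ip n0 z = 0"
    proof -
      have "?ip n0 z = cnj (?ip z n0)" by (simp add: mult.commute del: sum.insert)
      then show ?thesis using z_orth[OF n0(1)] by simp
    qed
    have orthz: "?ip (\<lambda>x. w x - n x) z = 0"
    proof -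
      have "?ip (\<lambda>x. w x - n0 x) z = ?ip w z - ?ip n0 z"
        by (simp add: sum_subtractf[symmetric] algebra_simps del: sum.insert)
      then show ?thesis unfolding lin n0z c_def using zz by simp
    qed
    have "?ip (\<lambda>x. w x - n x) y = 0" if y: "y \<in> N" for y
    proof -
      define v where "v = (\<lambda>i. y i + (- y a) * z i)"
      have v: "v \<in> N0" unfolding N0_def v_def using N(2)[OF y N(3)[OF zN, of "- y a"]] za by simp
      have "?ip (\<lambda>x. w x - n x) y = ?ip (\<lambda>x. w x - n x) v + cnj (y a) * ?ip (\<lambda>x. w x - n x) z"
        by (simp add: v_def sum_distrib_left sum.distrib[symmetric] algebra_simps del: sum.insert cong: sum.cong)
      then show ?thesis using orth0[OF v] orthz by (simp del: sum.insert)
    qed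
    then show ?thesis using nN by blast
  qed
qed

lemma orthogonal_self_zero:
  fixes z :: "'w \<Rightarrow> complex"
  assumes "finite \<Omega>" "(\<Sum>x\<in>\<Omega>. z x * cnj (z x)) = 0" "x \<in> \<Omega>"
  shows "z x = 0"
proof -
  have "(\<Sum>x\<in>\<Omega>. z x * cnj (z x)) = of_real (\<Sum>x\<in>\<Omega>. (cmod (z x))\<^sup>2)"
    unfolding of_real_sum complex_norm_square ..
  then have "(\<Sum>x\<in>\<Omega>. (cmod (z x))\<^sup>2) = 0" using assms(2) by (metis of_real_eq_0_iff)
  then show ?thesis using assms(1,3) by (simp add: sum_nonneg_eq_0_iff)
qed

text \<open>
  Complete reducibility in the form needed here, with \<open>M\<close> in the role of the kernel of an
  equivariant map: a vector that is invariant modulo \<open>M\<close> is congruent to an invariant one. The latter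
  is the component of \<open>w\<close> orthogonal to \<open>M\<close>: its displacement by \<open>g\<close> lies in \<open>M\<close>, and also in the
  orthogonal complement of \<open>M\<close>, which is stable because the action is closed under adjoints.
\<close>

lemma invariant_lift:
  fixes \<rho> :: "'g \<Rightarrow> 'w \<Rightarrow> 'w \<Rightarrow> complex" and M :: "('w \<Rightarrow> complex) set" and \<Omega> :: "'w set"
  defines "act g u \<equiv> (\<lambda>x. \<Sum>y\<in>\<Omega>. \<rho> g x y * u y)"
  assumes "finite \<Omega>"
    and adjoint: "\<And>g. g \<in> G \<Longrightarrow> \<exists>h\<in>G. \<forall>x\<in>\<Omega>. \<forall>y\<in>\<Omega>. \<rho> h x y = cnj (\<rho> g y x)"
    and M: "(\<lambda>_. 0) \<in> M" "\<And>x y. x \<in> M \<Longrightarrow> y \<in> M \<Longrightarrow> (\<lambda>i. x i + y i) \<in> M"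
      "\<And>c x. x \<in> M \<Longrightarrow> (\<lambda>i. c * x i) \<in> M"
    and stable: "\<And>g u. g \<in> G \<Longrightarrow> u \<in> M \<Longrightarrow> act g u \<in> M"
    and inv: "\<And>g. g \<in> G \<Longrightarrow> (\<lambda>x. act g w x - w x) \<in> M"
  shows "\<exists>z. (\<lambda>x. w x - z x) \<in> M \<and> (\<forall>g\<in>G. \<forall>x\<in>\<Omega>. act g z x = z x)"
proof -
  obtain n where n: "n \<in> M" "\<And>y. y \<in> M \<Longrightarrow> (\<Sum>x\<in>\<Omega>. (w x - n x) * cnj (y x)) = 0"
    using orthogonal_decomposition[OF \<open>finite \<Omega>\<close> M, of w] by blast
  define z where "z = (\<lambda>x. w x - n x)"
  have diff: "(\<lambda>i. x i - y i) \<in> M" if "x \<in> M" "y \<in> M" for x y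
    using M(2)[OF that(1) M(3)[OF that(2), of "-1"]] by simp
  have "act g z x = z x" if g: "g \<in> G" and x: "x \<in> \<Omega>" for g x
  proof -
    define d where "d = (\<lambda>x. act g z x - z x)"
    have "d = (\<lambda>x. (act g w x - w x) - (act g n x - n x))"
      unfolding d_def z_def act_def by (auto simp: algebra_simps sum_subtractf)
    then have dM: "d \<in> M" using diff[OF inv[OF g] diff[OF stable[OF g n(1)] n(1)]] by simp
    obtain h where h: "h \<in> G" "\<And>x y. x \<in> \<Omega> \<Longrightarrow> y \<in> \<Omega> \<Longrightarrow> \<rho> h x y = cnj (\<rho> g y x)"
      using adjoint[OF g] by blast
    have "(\<Sum>x\<in>\<Omega>. act g z x * cnj (d x)) = (\<Sum>x\<in>\<Omega>. \<Sum>y\<in>\<Omega>. z y * cnj (\<rho> h y x * d x))"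
      unfolding act_def sum_distrib_right
      by (intro sum.cong refl) (simp add: h(2))
    also have "\<dots> = (\<Sum>y\<in>\<Omega>. z y * cnj (act h d y))"
      unfolding act_def cnj_sum sum_distrib_left by (rule sum.swap)
    also have "\<dots> = 0" using n(2)[OF stable[OF h(1) dM]] by (simp add: z_def)
    finally have 1: "(\<Sum>x\<in>\<Omega>. act g z x * cnj (d x)) = 0" .
    have 2: "(\<Sum>x\<in>\<Omega>. z x * cnj (d x)) = 0" using n(2)[OF dM] by (simp add: z_def)
    have "(\<Sum>x\<in>\<Omega>. d x * cnj (d x)) = (\<Sum>x\<in>\<Omega>. act g z x * cnj (d x)) - (\<Sum>x\<in>\<Omega>. z x * cnj (d x))"
      unfolding sum_subtractf[symmetric] by (rule sum.cong) (auto simp: d_def algebra_simps)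
    then have "(\<Sum>x\<in>\<Omega>. d x * cnj (d x)) = 0" using 1 2 by simp
    from orthogonal_self_zero[OF \<open>finite \<Omega>\<close> this x] show ?thesis by (simp add: d_def)
  qed
  moreover have "(\<lambda>x. w x - z x) \<in> M" using n(1) by (simp add: z_def)
  ultimately show ?thesis by blast
qed

section \<open>Polarization\<close>

lemma alternating_sum_supersets:
  fixes V :: "'a set"
  assumes "finite V" "R \<subseteq> V"
  shows "(\<Sum>S\<in>Pow V. if R \<subseteq> S then (-1) ^ card S else 0) = (if R = V then (-1) ^ card V else (0::complex))"
proof -
  have fin: "finite {S. R \<subseteq> S \<and> S \<subseteq> V}"
    by (rule finite_subset[of _ "Pow V"]) (use assms in auto)
  have eq: "(\<Sum>S\<in>Pow V. if R \<subseteq> S then (-1) ^ card S else (0::complex)) = (\<Sum>S | R \<subseteq> S \<and> S \<subseteq> V. (-1) ^ card S)"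
    by (rule sum.mono_neutral_cong_right) (use assms in auto)
  show ?thesis
  proof (cases "R = V")
    case True
    then have "{S. R \<subseteq> S \<and> S \<subseteq> V} = {V}" by auto
    then show ?thesis using True eq by simp
  next
    case False
    then have "R \<subset> V" using assms by blast
    from card_subsupersets_even_odd[OF assms(1) this]
    have "(\<Sum>S | R \<subseteq> S \<and> S \<subseteq> V. (-1) ^ card S) = (0::complex)"
      by (intro sum_alternating_cancels[OF fin]) (simp add: conj_ac)
    then show ?thesis using eq False by simp
  qed
qed

lemma surjective_endomaps:
  fixes N :: nat
  shows "{h \<in> {..<N} \<rightarrow>\<^sub>E {..N}. {..<N} \<subseteq> h ` {..<N}} = (\<lambda>\<pi>. restrict \<pi> {..<N}) ` {\<pi>. \<pi> permutes {..<N}}"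
proof (intro equalityI subsetI)
  fix h assume h: "h \<in> {h \<in> {..<N} \<rightarrow>\<^sub>E {..N}. {..<N} \<subseteq> h ` {..<N}}"
  have "card (h ` {..<N}) \<le> card {..<N}" by (rule card_image_le) simp
  then have eq: "h ` {..<N} = {..<N}" using h card_seteq[of "h ` {..<N}" "{..<N}"] by auto
  then have "inj_on h {..<N}" by (intro eq_card_imp_inj_on) simp_all
  then have bij: "bij_betw h {..<N} {..<N}" using eq by (simp add: bij_betw_def)
  define \<pi> where "\<pi> = (\<lambda>i. if i < N then h i else i)"
  have "\<pi> permutes {..<N}"
  proof (rule bij_imp_permutes)
    show "bij_betw \<pi> {..<N} {..<N}" using bij by (rule bij_betw_cong[THEN iffD1, rotated]) (simp add: \<pi>_def)
  qed (simp add: \<pi>_def)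
  moreover have "h = restrict \<pi> {..<N}" using h by (auto simp: \<pi>_def PiE_def extensional_def fun_eq_iff)
  ultimately show "h \<in> (\<lambda>\<pi>. restrict \<pi> {..<N}) ` {\<pi>. \<pi> permutes {..<N}}" by blast
next
  fix h assume "h \<in> (\<lambda>\<pi>. restrict \<pi> {..<N}) ` {\<pi>. \<pi> permutes {..<N}}"
  then obtain \<pi> where s: "\<pi> permutes {..<N}" "h = restrict \<pi> {..<N}" by blast
  have "\<pi> ` {..<N} = {..<N}" using s permutes_image by blast
  moreover have "\<pi> x \<le> N" if "x < N" for x using that permutes_in_image[OF s(1), of x] by simp
  ultimately show "h \<in> {h \<in> {..<N} \<rightarrow>\<^sub>E {..N}. {..<N} \<subseteq> h ` {..<N}}" using s(2) by auto
qed

text \<open>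
  Expanding the product on the left gives a sum over maps \<open>h\<close> from factors to summands. The
  alternating sum over \<open>S\<close> leaves only the maps that hit every \<open>s < N\<close>, and these are permutations, so
  that the constants \<open>c r\<close> drop out. (For \<open>c = 0\<close> this is the formula of Ryser for the permanent.)
\<close>

lemma permanent_polarization:
  fixes t :: "nat \<Rightarrow> nat \<Rightarrow> complex"
  shows "(\<Sum>S\<in>Pow {..<N}. (-1) ^ card S * (\<Prod>r<N. c r + (\<Sum>s\<in>S. t r s))) =
    (-1) ^ N * (\<Sum>\<pi> | \<pi> permutes {..<N}. \<Prod>r<N. t r (\<pi> r))"
proof -
  \<comment> \<open>The index \<open>N\<close> stands for the constant summand \<open>c r\<close>.\<close>
  define u where "u r s = (if s = N then c r else t r s)" for r s
  let ?H = "{..<N} \<rightarrow>\<^sub>E {..N}"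
  have finH: "finite ?H" by (rule finite_PiE) auto
  have expand: "(\<Prod>r<N. c r + (\<Sum>s\<in>S. t r s)) = (\<Sum>h\<in>?H. if h ` {..<N} - {N} \<subseteq> S then (\<Prod>r<N. u r (h r)) else 0)"
    if S: "S \<in> Pow {..<N}" for S
  proof -
    have "c r + (\<Sum>s\<in>S. t r s) = (\<Sum>s\<le>N. if s \<in> insert N S then u r s else 0)" for r
    proof -
      have "N \<notin> S" "finite S" using S finite_subset by auto
      have sub: "insert N S \<subseteq> {..N}" using S by auto
      have "(\<Sum>s\<le>N. if s \<in> insert N S then u r s else 0) = (\<Sum>s\<in>insert N S. u r s)"
        by (rule sum.mono_neutral_cong_right) (use sub in auto)
      also have "\<dots> = c r + (\<Sum>s\<in>S. u r s)" using \<open>N \<notin> S\<close> \<open>finite S\<close> by (simp add: u_def)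
      also have "(\<Sum>s\<in>S. u r s) = (\<Sum>s\<in>S. t r s)" using \<open>N \<notin> S\<close> by (intro sum.cong) (auto simp: u_def)
      finally show ?thesis by simp
    qed
    then have "(\<Prod>r<N. c r + (\<Sum>s\<in>S. t r s)) = (\<Prod>r<N. \<Sum>s\<le>N. if s \<in> insert N S then u r s else 0)" by simp
    also have "\<dots> = (\<Sum>h\<in>?H. \<Prod>r<N. if h r \<in> insert N S then u r (h r) else 0)"
      by (rule prod_sum_PiE) auto
    also have "\<dots> = (\<Sum>h\<in>?H. if h ` {..<N} - {N} \<subseteq> S then (\<Prod>r<N. u r (h r)) else 0)"
    proof (rule sum.cong[OF refl])
      fix h assume "h \<in> ?H"
      show "(\<Prod>r<N. if h r \<in> insert N S then u r (h r) else 0) = (if h ` {..<N} - {N} \<subseteq> S then (\<Prod>r<N. u r (h r))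
          else 0)"
      proof (cases "h ` {..<N} - {N} \<subseteq> S")
        case True
        then show ?thesis by (auto intro!: prod.cong)
      next
        case False
        then obtain r where "r < N" "h r \<notin> insert N S" by auto
        then show ?thesis using False by (auto simp: prod_zero_iff)
      qed
    qed
    finally show ?thesis .
  qed
  have "(\<Sum>S\<in>Pow {..<N}. (-1) ^ card S * (\<Prod>r<N. c r + (\<Sum>s\<in>S. t r s))) =
     (\<Sum>S\<in>Pow {..<N}. \<Sum>h\<in>?H. (if h ` {..<N} - {N} \<subseteq> S then (-1) ^ card S else 0) * (\<Prod>r<N. u r (h r)))"
    by (intro sum.cong refl) (simp add: expand sum_distrib_left if_distrib if_distribR cong: if_cong)
  also have "\<dots> = (\<Sum>h\<in>?H. \<Sum>S\<in>Pow {..<N}. (if h ` {..<N} - {N} \<subseteq> S then (-1) ^ card S else 0) * (\<Prod>r<N. u r (h r)))"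
    by (rule sum.swap)
  also have "\<dots> = (\<Sum>h\<in>?H. if {..<N} \<subseteq> h ` {..<N} then (-1) ^ N * (\<Prod>r<N. u r (h r)) else 0)"
  proof (rule sum.cong[OF refl])
    fix h assume "h \<in> ?H"
    then have "h ` {..<N} \<subseteq> {..N}" by auto
    then have sub: "h ` {..<N} - {N} \<subseteq> {..<N}" by (auto simp: le_less)
    have iff: "h ` {..<N} - {N} = {..<N} \<longleftrightarrow> {..<N} \<subseteq> h ` {..<N}" using sub by auto
    show "(\<Sum>S\<in>Pow {..<N}. (if h ` {..<N} - {N} \<subseteq> S then (-1) ^ card S else 0) * (\<Prod>r<N. u r (h r))) =
      (if {..<N} \<subseteq> h ` {..<N} then (-1) ^ N * (\<Prod>r<N. u r (h r)) else 0)"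
      unfolding sum_distrib_right[symmetric] using alternating_sum_supersets[OF _ sub] iff by simp
  qed
  also have "\<dots> = (\<Sum>h\<in>{h\<in>?H. {..<N} \<subseteq> h ` {..<N}}. (-1) ^ N * (\<Prod>r<N. u r (h r)))"
    using finH by (simp add: sum.inter_filter)
  also have "\<dots> = (\<Sum>\<pi> | \<pi> permutes {..<N}. (-1) ^ N * (\<Prod>r<N. u r (restrict \<pi> {..<N} r)))"
    unfolding surjective_endomaps
  proof (rule sum.reindex[unfolded o_def])
    show "inj_on (\<lambda>\<pi>. restrict \<pi> {..<N}) {\<pi>. \<pi> permutes {..<N}}"
    proof (rule inj_onI)
      fix \<pi> \<tau> assume a: "\<pi> \<in> {\<pi>. \<pi> permutes {..<N}}" "\<tau> \<in> {\<pi>. \<pi> permutes {..<N}}" "restrict \<pi> {..<N} =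
          restrict \<tau> {..<N}"
      show "\<pi> = \<tau>"
      proof
        fix i
        show "\<pi> i = \<tau> i"
        proof (cases "i < N")
          case True
          then show ?thesis using fun_cong[OF a(3), of i] by simp
        next
          case False
          then show ?thesis using a by (metis lessThan_iff mem_Collect_eq permutes_not_in)
        qed
      qed
    qed
  qed
  also have "\<dots> = (-1) ^ N * (\<Sum>\<pi> | \<pi> permutes {..<N}. \<Prod>r<N. t r (\<pi> r))"
    unfolding sum_distrib_left
    by (intro sum.cong refl) (auto intro!: prod.cong simp: u_def dest: permutes_in_image[THEN iffD2,
        of _ "{..<N}"] )
  finally show ?thesis .
qed

section \<open>Tensor powers of a matrix and permutations of indices\<close>

definition tuples :: "nat \<Rightarrow> 'a list set" where
  "tuples N = {xs. length xs = N}"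

lemma finite_tuples [simp]: "finite (tuples N :: 'a::finite list set)"
  using finite_lists_length_eq[of "UNIV :: 'a set" N] by (simp add: tuples_def)

lemma tuples_0 [simp]: "tuples 0 = {[]}" by (auto simp: tuples_def)

lemma sum_tuples_Suc:
  "(\<Sum>I\<in>tuples (Suc N). f I) = (\<Sum>a\<in>(UNIV::'a::finite set). \<Sum>I\<in>tuples N. f (a # I))"
proof -
  have "tuples (Suc N) = (\<lambda>(a, I). a # I) ` ((UNIV::'a set) \<times> tuples N)"
    by (auto simp: tuples_def length_Suc_conv image_iff)
  then have "sum f (tuples (Suc N)) = (\<Sum>(a, I)\<in>(UNIV::'a set) \<times> tuples N. f (a # I))"
    by (simp add: sum.reindex inj_on_def case_prod_beta o_def)
  then show ?thesis by (simp add: sum.cartesian_product)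
qed

text \<open>
  The entries of \<open>g \<otimes> \<dots> \<otimes> g\<close> with respect to the product basis, indexed by lists.
\<close>

fun tpow :: "complex^'m^'m \<Rightarrow> 'm list \<Rightarrow> 'm list \<Rightarrow> complex" where
  "tpow g (a # I) (b # J) = g $ a $ b * tpow g I J"
| "tpow g _ _ = 1"

lemma tpow_nth: "length I = N \<Longrightarrow> length J = N \<Longrightarrow> tpow g I J = (\<Prod>r<N. g $ (I ! r) $ (J ! r))"
proof (induction N arbitrary: I J)
  case (Suc N)
  then obtain a I' b J' where "I = a # I'" "J = b # J'" by (metis length_Suc_conv)
  then show ?case using Suc by (simp add: prod.lessThan_Suc_shift del: prod.lessThan_Suc)
qed simp

lemma tpow_mult:
  fixes g h :: "complex^'m::finite^'m"
  shows "length A = N \<Longrightarrow> length B = N \<Longrightarrow>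
    (\<Sum>I\<in>tuples N. tpow g A I * tpow h I B) = tpow (g ** h) A B"
proof (induction N arbitrary: A B)
  case (Suc N)
  then obtain a A' b B' where e: "A = a # A'" "B = b # B'" "length A' = N" "length B' = N"
    by (metis length_Suc_conv)
  have "(\<Sum>I\<in>tuples (Suc N). tpow g A I * tpow h I B) =
     (\<Sum>c\<in>UNIV. \<Sum>I\<in>tuples N. (g $ a $ c * h $ c $ b) * (tpow g A' I * tpow h I B'))"
    by (simp add: sum_tuples_Suc e mult_ac)
  also have "\<dots> = tpow (g ** h) A B"
    unfolding sum_product[symmetric] Suc.IH[OF e(3,4)] by (simp add: e matrix_matrix_mult_def)
  finally show ?case .
qed simp

lemma tpow_scalar:
  "length A = N \<Longrightarrow> length B = N \<Longrightarrow> tpow (mat k) A B = (if A = B then k ^ N else 0)"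
proof (induction N arbitrary: A B)
  case (Suc N)
  then obtain a A' b B' where "A = a # A'" "B = b # B'" "length A' = N" "length B' = N"
    by (metis length_Suc_conv)
  then show ?case using Suc.IH[of A' B'] by (simp add: mat_def)
qed simp

definition permute :: "nat \<Rightarrow> (nat \<Rightarrow> nat) \<Rightarrow> 'a list \<Rightarrow> 'a list" where
  "permute N \<pi> xs = map (\<lambda>i. xs ! \<pi> i) [0..<N]"

lemma permute_in_tuples [simp]: "permute N \<pi> xs \<in> tuples N"
  by (simp add: permute_def tuples_def)

lemma permute_compose:
  "\<pi> permutes {..<N} \<Longrightarrow> permute N \<pi> (permute N \<tau> xs) = permute N (\<tau> \<circ> \<pi>) xs"
  by (auto simp: permute_def permutes_in_image[of _ "{..<N}", simplified])

lemma permute_id: "xs \<in> tuples N \<Longrightarrow> permute N id xs = xs"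
  using map_nth[of xs] by (simp add: permute_def tuples_def)

lemma permute_inverse:
  assumes "\<pi> permutes {..<N}" "xs \<in> tuples N"
  shows "permute N \<pi> (permute N (inv \<pi>) xs) = xs" "permute N (inv \<pi>) (permute N \<pi> xs) = xs"
  using assms by (simp_all add: permute_compose permutes_inv permutes_inv_o permute_id)

lemma permute_eq_iff:
  assumes "\<pi> permutes {..<N}" "xs \<in> tuples N" "ys \<in> tuples N"
  shows "permute N \<pi> xs = ys \<longleftrightarrow> xs = permute N (inv \<pi>) ys"
  using permute_inverse[OF assms(1)] assms(2,3) by metis

lemma bij_permute:
  assumes "\<pi> permutes {..<N}"
  shows "bij_betw (permute N \<pi>) (tuples N) (tuples N)"
  by (rule bij_betw_byWitness[of _ "permute N (inv \<pi>)"])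
    (use permute_inverse[OF assms] in auto)

lemma sum_tuples_permute:
  assumes "\<pi> permutes {..<N}"
  shows "(\<Sum>xs\<in>tuples N. f (permute N \<pi> xs)) = (\<Sum>xs\<in>tuples N. f xs)"
  by (rule sum.reindex_bij_betw[OF bij_permute[OF assms]])

section \<open>The first fundamental theorem for matrix tensors\<close>

text \<open>
  The matrices that are fed into the polarization formula. The scalar part, larger than the number
  of matrix units, makes them invertible.
\<close>

definition shifted_unit_sum :: "'m list \<Rightarrow> 'm list \<Rightarrow> nat set \<Rightarrow> complex^'m::finite^'m" where
  "shifted_unit_sum a b S = mat (of_nat (length a) + 1) + (\<Sum>s\<in>S. mat_unit (a ! s) (b ! s))"

lemma shifted_unit_sum_nth:
  "shifted_unit_sum a b S $ i $ j = (if i = j then of_nat (length a) + 1 else 0) + (\<Sum>s\<in>S. if i = a ! s \<and> j =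
      b ! s then 1 else 0)"
  by (simp add: shifted_unit_sum_def mat_def mat_unit_def)

text \<open>
  At a coordinate of largest modulus of a kernel vector, the contribution of the scalar part
  \<open>length a + 1\<close> cannot be cancelled by those of at most \<open>length a\<close> matrix units.
\<close>

lemma invertible_shifted_unit_sum:
  fixes a b :: "'m::finite list"
  assumes S: "S \<subseteq> {..<length a}"
  shows "invertible (shifted_unit_sum a b S)"
proof -
  let ?M = "shifted_unit_sum a b S"
  let ?N = "real (length a)"
  have "v = 0" if v: "?M *v v = 0" for v :: "complex^'m"
  proof -
    have "Max (range (\<lambda>i. cmod (v $ i))) \<in> range (\<lambda>i. cmod (v $ i))" by (intro Max_in) auto
    then obtain i where i: "Max (range (\<lambda>i. cmod (v $ i))) = cmod (v $ i)" by (rule rangeE)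
    have mx: "cmod (v $ j) \<le> cmod (v $ i)" for j unfolding i[symmetric] by simp
    have "0 = (\<Sum>j\<in>UNIV. ?M $ i $ j * v $ j)"
      using v by (simp add: matrix_vector_mult_def vec_eq_iff)
    also have "\<dots> = (of_nat (length a) + 1) * v $ i + (\<Sum>j\<in>UNIV. \<Sum>s\<in>S. if i = a ! s \<and> j = b ! s then v $ j else 0)"
    proof -
      have "?M $ i $ j * v $ j = (if j = i then (of_nat (length a) + 1) * v $ i else 0) +
          (\<Sum>s\<in>S. if i = a ! s \<and> j = b ! s then v $ j else 0)" for j
        unfolding shifted_unit_sum_nth distrib_right sum_distrib_right
        by (intro arg_cong2[where f = "(+)"] sum.cong) (auto simp: distrib_right)
      then show ?thesis by (simp add: sum.distrib)
    qed
    also have "(\<Sum>j\<in>UNIV. \<Sum>s\<in>S. if i = a ! s \<and> j = b ! s then v $ j else 0) = (\<Sum>s\<in>S. if i =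
        a ! s then v $ (b ! s) else 0)"
      by (subst sum.swap) (auto intro!: sum.cong)
    finally have "(of_nat (length a) + 1) * v $ i = - (\<Sum>s\<in>S. if i = a ! s then v $ (b ! s) else 0)"
      by (simp add: eq_neg_iff_add_eq_0)
    then have "cmod ((of_nat (length a) + 1) * v $ i) = cmod (\<Sum>s\<in>S. if i = a ! s then v $ (b ! s) else 0)" by simp
    also have "\<dots> \<le> (\<Sum>s\<in>S. cmod (v $ i))"
    proof (rule order_trans[OF norm_sum sum_mono])
      fix s
      show "cmod (if i = a ! s then v $ (b ! s) else 0) \<le> cmod (v $ i)"
        using mx[of "b ! s"] by (cases "i = a ! s") simp_all
    qed
    also have "\<dots> \<le> ?N * cmod (v $ i)"
      using card_mono[OF _ S] by (simp add: mult_right_mono)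
    also have "cmod ((of_nat (length a) + 1) * v $ i) = (?N + 1) * cmod (v $ i)"
      by (metis norm_mult norm_of_nat of_nat_Suc add.commute)
    finally have "cmod (v $ i) \<le> 0" by (simp add: algebra_simps)
    then have "cmod (v $ j) \<le> 0" for j using mx[of j] by linarith
    then show "v = 0" by (simp add: vec_eq_iff)
  qed
  then have "\<exists>B. B ** ?M = mat 1" unfolding matrix_left_invertible_ker by blast
  then show ?thesis by (simp add: invertible_left_inverse)
qed

definition commutes_on :: "'w set \<Rightarrow> ('w \<Rightarrow> 'w \<Rightarrow> complex) \<Rightarrow> ('w \<Rightarrow> 'w \<Rightarrow> complex) \<Rightarrow> bool" where
  "commutes_on D q Y \<longleftrightarrow> (\<forall>A\<in>D. \<forall>B\<in>D. (\<Sum>I\<in>D. q A I * Y I B) = (\<Sum>I\<in>D. Y A I * q I B))"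

lemma commutes_on_sum:
  assumes "\<And>k. k \<in> K \<Longrightarrow> commutes_on D q (Y k)"
    and "\<And>A B. A \<in> D \<Longrightarrow> B \<in> D \<Longrightarrow> Z A B = (\<Sum>k\<in>K. c k * Y k A B)"
  shows "commutes_on D q Z"
  unfolding commutes_on_def
proof (intro ballI)
  fix A B assume AB: "A \<in> D" "B \<in> D"
  have "(\<Sum>I\<in>D. q A I * Z I B) = (\<Sum>k\<in>K. c k * (\<Sum>I\<in>D. q A I * Y k I B))"
    unfolding sum_distrib_left by (subst sum.swap) (simp add: assms(2) AB sum_distrib_left mult_ac)
  also have "\<dots> = (\<Sum>k\<in>K. c k * (\<Sum>I\<in>D. Y k A I * q I B))"
    using assms(1) AB by (auto simp: commutes_on_def intro!: sum.cong)
  also have "\<dots> = (\<Sum>I\<in>D. Z A I * q I B)"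
    unfolding sum_distrib_left by (subst sum.swap) (simp add: assms(2)
        AB sum_distrib_left sum_distrib_right mult_ac)
  finally show "(\<Sum>I\<in>D. q A I * Z I B) = (\<Sum>I\<in>D. Z A I * q I B)" .
qed

text \<open>
  By polarization the symmetrization of a product of matrix units is a combination of tensor powers
  of invertible matrices.
\<close>

lemma commutes_with_orbit_sums:
  fixes q :: "'m::finite list \<Rightarrow> 'm list \<Rightarrow> complex"
  assumes q: "\<And>g. invertible g \<Longrightarrow> commutes_on (tuples N) q (tpow g)"
    and ab: "a \<in> tuples N" "b \<in> tuples N"
  shows "commutes_on (tuples N) q
    (\<lambda>A B. \<Sum>\<pi> | \<pi> permutes {..<N}. if A = permute N \<pi> a \<and> B = permute N \<pi> b then 1 else 0)"
proof (rule commutes_on_sum)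
  fix S assume "S \<in> Pow {..<N}"
  then show "commutes_on (tuples N) q (tpow (shifted_unit_sum a b S))"
    using ab by (intro q invertible_shifted_unit_sum) (auto simp: tuples_def)
next
  fix A B :: "'m list" assume AB: "A \<in> tuples N" "B \<in> tuples N"
  have len: "length a = N" "length A = N" "length B = N" using ab AB by (auto simp: tuples_def)
  have "(\<Sum>S\<in>Pow {..<N}. (-1) ^ card S * tpow (shifted_unit_sum a b S) A B) =
     (\<Sum>S\<in>Pow {..<N}. (-1) ^ card S * (\<Prod>r<N. (if A ! r = B ! r then of_nat N + 1 else 0) +
        (\<Sum>s\<in>S. if A ! r = a ! s \<and> B ! r = b ! s then 1 else 0)))"
    unfolding tpow_nth[OF len(2,3)] shifted_unit_sum_nth len(1) ..
  also have "\<dots> = (-1) ^ N * (\<Sum>\<pi> | \<pi> permutes {..<N}. \<Prod>r<N. if A ! r = a ! \<pi> r \<and> B ! r = b ! \<pi> r then 1 else 0)"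
    by (rule permanent_polarization)
  finally have "(\<Sum>S\<in>Pow {..<N}. (-1) ^ card S * tpow (shifted_unit_sum a b S) A B) =
     (-1) ^ N * (\<Sum>\<pi> | \<pi> permutes {..<N}. \<Prod>r<N. if A ! r = a ! \<pi> r \<and> B ! r = b ! \<pi> r then 1 else 0)" .
  moreover have "(\<Prod>r<N. if A ! r = a ! \<pi> r \<and> B ! r = b ! \<pi> r then 1 else (0::complex)) =
      (if A = permute N \<pi> a \<and> B = permute N \<pi> b then 1 else 0)" for \<pi>
  proof -
    have "(A = permute N \<pi> a \<and> B = permute N \<pi> b) \<longleftrightarrow> (\<forall>r<N. A ! r = a ! \<pi> r \<and> B ! r = b ! \<pi> r)"
      using len by (auto simp: list_eq_iff_nth_eq permute_def)
    then show ?thesis by (auto simp: prod_zero_iff intro!: prod.neutral)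
  qed
  ultimately have e: "(\<Sum>S\<in>Pow {..<N}. (-1) ^ card S * tpow (shifted_unit_sum a b S) A B) =
     (-1) ^ N * (\<Sum>\<pi> | \<pi> permutes {..<N}. if A = permute N \<pi> a \<and> B = permute N \<pi> b then 1 else 0)" by simp
  have "(\<Sum>S\<in>Pow {..<N}. ((-1) ^ N * (-1) ^ card S) * tpow (shifted_unit_sum a b S) A B) =
     (-1) ^ N * (\<Sum>S\<in>Pow {..<N}. (-1) ^ card S * tpow (shifted_unit_sum a b S) A B)"
    by (simp add: sum_distrib_left mult_ac)
  also have "\<dots> = (\<Sum>\<pi> | \<pi> permutes {..<N}. if A = permute N \<pi> a \<and> B = permute N \<pi> b then 1 else 0)"
    unfolding e mult.assoc[symmetric] power_mult_distrib[symmetric] by simp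
  finally show "(\<Sum>\<pi> | \<pi> permutes {..<N}. if A = permute N \<pi> a \<and> B = permute N \<pi> b then 1 else 0) =
     (\<Sum>S\<in>Pow {..<N}. ((-1) ^ N * (-1) ^ card S) * tpow (shifted_unit_sum a b S) A B)" by simp
qed

text \<open>
  The orbit sums of pairs of indices span the operators that commute with all permutations.
\<close>

lemma commutes_with_symmetric:
  fixes q :: "'m::finite list \<Rightarrow> 'm list \<Rightarrow> complex"
  assumes q: "\<And>g. invertible g \<Longrightarrow> commutes_on (tuples N) q (tpow g)"
    and sym: "\<And>\<pi> A B. \<pi> permutes {..<N} \<Longrightarrow> A \<in> tuples N \<Longrightarrow> B \<in> tuples N \<Longrightarrow>
      Y (permute N \<pi> A) (permute N \<pi> B) = Y A B"
  shows "commutes_on (tuples N) q Y"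
proof (rule commutes_on_sum)
  fix ab :: "'m list \<times> 'm list" assume "ab \<in> tuples N \<times> tuples N"
  then show "commutes_on (tuples N) q ((\<lambda>(a, b) A B. \<Sum>\<pi> | \<pi> permutes {..<N}.
       if A = permute N \<pi> a \<and> B = permute N \<pi> b then 1 else 0) ab)"
    by (auto intro!: commutes_with_orbit_sums q)
next
  fix A B :: "'m list" assume AB: "A \<in> tuples N" "B \<in> tuples N"
  have "(\<Sum>ab\<in>tuples N \<times> tuples N. (case ab of (a, b) \<Rightarrow> Y a b / fact N) *
      (\<lambda>(a, b) A B. \<Sum>\<pi> | \<pi> permutes {..<N}. if A = permute N \<pi> a \<and> B = permute N \<pi> b then 1 else 0) ab A B)
    = (\<Sum>a\<in>tuples N. \<Sum>b\<in>tuples N. \<Sum>\<pi> | \<pi> permutes {..<N}.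
        if a = permute N (inv \<pi>) A \<and> b = permute N (inv \<pi>) B then Y a b / fact N else 0)"
    unfolding sum.cartesian_product'
    by (intro sum.cong refl) (auto simp: sum_distrib_left permute_eq_iff AB eq_commute[of A] eq_commute[of B]
        intro!: sum.cong)
  also have "\<dots> = (\<Sum>\<pi> | \<pi> permutes {..<N}. \<Sum>a\<in>tuples N. \<Sum>b\<in>tuples N.
        if a = permute N (inv \<pi>) A \<and> b = permute N (inv \<pi>) B then Y a b / fact N else 0)"
    by (rule trans[OF sum.cong[OF refl sum.swap] sum.swap])
  also have "\<dots> = (\<Sum>\<pi> | \<pi> permutes {..<N}. Y A B / fact N)"
  proof (rule sum.cong[OF refl])
    fix \<pi> assume "\<pi> \<in> {\<pi>. \<pi> permutes {..<N}}"
    then have "inv \<pi> permutes {..<N}" by (simp add: permutes_inv)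
    have "(\<Sum>a\<in>tuples N. \<Sum>b\<in>tuples N.
        if a = permute N (inv \<pi>) A \<and> b = permute N (inv \<pi>) B then Y a b / fact N else 0)
      = (\<Sum>a\<in>tuples N. if a = permute N (inv \<pi>) A then Y a (permute N (inv \<pi>) B) / fact N else 0)"
      by (intro sum.cong refl) auto
    also have "\<dots> = Y A B / fact N" using sym[OF \<open>inv \<pi> permutes {..<N}\<close> AB] by simp
    finally show "(\<Sum>a\<in>tuples N. \<Sum>b\<in>tuples N.
        if a = permute N (inv \<pi>) A \<and> b = permute N (inv \<pi>) B then Y a b / fact N else 0) = Y A B / fact N" .
  qed
  also have "\<dots> = Y A B"
    using card_permutations[OF refl, of "{..<N}"] by simp
  finally show "Y A B = (\<Sum>ab\<in>tuples N \<times> tuples N. (case ab of (a, b) \<Rightarrow> Y a b / fact N) *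
      (\<lambda>(a, b) A B. \<Sum>\<pi> | \<pi> permutes {..<N}. if A = permute N \<pi> a \<and> B = permute N \<pi> b then 1 else 0) ab A B)" ..
qed


text \<open>
  The double commutant theorem for the span \<open>C\<close> of the permutation operators. Let \<open>p\<close> be the
  orthogonal projection of the space of all operators onto \<open>C\<close>. It commutes with left multiplication by
  permutations, hence the operators that describe how \<open>p\<close> maps column \<open>I\<close> to column \<open>J\<close> are symmetric
  and commute with \<open>q\<close>. Therefore \<open>p\<close> commutes with left multiplication by \<open>q\<close>, and
  \<open>p(q) = q p(1) = q\<close> because the identity lies in \<open>C\<close>.
\<close>

lemma double_commutant_of_permutations:
  fixes q :: "'m::finite list \<Rightarrow> 'm list \<Rightarrow> complex"
  assumes comm: "\<And>Y. (\<And>\<pi> A B. \<pi> permutes {..<N} \<Longrightarrow> A \<in> tuples N \<Longrightarrow> B \<in> tuples N \<Longrightarrow>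
      Y (permute N \<pi> A) (permute N \<pi> B) = Y A B) \<Longrightarrow> commutes_on (tuples N) q Y"
  shows "\<exists>c. \<forall>A\<in>tuples N. \<forall>B\<in>tuples N.
    q A B = (\<Sum>\<pi> | \<pi> permutes {..<N}. if A = permute N \<pi> B then c \<pi> else 0)"
proof -
  let ?D = "tuples N :: 'm list set" and ?P = "{\<pi>. \<pi> permutes {..<N}}"
  define C where "C = {X. \<exists>c. \<forall>A\<in>?D. \<forall>B\<in>?D. X (A, B) = (\<Sum>\<pi>\<in>?P. if A = permute N \<pi> B then c \<pi> else (0::complex))}"
  have C0: "(\<lambda>_. 0) \<in> C" unfolding C_def by (auto intro!: exI[of _ "\<lambda>_. 0"])
  have Cadd: "(\<lambda>i. X i + Z i) \<in> C" if XZ: "X \<in> C" "Z \<in> C" for X Z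
  proof -
    obtain c d where "\<forall>A\<in>?D. \<forall>B\<in>?D. X (A, B) = (\<Sum>\<pi>\<in>?P. if A = permute N \<pi> B then c \<pi> else 0)"
      "\<forall>A\<in>?D. \<forall>B\<in>?D. Z (A, B) = (\<Sum>\<pi>\<in>?P. if A = permute N \<pi> B then d \<pi> else 0)"
      using XZ unfolding C_def by blast
    then show ?thesis unfolding C_def
      by (auto simp: sum.distrib[symmetric] intro!: exI[of _ "\<lambda>\<pi>. c \<pi> + d \<pi>"] sum.cong)
  qed
  have Cscale: "(\<lambda>i. k * X i) \<in> C" if X: "X \<in> C" for X k
  proof -
    obtain c where "\<forall>A\<in>?D. \<forall>B\<in>?D. X (A, B) = (\<Sum>\<pi>\<in>?P. if A = permute N \<pi> B then c \<pi> else 0)"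
      using X unfolding C_def by blast
    then show ?thesis unfolding C_def
      by (auto simp: sum_distrib_left intro!: exI[of _ "\<lambda>\<pi>. k * c \<pi>"] sum.cong)
  qed
  have Csum: "(\<lambda>i. \<Sum>k\<in>K. a k * X k i) \<in> C" if "\<And>k. k \<in> K \<Longrightarrow> X k \<in> C" for K :: "'k set" and a X
    using that
    by (induction K rule: infinite_finite_induct) (auto intro!: C0 Cadd Cscale)
  have Ctrans: "(\<lambda>(A, B). X (permute N \<tau> A, B)) \<in> C" if X: "X \<in> C" and \<tau>: "\<tau> permutes {..<N}" for X \<tau>
  proof -
    obtain c where c: "\<And>A B. A \<in> ?D \<Longrightarrow> B \<in> ?D \<Longrightarrow> X (A, B) = (\<Sum>\<pi>\<in>?P. if A = permute N \<pi> B then c \<pi> else 0)"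
      using X unfolding C_def by blast
    have "X (permute N \<tau> A, B) = (\<Sum>\<pi>\<in>?P. if A = permute N \<pi> B then c (\<pi> \<circ> \<tau>) else 0)" if AB: "A \<in> ?D" "B \<in> ?D"
        for A B
    proof -
      have "X (permute N \<tau> A, B) = (\<Sum>\<pi>\<in>?P. if permute N \<tau> A = permute N \<pi> B then c \<pi> else 0)"
        using c AB by simp
      also have "\<dots> = (\<Sum>\<pi>\<in>?P. if permute N \<tau> A = permute N (\<pi> \<circ> \<tau>) B then c (\<pi> \<circ> \<tau>) else 0)"
        by (rule sum.reindex_bij_betw[symmetric, OF bij_betw_byWitness[of _ "\<lambda>\<pi>. \<pi> \<circ> inv \<tau>"]])
          (use \<tau> in \<open>auto simp: o_assoc[symmetric] permutes_inv_o intro!: permutes_compose permutes_inv\<close>)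
      also have "\<dots> = (\<Sum>\<pi>\<in>?P. if A = permute N \<pi> B then c (\<pi> \<circ> \<tau>) else 0)"
      proof (rule sum.cong[OF refl])
        fix \<pi> assume "\<pi> \<in> ?P"
        have "permute N \<tau> A = permute N (\<pi> \<circ> \<tau>) B \<longleftrightarrow> permute N \<tau> A = permute N \<tau> (permute N \<pi> B)"
          using \<tau> by (simp add: permute_compose)
        also have "\<dots> \<longleftrightarrow> A = permute N \<pi> B"
          using \<tau> AB by (metis permute_eq_iff permute_in_tuples)
        finally show "(if permute N \<tau> A = permute N (\<pi> \<circ> \<tau>) B then c (\<pi> \<circ> \<tau>) else 0) =
          (if A = permute N \<pi> B then c (\<pi> \<circ> \<tau>) else 0)" by simp
      qed
      finally show ?thesis .
    qed
    then show ?thesis unfolding C_def by (auto intro!: exI[of _ "\<lambda>\<pi>. c (\<pi> \<circ> \<tau>)"])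
  qed
  let ?ip = "\<lambda>X Z. \<Sum>x\<in>?D \<times> ?D. X x * cnj (Z x)"
  have fin: "finite (?D \<times> ?D)" by simp
  have unique: "X x = 0" if "X \<in> C" "\<And>Z. Z \<in> C \<Longrightarrow> ?ip X Z = 0" "x \<in> ?D \<times> ?D" for X x
    using orthogonal_self_zero[OF fin that(2)[OF that(1)] that(3)] .
  \<comment> \<open>\<open>n B I\<close> is the projection \<open>p\<close> of the matrix unit \<open>e B I\<close>.\<close>
  define e where "e B I = (\<lambda>x. if x = (B, I) then 1 else (0::complex))" for B I :: "'m list"
  have "\<exists>n\<in>C. \<forall>Z\<in>C. ?ip (\<lambda>x. e B I x - n x) Z = 0" for B I
    by (rule orthogonal_decomposition[OF fin C0 Cadd Cscale])
  then obtain n where nC: "n B I \<in> C" and n: "Z \<in> C \<Longrightarrow> ?ip (\<lambda>x. e B I x - n B I x) Z = 0" for B I Z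
    by metis
  \<comment> \<open>The projection of a matrix unit, translated by a permutation, is the projection of the translated unit.\<close>
  have equivariant: "n (permute N \<tau> B) I (permute N \<tau> A, J) = n B I (A, J)"
    if \<tau>: "\<tau> permutes {..<N}" and D: "A \<in> ?D" "B \<in> ?D" "I \<in> ?D" "J \<in> ?D" for \<tau> A B I J
  proof -
    define n' where "n' = (\<lambda>(A, J). n (permute N \<tau> B) I (permute N \<tau> A, J))"
    have n'C: "n' \<in> C" unfolding n'_def by (rule Ctrans[OF nC \<tau>])
    have orth: "?ip (\<lambda>x. e B I x - n' x) Z = 0" if Z: "Z \<in> C" for Z
    proof -
      define Z' where "Z' = (\<lambda>(A, B). Z (permute N (inv \<tau>) A, B))"
      have Z'C: "Z' \<in> C" unfolding Z'_def by (rule Ctrans[OF Z permutes_inv[OF \<tau>]])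
      have "?ip (\<lambda>x. e B I x - n' x) Z =
        (\<Sum>A\<in>?D. \<Sum>J\<in>?D. (e B I (A, J) - n' (A, J)) * cnj (Z (A, J)))"
        by (simp add: sum.cartesian_product')
      also have "\<dots> = (\<Sum>A\<in>?D. \<Sum>J\<in>?D. (e (permute N \<tau> B) I (permute N \<tau> A, J) - n (permute N \<tau> B)
          I (permute N \<tau> A, J))
           * cnj (Z' (permute N \<tau> A, J)))"
      proof (intro sum.cong refl)
        fix A J assume A: "A \<in> ?D"
        have "permute N \<tau> A = permute N \<tau> B \<longleftrightarrow> A = B"
          using \<tau> A D by (metis permute_inverse(2))
        then show "(e B I (A, J) - n' (A, J)) * cnj (Z (A, J)) =
          (e (permute N \<tau> B) I (permute N \<tau> A, J) - n (permute N \<tau> B) I (permute N \<tau> A, J)) *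
              cnj (Z' (permute N \<tau> A, J))"
          by (simp add: e_def n'_def Z'_def permute_inverse[OF \<tau> A])
      qed
      also have "\<dots> = (\<Sum>A\<in>?D. \<Sum>J\<in>?D. (e (permute N \<tau> B) I (A, J) - n (permute N \<tau> B) I (A, J)) * cnj (Z' (A, J)))"
        by (rule sum_tuples_permute[OF \<tau>, of "\<lambda>A. \<Sum>J\<in>?D. (e (permute N \<tau> B) I (A, J) - n (permute N \<tau> B) I (A,
            J)) * cnj (Z' (A, J))"])
      also have "\<dots> = ?ip (\<lambda>x. e (permute N \<tau> B) I x - n (permute N \<tau> B) I x) Z'"
        by (simp add: sum.cartesian_product')
      finally show ?thesis using n[OF Z'C] by simp
    qed
    have "n' (A, J) - n B I (A, J) = 0"
    proof (rule unique[of "\<lambda>x. n' x - n B I x"])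
      show "(\<lambda>x. n' x - n B I x) \<in> C" using Cadd[OF n'C Cscale[OF nC, of "-1"]] by simp
      show "?ip (\<lambda>x. n' x - n B I x) Z = 0" if Z: "Z \<in> C" for Z
      proof -
        have "?ip (\<lambda>x. n' x - n B I x) Z = ?ip (\<lambda>x. e B I x - n B I x) Z - ?ip (\<lambda>x. e B I x - n' x) Z"
          unfolding sum_subtractf[symmetric] by (intro sum.cong refl) (simp add: algebra_simps)
        then show ?thesis using n[OF Z] orth[OF Z] by simp
      qed
    qed (use D in simp)
    then show ?thesis by (simp add: n'_def)
  qed
  have unit: "(\<Sum>I\<in>?D. n I I (A, J)) = (if A = J then 1 else 0)" if D: "A \<in> ?D" "J \<in> ?D" for A J
  proof -
    define E where "E = (\<lambda>(A :: 'm list, B). if A = B then 1 else (0::complex))"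
    have EC: "E \<in> C"
    proof -
      have "(\<Sum>\<pi>\<in>?P. if A = permute N \<pi> B then (if \<pi> = id then 1 else 0) else (0::complex)) = (if A =
          B then 1 else 0)"
        if "A \<in> ?D" "B \<in> ?D" for A B
      proof -
        have "(\<Sum>\<pi>\<in>?P. if A = permute N \<pi> B then (if \<pi> = id then 1 else 0) else (0::complex)) =
           (\<Sum>\<pi>\<in>?P. if \<pi> = id then (if A = B then 1 else 0) else 0)"
          using permute_id[OF that(2)] by (intro sum.cong refl) auto
        also have "\<dots> = (if A = B then 1 else 0)"
          using permutes_id[of "{..<N}"] by (subst sum.delta) (auto simp: finite_permutations)
        finally show ?thesis .
      qed
      then show ?thesis unfolding C_def E_def by (auto intro!: exI[of _ "\<lambda>\<pi>. if \<pi> = id then 1 else 0"])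
    qed
    have SC: "(\<lambda>x. \<Sum>I\<in>?D. n I I x) \<in> C"
      using Csum[of ?D "\<lambda>I. n I I" "\<lambda>_. 1"] nC by simp
    have "E (A, J) - (\<Sum>I\<in>?D. n I I (A, J)) = 0"
    proof (rule unique[of "\<lambda>x. E x - (\<Sum>I\<in>?D. n I I x)"])
      show "(\<lambda>x. E x - (\<Sum>I\<in>?D. n I I x)) \<in> C" using Cadd[OF EC Cscale[OF SC, of "-1"]] by simp
      show "?ip (\<lambda>x. E x - (\<Sum>I\<in>?D. n I I x)) Z = 0" if Z: "Z \<in> C" for Z
      proof -
        have "E x - (\<Sum>I\<in>?D. n I I x) = (\<Sum>I\<in>?D. e I I x - n I I x)" if x: "x \<in> ?D \<times> ?D" for x
        proof -
          obtain U V where UV: "x = (U, V)" "U \<in> ?D" "V \<in> ?D" using x by auto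
          have "(\<Sum>I\<in>?D. e I I x) = (\<Sum>I\<in>?D. if I = U then (if U = V then 1 else 0) else 0)"
            by (intro sum.cong refl) (auto simp: e_def UV)
          also have "\<dots> = E x" using UV by (simp add: E_def)
          finally show ?thesis by (simp add: sum_subtractf)
        qed
        then have "?ip (\<lambda>x. E x - (\<Sum>I\<in>?D. n I I x)) Z = (\<Sum>x\<in>?D \<times> ?D. \<Sum>I\<in>?D. (e I I x - n I I x) * cnj (Z x))"
          by (intro sum.cong refl) (simp add: sum_distrib_right)
        also have "\<dots> = (\<Sum>I\<in>?D. ?ip (\<lambda>x. e I I x - n I I x) Z)" by (rule sum.swap)
        also have "\<dots> = 0" using n[OF Z] by simp
        finally show ?thesis .
      qed
    qed (use D in simp)
    then show ?thesis by (simp add: E_def)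
  qed
  define p where "p = (\<lambda>x. \<Sum>k\<in>?D \<times> ?D. q (fst k) (snd k) * n (fst k) (snd k) x)"
  have pC: "p \<in> C" unfolding p_def by (rule Csum) (rule nC)
  have "p (A, J) = q A J" if D: "A \<in> ?D" "J \<in> ?D" for A J
  proof -
    \<comment> \<open>\<open>\<lambda>A B. n B I' (A, J)\<close> is symmetric, hence commutes with \<open>q\<close>; evaluate in column \<open>I'\<close>.\<close>
    have comm': "(\<Sum>B\<in>?D. q A B * n I' I' (B, J)) = (\<Sum>B\<in>?D. n B I' (A, J) * q B I')" if I': "I' \<in> ?D" for I'
    proof -
      have "commutes_on ?D q (\<lambda>A B. if A \<in> ?D \<and> B \<in> ?D then n B I' (A, J) else 0)"
        by (rule comm) (use equivariant I' D in auto)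
      then have "(\<Sum>B\<in>?D. q A B * (if B \<in> ?D \<and> I' \<in> ?D then n I' I' (B, J) else 0)) =
          (\<Sum>B\<in>?D. (if A \<in> ?D \<and> B \<in> ?D then n B I' (A, J) else 0) * q B I')"
        using D I' unfolding commutes_on_def by blast
      then show ?thesis using D I' by simp
    qed
    have "p (A, J) = (\<Sum>B\<in>?D. \<Sum>I\<in>?D. n B I (A, J) * q B I)"
      by (simp add: p_def sum.cartesian_product' mult.commute)
    also have "\<dots> = (\<Sum>I\<in>?D. \<Sum>B\<in>?D. q A B * n I I (B, J))"
      by (subst sum.swap) (simp add: comm')
    also have "\<dots> = (\<Sum>B\<in>?D. q A B * (\<Sum>I\<in>?D. n I I (B, J)))"
      by (subst sum.swap) (simp add: sum_distrib_left)
    also have "\<dots> = (\<Sum>B\<in>?D. if B = J then q A B else 0)"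
      by (intro sum.cong refl) (simp add: unit D)
    also have "\<dots> = q A J" using D by simp
    finally show ?thesis .
  qed
  then show ?thesis using pC unfolding C_def by auto
qed

text \<open>
  The commutant of \<open>GL\<^sub>m\<close> on a tensor power of its natural representation is spanned by the
  permutations of the factors: commuting with tensor powers of invertible matrices is the same as
  commuting with all symmetric operators, and these form the commutant of the permutations.
\<close>

theorem tensor_first_fundamental_theorem:
  fixes q :: "'m::finite list \<Rightarrow> 'm list \<Rightarrow> complex"
  assumes "\<And>g. invertible g \<Longrightarrow> commutes_on (tuples N) q (tpow g)"
  shows "\<exists>c. \<forall>A\<in>tuples N. \<forall>B\<in>tuples N.
    q A B = (\<Sum>\<pi> | \<pi> permutes {..<N}. if A = permute N \<pi> B then c \<pi> else 0)"
  by (rule double_commutant_of_permutations) (rule commutes_with_symmetric[OF assms])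

section \<open>Powers of a matrix with the commutation relations of \<open>gl\<^sub>m\<close>\<close>

text \<open>
  The powers are defined entrywise because the algebra may be trivial, that is, satisfy \<open>0 = 1\<close>.
\<close>

primrec mpow :: "('m::finite \<Rightarrow> 'm \<Rightarrow> 'a::complex_algebra) \<Rightarrow> nat \<Rightarrow> 'm \<Rightarrow> 'm \<Rightarrow> 'a" where
  "mpow w 0 a b = (if a = b then 1 else 0)"
| "mpow w (Suc s) a b = (\<Sum>f\<in>UNIV. w a f * mpow w s f b)"

lemma mult_if_delta:
  fixes x :: "'a::{mult_zero,monoid_mult}"
  shows "x * (if P then 1 else 0) = (if P then x else 0)" "(if P then 1 else 0) * x = (if P then x else 0)"
  by auto

lemma mpow_1 [simp]: "mpow w (Suc 0) a b = w a b"
  by (simp add: mult_if_delta)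

lemma mpow_add: "mpow w (r + s) a b = (\<Sum>f\<in>UNIV. mpow w r a f * mpow w s f b)"
proof (induction r arbitrary: a)
  case 0
  then show ?case by (simp add: mult_if_delta)
next
  case (Suc r)
  have "mpow w (Suc r + s) a b = (\<Sum>g\<in>UNIV. \<Sum>f\<in>UNIV. w a g * (mpow w r g f * mpow w s f b))"
    by (simp add: Suc.IH sum_distrib_left)
  also have "\<dots> = (\<Sum>f\<in>UNIV. mpow w (Suc r) a f * mpow w s f b)"
    by (subst sum.swap) (simp add: sum_distrib_right mult.assoc)
  finally show ?case .
qed

lemma mpow_Suc_right: "mpow w (Suc s) a b = (\<Sum>f\<in>UNIV. mpow w s a f * w f b)"
  using mpow_add[of w s "Suc 0" a b] by (simp only: mpow_1 add_Suc_right add_0_right)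

locale gl_type_matrix =
  fixes w :: "'m::finite \<Rightarrow> 'm \<Rightarrow> 'a::complex_algebra" and t :: complex
  assumes bracket: "w a b * w c d - w c d * w a b =
      - (t *\<^sub>C ((if a = d then w c b else 0) - (if b = c then w a d else 0)))"
begin

definition comm :: "nat \<Rightarrow> nat \<Rightarrow> 'm \<Rightarrow> 'm \<Rightarrow> 'm \<Rightarrow> 'm \<Rightarrow> 'a" where
  "comm r s a b c d = mpow w r a b * mpow w s c d - mpow w s c d * mpow w r a b"

text \<open>
  The commutator with \<open>w\<^sub>a\<^sub>b\<close> is a derivation, and the two extra terms arising at the junction of
  two factors of a matrix product cancel.
\<close>

lemma bracket_mpow:
  "w a b * mpow w s c d - mpow w s c d * w a b =
    - (t *\<^sub>C ((if a = d then mpow w s c b else 0) - (if b = c then mpow w s a d else 0)))"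
proof (induction s arbitrary: c)
  case 0
  show ?case by (auto simp: mult_if_delta)
next
  case (Suc s)
  have "w a b * mpow w (Suc s) c d - mpow w (Suc s) c d * w a b =
     (\<Sum>f\<in>UNIV. (w a b * w c f - w c f * w a b) * mpow w s f d + w c f * (w a b * mpow w s f d - mpow w s f d *
         w a b))"
    by (simp add: sum_distrib_left sum_distrib_right sum_subtractf[symmetric] algebra_simps)
  also have "\<dots> = (\<Sum>f\<in>UNIV. - (t *\<^sub>C ((if f = a then w c b * mpow w s a d else 0) - (if b = c then w a f *
      mpow w s f d else 0)
       + (if a = d then w c f * mpow w s f b else 0) - (if f = b then w c b * mpow w s a d else 0))))"
    by (rule sum.cong[OF refl], unfold bracket Suc)
      (auto simp: mult_scaleC_left mult_scaleC_right algebra_simps scaleC_add_right scaleC_diff_right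
          scaleC_minus_right)
  also have "\<dots> = - (t *\<^sub>C ((if a = d then mpow w (Suc s) c b else 0) - (if b = c then mpow w (Suc s)
      a d else 0)))"
    unfolding sum_negf scaleC_sum_right[symmetric] sum.distrib sum_subtractf
    by auto
  finally show ?case .
qed

lemma comm_Suc_left:
  "comm (Suc r) s a b c d = (\<Sum>f\<in>UNIV. w a f * comm r s f b c d)
     - t *\<^sub>C ((if a = d then mpow w (r + s) c b else 0) - mpow w s a d * mpow w r c b)" 
proof -
  have "comm (Suc r) s a b c d = (\<Sum>f\<in>UNIV. w a f * comm r s f b c d
      + (w a f * mpow w s c d - mpow w s c d * w a f) * mpow w r f b)"
    by (simp add: comm_def sum_distrib_left sum_distrib_right sum_subtractf[symmetric] algebra_simps)
  also have "\<dots> = (\<Sum>f\<in>UNIV. w a f * comm r s f b c d)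
     - t *\<^sub>C (\<Sum>f\<in>UNIV. (if a = d then mpow w s c f * mpow w r f b else 0) - (if f = c then mpow w s a d *
         mpow w r c b else 0))"
    unfolding bracket_mpow scaleC_sum_right sum_subtractf[symmetric]
    by (rule sum.cong[OF refl]) (auto simp: mult_scaleC_left algebra_simps scaleC_diff_right)
  also have "(\<Sum>f\<in>UNIV. (if a = d then mpow w s c f * mpow w r f b else 0) - (if f = c then mpow w s a d *
      mpow w r c b else 0))
     = (if a = d then mpow w (r + s) c b else 0) - mpow w s a d * mpow w r c b"
    by (simp add: sum_subtractf mpow_add[of w s r] add.commute[of r s])
  finally show ?thesis .
qed

lemma comm_0: "comm 0 s a b c d = 0"
  by (simp add: comm_def mult_if_delta)

text \<open>
  The relation \<open>(x - y) [R\<^sub>a\<^sub>b(x), R\<^sub>c\<^sub>d(y)] = - t (R\<^sub>a\<^sub>d(x) R\<^sub>c\<^sub>b(y) - R\<^sub>a\<^sub>d(y) R\<^sub>c\<^sub>b(x))\<close> of the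
  resolvent \<open>R(x) = (x - w)\<^bsup>-1\<^esup>\<close>, read off coefficientwise.
\<close>

lemma comm_telescope:
  "comm (Suc r) s a b c d - comm r (Suc s) a b c d =
    - (t *\<^sub>C (mpow w r a d * mpow w s c b - mpow w s a d * mpow w r c b))"
proof (induction r arbitrary: a)
  case 0
  show ?case
    by (simp add: comm_Suc_left comm_0 mult_if_delta)
next
  case (Suc r)
  \<comment> \<open>Splits \<open>comm_Suc_left\<close> for the two commutators into main terms and corrections.\<close>
  have rearrange: "(A - P) - (B - Q) = (A - B) - P + Q" for A B P Q :: 'a by (simp add: algebra_simps)
  have "comm (Suc (Suc r)) s a b c d - comm (Suc r) (Suc s) a b c d =
     (\<Sum>f\<in>UNIV. w a f * (comm (Suc r) s f b c d - comm r (Suc s) f b c d))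
     - t *\<^sub>C ((if a = d then mpow w (Suc r + s) c b else 0) - mpow w s a d * mpow w (Suc r) c b)
     + t *\<^sub>C ((if a = d then mpow w (r + Suc s) c b else 0) - mpow w (Suc s) a d * mpow w r c b)"
    unfolding comm_Suc_left[of "Suc r"] comm_Suc_left[of r "Suc s" a] right_diff_distrib sum_subtractf
    by (rule rearrange)
  also have "(\<Sum>f\<in>UNIV. w a f * (comm (Suc r) s f b c d - comm r (Suc s) f b c d)) =
     - (t *\<^sub>C (mpow w (Suc r) a d * mpow w s c b - mpow w (Suc s) a d * mpow w r c b))"
    unfolding Suc.IH
    by (simp add: sum_negf mult_scaleC_right scaleC_sum_right[symmetric] right_diff_distrib sum_subtractf
        mult.assoc[symmetric] sum_distrib_right[symmetric])
  also have "- (t *\<^sub>C (mpow w (Suc r) a d * mpow w s c b - mpow w (Suc s) a d * mpow w r c b))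
     - t *\<^sub>C ((if a = d then mpow w (Suc r + s) c b else 0) - mpow w s a d * mpow w (Suc r) c b)
     + t *\<^sub>C ((if a = d then mpow w (r + Suc s) c b else 0) - mpow w (Suc s) a d * mpow w r c b)
     = - (t *\<^sub>C (mpow w (Suc r) a d * mpow w s c b - mpow w s a d * mpow w (Suc r) c b))"
    by (simp add: scaleC_diff_right del: mpow.simps)
  finally show ?case .
qed

text \<open>
  The right-hand side of \<open>comm_telescope\<close> changes sign when \<open>r\<close> and \<open>s\<close> are exchanged; so
  \<open>C(r, s) - C(s, r)\<close> depends only on \<open>r + s\<close>, and it vanishes for \<open>r = 0\<close>.
\<close>

lemma comm_symmetric: "comm r s a b c d = comm s r a b c d"
proof (induction r arbitrary: s)
  case 0
  show ?case by (simp add: comm_def mult_if_delta)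
next
  case (Suc r)
  have "comm (Suc r) s a b c d - comm r (Suc s) a b c d = - (comm (Suc s) r a b c d - comm s (Suc r) a b c d)"
    unfolding comm_telescope by (simp add: scaleC_diff_right)
  then show ?case using Suc.IH[of "Suc s"] by (simp add: algebra_simps)
qed

end

section \<open>The resolvent of the shifted matrix \<open>E\<close>\<close>

text \<open>
  The matrix \<open>w = - (c + t E)\<close>, for which \<open>x + c + t E = x - w\<close>.
\<close>

definition w_matrix :: "complex \<Rightarrow> complex \<Rightarrow> 'm \<Rightarrow> 'm \<Rightarrow> 'm::finite Ugl" where
  "w_matrix c t a b = - ((if a = b then c *\<^sub>C 1 else 0) + t *\<^sub>C U_E b a)"

lemma U_E_bracket: "U_E a b * U_E c d - U_E c d * U_E a b = (if b = c then U_E a d else 0) - (if a =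
    d then U_E c b else 0)"
proof -
  have gl0: "gl_incl 0 = 0" using gl_incl_add[of 0 0] by simp
  have minus: "gl_incl (M - N) = gl_incl M - gl_incl N" for M N :: "complex^'a^'a"
    using gl_incl_add[of "M - N" N] by simp
  have prod: "mat_unit a b ** mat_unit c d = (if b = c then mat_unit a d else 0)" for a b c d :: 'a
  proof -
    have "(\<Sum>k\<in>UNIV. mat_unit a b $ i $ k * mat_unit c d $ k $ j) =
      (\<Sum>k\<in>UNIV. if k = b then (if b = c \<and> i = a \<and> j = d then 1 else 0) else 0)" for i j
      by (rule sum.cong) (auto simp: mat_unit_def)
    then show ?thesis by (auto simp: matrix_matrix_mult_def vec_eq_iff mat_unit_def)
  qed
  show ?thesis
    unfolding U_E_def gl_incl_bracket[symmetric] prod by (auto simp: minus gl0)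
qed

lemma gl_type_matrix_w_matrix:
  assumes "t * t = 1"
  shows "gl_type_matrix (w_matrix c t :: 'm \<Rightarrow> 'm \<Rightarrow> 'm::finite Ugl) t"
proof
  fix a b i d :: 'm
  let ?c = "\<lambda>a b. if a = b then c *\<^sub>C 1 else (0 :: 'm Ugl)"
  have central: "?c a b * x = x * ?c a b" for a b x
    by (simp add: mult_scaleC_left mult_scaleC_right)
  have expand: "- (z + A) * - (z' + B) - - (z' + B) * - (z + A) = A * B - B * A"
    if "z * B = B * z" "z' * A = A * z'" "z * z' = z' * z" for z z' A B :: "'m Ugl"
  proof -
    have "- (z + A) * - (z' + B) - - (z' + B) * - (z + A) =
      A * B - B * A + (z * B - B * z) + (A * z' - z' * A) + (z * z' - z' * z)"
      by (simp add: algebra_simps)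
    then show ?thesis by (simp only: that) simp
  qed
  have "w_matrix c t a b * w_matrix c t i d - w_matrix c t i d * w_matrix c t a b =
     t *\<^sub>C t *\<^sub>C (U_E b a * U_E d i - U_E d i * U_E b a)"
    unfolding w_matrix_def expand[OF central central central]
    by (simp add: mult_scaleC_left mult_scaleC_right scaleC_diff_right)
  also have "\<dots> = U_E b a * U_E d i - U_E d i * U_E b a"
    using assms by (simp add: scaleC_scaleC scaleC_one)
  also have "\<dots> = (if a = d then U_E b i else 0) - (if b = i then U_E d a else 0)"
    unfolding U_E_bracket ..
  also have "\<dots> = (t * t) *\<^sub>C (if a = d then U_E b i else 0) - (t * t) *\<^sub>C (if b = i then U_E d a else 0)"
    using assms by (simp add: scaleC_one)
  also have "\<dots> = - (t *\<^sub>C ((if a = d then w_matrix c t i b else 0) - (if b = i then w_matrix c t a d else 0)))"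
    unfolding scaleC_minus_right[symmetric] scaleC_scaleC[symmetric] scaleC_diff_right[symmetric]
    by (rule arg_cong[where f = "(*\<^sub>C) t"]) (auto simp: w_matrix_def scaleC_diff_right)
  finally show "w_matrix c t a b * w_matrix c t i d - w_matrix c t i d * w_matrix c t a b =
    - (t *\<^sub>C ((if a = d then w_matrix c t i b else 0) - (if b = i then w_matrix c t a d else 0)))" .
qed

text \<open>
  The geometric series \<open>\<Sum>\<^sub>s w\<^bsup>s\<^esup> x\<^bsup>-s-1\<^esup>\<close>.
\<close>

definition resolvent :: "complex \<Rightarrow> complex \<Rightarrow> ('m::finite) Ugl fls ^'m^'m" where
  "resolvent c t = (\<chi> a b. fps_to_fls (Abs_fps (\<lambda>k. case k of 0 \<Rightarrow> 0 | Suc s \<Rightarrow> mpow (w_matrix c t) s a b)))"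

lemma resolvent_nth:
  "fls_nth (resolvent c t $ a $ b) k = (if k \<le> 0 then 0 else mpow (w_matrix c t) (nat (k - 1)) a b)"
proof -
  have "k > 0 \<Longrightarrow> nat k = Suc (nat (k - 1))" by simp
  then show ?thesis by (auto simp: resolvent_def)
qed

lemma shifted_E_matrix_nth:
  "shifted_E_matrix c t $ a $ b = (if a = b then fls_X_inv else 0) - fls_const (w_matrix c t a b)"
  by (rule fls_eqI) (auto simp: shifted_E_matrix_def mat_def w_matrix_def)

lemma matrix_inv_shifted_E_matrix:
  "matrix_inv (shifted_E_matrix c t) = (resolvent c t :: 'm::finite Ugl fls^'m^'m)"
proof -
  let ?Z = "shifted_E_matrix c t :: 'm Ugl fls^'m^'m" and ?R = "resolvent c t :: 'm Ugl fls^'m^'m"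
  have cases: "k < 0 \<or> k = 0 \<or> (\<exists>s. k = int (Suc s))" for k :: int
    by (metis linorder_neqE_linordered_idom zero_less_imp_eq_int gr0_implies_Suc)
  have nat_Suc: "nat (1 + int s) = Suc s" for s by simp
  have ZR: "?Z ** ?R = mat 1"
  proof (simp only: vec_eq_iff, intro allI, rule fls_eqI)
    fix a b k
    have "fls_nth ((?Z ** ?R) $ a $ b) k =
      (\<Sum>f\<in>UNIV. (if a = f then fls_nth (?R $ f $ b) (k + 1) else 0) - w_matrix c t a f * fls_nth (?R $ f $ b) k)"
      by (auto simp: matrix_matrix_mult_def fls_nth_sum shifted_E_matrix_nth algebra_simps
          fls_X_inv_times_conv_shift intro!: sum.cong)
    also have "\<dots> = fls_nth (?R $ a $ b) (k + 1) - (\<Sum>f\<in>UNIV. w_matrix c t a f * fls_nth (?R $ f $ b) k)"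
      by (simp add: sum_subtractf)
    also have "\<dots> = fls_nth (mat 1 $ a $ b) k"
      using cases[of k] by (auto simp: resolvent_nth mat_def nat_Suc)
    finally show "fls_nth ((?Z ** ?R) $ a $ b) k = fls_nth (mat 1 $ a $ b) k" .
  qed
  have RZ: "?R ** ?Z = mat 1"
  proof (simp only: vec_eq_iff, intro allI, rule fls_eqI)
    fix a b k
    have "fls_nth (?R $ a $ f * ?Z $ f $ b) k =
      (if f = b then fls_nth (?R $ a $ f) (k + 1) else 0) - fls_nth (?R $ a $ f) k * w_matrix c t f b" for f
      by (cases "f = b") (simp_all add: shifted_E_matrix_nth right_diff_distrib fls_X_inv_times_conv_shift)
    then have "fls_nth ((?R ** ?Z) $ a $ b) k =
      (\<Sum>f\<in>UNIV. (if f = b then fls_nth (?R $ a $ f) (k + 1) else 0) - fls_nth (?R $ a $ f) k * w_matrix c t f b)"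
      by (simp add: matrix_matrix_mult_def fls_nth_sum)
    also have "\<dots> = fls_nth (?R $ a $ b) (k + 1) - (\<Sum>f\<in>UNIV. fls_nth (?R $ a $ f) k * w_matrix c t f b)"
      by (simp add: sum_subtractf)
    also have "\<dots> = fls_nth (mat 1 $ a $ b) k"
      using cases[of k] by (auto simp: resolvent_nth mat_def nat_Suc mpow_Suc_right[symmetric] simp del:
          mpow.simps(2))
    finally show "fls_nth ((?R ** ?Z) $ a $ b) k = fls_nth (mat 1 $ a $ b) k" .
  qed
  define V where "V = matrix_inv ?Z"
  have "?Z ** V = mat 1 \<and> V ** ?Z = mat 1"
    unfolding V_def matrix_inv_def by (rule someI[of _ ?R]) (simp add: ZR RZ)
  then have "V = (?R ** ?Z) ** V" by (simp add: RZ)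
  also have "\<dots> = ?R" using \<open>?Z ** V = mat 1 \<and> V ** ?Z = mat 1\<close> by (simp add: matrix_mul_assoc[symmetric])
  finally show ?thesis by (simp add: V_def)
qed

section \<open>Homomorphisms out of presented algebras\<close>

interpretation calg: vector_space "scaleC :: complex \<Rightarrow> 'a \<Rightarrow> 'a::complex_algebra"
  by standard (simp_all add: scaleC_add_right scaleC_add_left scaleC_scaleC scaleC_one)

lemma alg_homD:
  assumes "alg_hom f"
  shows "f (x + y) = f x + f y" "f (c *\<^sub>C x) = c *\<^sub>C f x" "f (x * y) = f x * f y" "f 1 = 1" "f 0 = 0"
proof -
  show "f (x + y) = f x + f y" "f (c *\<^sub>C x) = c *\<^sub>C f x" "f (x * y) = f x * f y" "f 1 = 1"
    using assms by (simp_all add: alg_hom_def)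
  have "f (0 *\<^sub>C 0) = 0 *\<^sub>C f 0" using assms unfolding alg_hom_def by blast
  then show "f 0 = 0" by simp
qed

lemma alg_hom_sum: "alg_hom f \<Longrightarrow> f (sum g S) = (\<Sum>i\<in>S. f (g i))"
  by (induction S rule: infinite_finite_induct) (simp_all add: alg_homD)

lemma alg_hom_prod_list: "alg_hom f \<Longrightarrow> f (prod_list xs) = prod_list (map f xs)"
  by (induction xs) (simp_all add: alg_homD)

lemma alg_hom_diff: "alg_hom f \<Longrightarrow> f (x - y) = f x - f y"
  using alg_homD(1)[of f "x - y" y] by simp

lemma alg_hom_uminus: "alg_hom f \<Longrightarrow> f (- x) = - f x"
  using alg_hom_diff[of f 0 x] by (simp add: alg_homD)

lemma alg_hom_compose: "alg_hom f \<Longrightarrow> alg_hom g \<Longrightarrow> alg_hom (\<lambda>x. f (g x))"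
  by (simp add: alg_hom_def)

lemma alg_quot_in_span_basis: "x \<in> calg.span (range (basis_elem :: 'w::alg_relations \<Rightarrow> 'w alg_quot))"
proof -
  obtain p where p: "x = abs_alg_quot p" by (metis Quotient_abs_rep[OF Quotient_alg_quot])
  have abs_sum: "abs_alg_quot (\<Sum>i\<in>K. f i) = (\<Sum>i\<in>K. abs_alg_quot (f i))"
    for K :: "'w set" and f :: "'w \<Rightarrow> 'w \<Rightarrow>\<^sub>0 complex"
    by (induction K rule: infinite_finite_induct)
      (simp_all add: zero_alg_quot_def plus_alg_quot.abs_eq[symmetric])
  have "abs_alg_quot (Poly_Mapping.single w c) = c *\<^sub>C basis_elem w" for w :: 'w and c
    by (simp add: basis_elem_def scaleC_alg_quot.abs_eq mult_single)
  then have "x = (\<Sum>k\<in>Poly_Mapping.keys p. Poly_Mapping.lookup p k *\<^sub>C basis_elem k)"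
    unfolding p by (subst poly_mapping_sum_single[of p]) (simp add: abs_sum)
  moreover have "\<dots> \<in> calg.span (range basis_elem)"
    by (intro calg.span_sum calg.span_scale calg.span_base rangeI)
  ultimately show ?thesis by simp
qed

lemma basis_elem_word: "basis_elem (Free_Word gs) = prod_list (map gen gs)"
proof (induction gs)
  case Nil
  show ?case by (simp add: basis_elem_def one_alg_quot_def zero_free_word_def[symmetric])
next
  case (Cons g gs)
  have "basis_elem (Free_Word (g # gs)) = basis_elem (Free_Word [g]) * basis_elem (Free_Word gs)"
    by (simp add: basis_elem_def times_alg_quot.abs_eq mult_single plus_free_word_def)
  then show ?case using Cons by (simp add: gen_def)
qed

lemma presented_in_span_words: "x \<in> calg.span (range (\<lambda>gs. prod_list (map gen gs)))" for x ::
    "'g::presentation presented"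
proof -
  have "range (basis_elem :: 'g free_word \<Rightarrow> 'g presented) \<subseteq> range (\<lambda>gs. prod_list (map gen gs))"
    by (metis basis_elem_word free_word.exhaust image_subset_iff rangeI)
  then show ?thesis using alg_quot_in_span_basis calg.span_mono by blast
qed

lemma alg_hom_presented_eqI:
  fixes f g :: "'g::presentation presented \<Rightarrow> 'b::complex_algebra"
  assumes f: "alg_hom f" and g: "alg_hom g" and eq: "\<And>u. f (gen u) = g (gen u)"
  shows "f = g"
proof
  fix x
  show "f x = g x"
  proof (rule calg.span_induct[OF presented_in_span_words[of x]])
    show "calg.subspace {x. f x = g x}"
      using f g by (simp add: calg.subspace_def alg_homD)
  qed (use f g eq in \<open>auto simp: alg_hom_prod_list o_def\<close>)
qed

section \<open>The homomorphism from the Yangian\<close>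

text \<open>
  The coefficient of \<open>x\<^bsup>-s-1\<^esup>\<close> in the image of \<open>T\<^sub>i\<^sub>j(x)\<close>; the index is the exponent of \<open>w\<close>.
\<close>

definition t_coeff :: "complex \<Rightarrow> nat \<Rightarrow> 'n \<Rightarrow> 'n \<Rightarrow> ('s::theta_sign, 'm::finite, 'n) A" where
  "t_coeff c s i j = (\<Sum>a\<in>UNIV. \<Sum>b\<in>UNIV. mpow (w_matrix c (theta TYPE('s))) s a b \<otimes> (H_x a i * H_d b j))"

definition T_coeff :: "complex \<Rightarrow> nat \<Rightarrow> 'n \<Rightarrow> 'n \<Rightarrow> ('s::theta_sign, 'm::finite, 'n) A" where
  "T_coeff c k i j = (case k of 0 \<Rightarrow> if i = j then 1 else 0 | Suc s \<Rightarrow> t_coeff c s i j)"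

text \<open>
  The part of a product of two \<open>t_coeff\<close> in which no \<open>\<partial>\<close> has been contracted with an \<open>x\<close>.
\<close>

definition quartic :: "('m \<Rightarrow> 'm \<Rightarrow> 'm \<Rightarrow> 'm \<Rightarrow> 'm Ugl) \<Rightarrow> 'n \<Rightarrow> 'n \<Rightarrow> 'n \<Rightarrow> 'n \<Rightarrow> ('s::theta_sign, 'm::finite, 'n) A"
    where
  "quartic F i k j l = (\<Sum>a\<in>UNIV. \<Sum>b\<in>UNIV. \<Sum>c\<in>UNIV. \<Sum>d\<in>UNIV. F a b c d \<otimes> (H_x a i * H_x c k * H_d b j * H_d d l))"

lemma theta_square: "theta TYPE('s::theta_sign) * theta TYPE('s) = 1"
  using theta_cases[where 'a = 's] by auto

lemma sum_swap_pairs: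
  "(\<Sum>a\<in>A. \<Sum>b\<in>B. \<Sum>c\<in>C. \<Sum>d\<in>D. f a b c d) = (\<Sum>c\<in>C. \<Sum>d\<in>D. \<Sum>a\<in>A. \<Sum>b\<in>B. f a b c d)"
proof -
  have "(\<Sum>a\<in>A. \<Sum>b\<in>B. \<Sum>c\<in>C. \<Sum>d\<in>D. f a b c d) = (\<Sum>c\<in>C. \<Sum>a\<in>A. \<Sum>b\<in>B. \<Sum>d\<in>D. f a b c d)"
    by (rule trans[OF sum.cong[OF refl sum.swap] sum.swap])
  also have "\<dots> = (\<Sum>c\<in>C. \<Sum>d\<in>D. \<Sum>a\<in>A. \<Sum>b\<in>B. f a b c d)"
    by (rule sum.cong[OF refl trans[OF sum.cong[OF refl sum.swap] sum.swap]])
  finally show ?thesis .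
qed

lemma sum_swap_outer_inner:
  "(\<Sum>a\<in>A. \<Sum>b\<in>B. \<Sum>c\<in>C. f a b c) = (\<Sum>c\<in>C. \<Sum>b\<in>B. \<Sum>a\<in>A. f a b c)"
proof -
  have "(\<Sum>a\<in>A. \<Sum>b\<in>B. \<Sum>c\<in>C. f a b c) = (\<Sum>b\<in>B. \<Sum>a\<in>A. \<Sum>c\<in>C. f a b c)" by (rule sum.swap)
  also have "\<dots> = (\<Sum>b\<in>B. \<Sum>c\<in>C. \<Sum>a\<in>A. f a b c)" by (intro sum.cong refl sum.swap)
  also have "\<dots> = (\<Sum>c\<in>C. \<Sum>b\<in>B. \<Sum>a\<in>A. f a b c)" by (rule sum.swap)
  finally show ?thesis .
qed

lemma tensor_zero_right [simp]: "u \<otimes> 0 = 0"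
  using tensor_add_right[of u 0 0] by simp

lemma tensor_uminus_left: "(- u) \<otimes> h = - (u \<otimes> h)"
  using tensor_add_left[of "- u" u h] by (simp add: eq_neg_iff_add_eq_0)

lemma tensor_diff_left: "(u - v) \<otimes> h = u \<otimes> h - v \<otimes> h"
  using tensor_add_left[of u "- v" h] by (simp add: tensor_uminus_left)

lemma tensor_sum_left: "sum f I \<otimes> h = (\<Sum>i\<in>I. f i \<otimes> h)"
  by (induction I rule: infinite_finite_induct) (simp_all add: tensor_add_left)

lemma tensor_sum_right: "u \<otimes> sum f I = (\<Sum>i\<in>I. u \<otimes> f i)"
  by (induction I rule: infinite_finite_induct) (simp_all add: tensor_add_right)

lemma tensor_uminus_right: "u \<otimes> (- h) = - (u \<otimes> h)"
  using tensor_add_right[of u "- h" h] by (simp add: eq_neg_iff_add_eq_0)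

lemma tensor_diff_right: "u \<otimes> (x - y) = u \<otimes> x - u \<otimes> y"
  using tensor_add_right[of u "x - y" y] by (simp add: algebra_simps)

lemma quartic_diff: "quartic F i k j l - quartic G i k j l = quartic (\<lambda>a b c d. F a b c d - G a b c d) i k j l"
  by (simp add: quartic_def tensor_diff_left sum_subtractf)

lemma quartic_scale: "z *\<^sub>C quartic F i k j l = quartic (\<lambda>a b c d. z *\<^sub>C F a b c d) i k j l"
  by (simp add: quartic_def tensor_scaleC_left scaleC_sum_right)

lemma quartic_swap_x:
  fixes F :: "'m \<Rightarrow> 'm \<Rightarrow> 'm \<Rightarrow> 'm \<Rightarrow> 'm::finite Ugl"
  shows "(quartic F k i j l :: ('s::theta_sign, 'm, 'n) A) = theta TYPE('s) *\<^sub>C quartic (\<lambda>a b c d. F c b a d)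
      i k j l"
proof -
  have "(quartic F k i j l :: ('s, 'm, 'n) A) =
     (\<Sum>c\<in>UNIV. \<Sum>b\<in>UNIV. \<Sum>a\<in>UNIV. \<Sum>d\<in>UNIV. F c b a d \<otimes> (H_x c k * H_x a i * H_d b j * H_d d l))"
    by (simp add: quartic_def)
  also have "\<dots> = (\<Sum>a\<in>UNIV. \<Sum>b\<in>UNIV. \<Sum>c\<in>UNIV. \<Sum>d\<in>UNIV. F c b a d \<otimes> (H_x c k * H_x a i * H_d b j * H_d d l))"
    by (rule sum_swap_outer_inner)
  also have "\<dots> = (\<Sum>a\<in>UNIV. \<Sum>b\<in>UNIV. \<Sum>c\<in>UNIV. \<Sum>d\<in>UNIV. theta TYPE('s) *\<^sub>C (F c b a d \<otimes> (H_x a i * H_x c k *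
      H_d b j * H_d d l)))"
    by (simp only: H_x_H_x[of _ k _ i] mult_scaleC_left tensor_scaleC_right)
  finally show ?thesis by (simp only: quartic_def scaleC_sum_right)
qed

lemma quartic_swap_pairs:
  fixes F :: "'m \<Rightarrow> 'm \<Rightarrow> 'm \<Rightarrow> 'm \<Rightarrow> 'm::finite Ugl"
  shows "(quartic F k i l j :: ('s::theta_sign, 'm, 'n) A) = quartic (\<lambda>a b c d. F c d a b) i k j l"
proof -
  have *: "H_x c k * H_x a i * H_d d l * H_d b j = (H_x a i * H_x c k * H_d b j * H_d d l :: ('s, 'm, 'n) HU)"
      for a b c d
  proof -
    have "H_x c k * H_x a i * (H_d d l * H_d b j) = (H_x a i * H_x c k * (H_d b j * H_d d l) :: ('s, 'm, 'n) HU)"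
      by (simp add: H_x_H_x[of _ k _ i] H_d_H_d[of _ l _ j] mult_scaleC_left mult_scaleC_right scaleC_scaleC
          theta_square scaleC_one)
    then show ?thesis by (simp add: mult.assoc)
  qed
  have "(quartic F k i l j :: ('s, 'm, 'n) A) =
     (\<Sum>c\<in>UNIV. \<Sum>d\<in>UNIV. \<Sum>a\<in>UNIV. \<Sum>b\<in>UNIV. F c d a b \<otimes> (H_x c k * H_x a i * H_d d l * H_d b j))"
    by (simp add: quartic_def)
  also have "\<dots> = (\<Sum>a\<in>UNIV. \<Sum>b\<in>UNIV. \<Sum>c\<in>UNIV. \<Sum>d\<in>UNIV. F c d a b \<otimes> (H_x c k * H_x a i * H_d d l * H_d b j))"
    by (rule sum_swap_pairs)
  finally show ?thesis unfolding * by (simp add: quartic_def)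
qed

text \<open>
  Moving \<open>\<partial>\<^sub>b\<^sub>j\<close> past \<open>x\<^sub>d\<^sub>k\<close> contracts \<open>b\<close> with \<open>d\<close>, which multiplies the two matrix powers.
\<close>

lemma t_coeff_mult:
  fixes i j k l :: 'n
  shows "(t_coeff c r i j * t_coeff c s k l :: ('s::theta_sign, 'm::finite, 'n) A) =
    (if j = k then t_coeff c (r + s) i l else 0) +
    theta TYPE('s) *\<^sub>C quartic (\<lambda>a b d e. mpow (w_matrix c (theta TYPE('s))) r a b *
        mpow (w_matrix c (theta TYPE('s))) s d e) i k j l"
proof -
  let ?w = "mpow (w_matrix c (theta TYPE('s)) :: 'm \<Rightarrow> 'm \<Rightarrow> 'm Ugl)"
  have H: "H_x a i * H_d b j * (H_x d k * H_d e l) =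
     (if b = d \<and> j = k then H_x a i * H_d e l else 0) +
     theta TYPE('s) *\<^sub>C (H_x a i * H_x d k * H_d b j * H_d e l :: ('s, 'm, 'n) HU)" for a b d e
  proof -
    have "H_x a i * H_d b j * (H_x d k * H_d e l) = H_x a i * (H_d b j * H_x d k) * (H_d e l :: ('s, 'm, 'n) HU)"
      by (simp add: mult.assoc)
    then show ?thesis unfolding H_d_H_x
      by (auto simp: distrib_left distrib_right mult.assoc mult_scaleC_left mult_scaleC_right)
  qed
  let ?K = "\<lambda>a b d e. if d = b then (if j = k then (?w r a d * ?w s d e) \<otimes> (H_x a i * H_d e l) else 0)
      else (0 :: ('s, 'm, 'n) A)"
  have "(t_coeff c r i j * t_coeff c s k l :: ('s, 'm, 'n) A) =
    (\<Sum>a\<in>UNIV. \<Sum>b\<in>UNIV. \<Sum>d\<in>UNIV. \<Sum>e\<in>UNIV. (?w r a b * ?w s d e) \<otimes> (H_x a i * H_d b j * (H_x d k * H_d e l)))"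
    by (simp only: t_coeff_def sum_distrib_left sum_distrib_right tensor_mult)
      (rule sum_swap_pairs)
  also have "\<dots> = (\<Sum>a\<in>UNIV. \<Sum>b\<in>UNIV. \<Sum>d\<in>UNIV. \<Sum>e\<in>UNIV.
      ?K a b d e
      + theta TYPE('s) *\<^sub>C ((?w r a b * ?w s d e) \<otimes> (H_x a i * H_x d k * H_d b j * H_d e l)))"
    unfolding H tensor_add_right tensor_scaleC_right by (intro sum.cong refl) auto
  also have "\<dots> = (\<Sum>a\<in>UNIV. \<Sum>b\<in>UNIV. \<Sum>d\<in>UNIV. \<Sum>e\<in>UNIV.
      ?K a b d e)
      + theta TYPE('s) *\<^sub>C quartic (\<lambda>a b d e. ?w r a b * ?w s d e) i k j l"
    by (simp only: sum.distrib quartic_def scaleC_sum_right)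
  also have "(\<Sum>a\<in>UNIV. \<Sum>b\<in>UNIV. \<Sum>d\<in>UNIV. \<Sum>e\<in>UNIV.
      ?K a b d e) =
      (\<Sum>a\<in>UNIV. \<Sum>b\<in>UNIV. \<Sum>e\<in>UNIV. \<Sum>d\<in>UNIV.
      ?K a b d e)"
    by (intro sum.cong refl sum.swap)
  also have "\<dots> = (\<Sum>a\<in>UNIV. \<Sum>e\<in>UNIV. \<Sum>b\<in>UNIV. if j = k then (?w r a b * ?w s b e) \<otimes> (H_x a i * H_d e l) else 0)"
    by (simp only: sum.delta finite UNIV_I if_True) (intro sum.cong refl sum.swap)
  also have "\<dots> = (if j = k then t_coeff c (r + s) i l else 0)"
    by (simp add: t_coeff_def mpow_add tensor_sum_left)
  finally show ?thesis .
qed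

text \<open>
  When both indices are positive, the contracted terms on the left cancel, since they depend on
  \<open>r + s\<close> only, and likewise on the right; the remaining quartic terms agree by \<open>comm_telescope\<close>, once
  \<open>comm_symmetric\<close> has been used to reorder the coefficients. When one of the indices is zero, the
  contracted terms are all there is.
\<close>

lemma yangian_relation_T_coeff:
  fixes i j k l :: 'n and c :: complex
  defines "T \<equiv> T_coeff c :: nat \<Rightarrow> 'n \<Rightarrow> 'n \<Rightarrow> ('s::theta_sign, 'm::finite, 'n) A"
  shows "(T (Suc r) i j * T s k l - T s k l * T (Suc r) i j)
        - (T r i j * T (Suc s) k l - T (Suc s) k l * T r i j)
        = T r k j * T s i l - T s k j * T r i l"
proof -
  let ?t = "theta TYPE('s)"
  interpret gl_type_matrix "w_matrix c ?t :: 'm \<Rightarrow> 'm \<Rightarrow> 'm Ugl" ?t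
    by (rule gl_type_matrix_w_matrix) (rule theta_square)
  let ?w = "mpow (w_matrix c (theta TYPE('s)) :: 'm \<Rightarrow> 'm \<Rightarrow> 'm Ugl)"
  let ?tc = "t_coeff c :: nat \<Rightarrow> 'n \<Rightarrow> 'n \<Rightarrow> ('s, 'm, 'n) A"
  have bracket: "?tc r i j * ?tc s k l - ?tc s k l * ?tc r i j =
    (if j = k then ?tc (r + s) i l else 0) - (if l = i then ?tc (r + s) k j else 0)
    + ?t *\<^sub>C quartic (comm r s) i k j l" for r s
  proof -
    have "quartic (\<lambda>a b d e. ?w s a b * ?w r d e) k i l j =
        (quartic (\<lambda>a b d e. ?w s d e * ?w r a b) i k j l :: ('s, 'm, 'n) A)"
      by (rule quartic_swap_pairs)
    moreover have "quartic (comm r s) i k j l =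
       quartic (\<lambda>a b d e. ?w r a b * ?w s d e) i k j l - (quartic (\<lambda>a b d e. ?w s d e * ?w r a b) i k j l ::
           ('s, 'm, 'n) A)"
      unfolding quartic_diff comm_def ..
    ultimately show ?thesis
      unfolding t_coeff_mult by (simp add: scaleC_diff_right add.commute[of s r])
  qed
  have product: "?tc r k j * ?tc s i l = (if j = i then ?tc (r + s) k l else 0) +
      quartic (\<lambda>a b d e. ?w r d b * ?w s a e) i k j l" for r s
    unfolding t_coeff_mult quartic_swap_x[of _ k i] by (simp add: scaleC_scaleC theta_square scaleC_one)
  \<comment> \<open>The case of two positive indices.\<close>
  have bb: "(?tc (Suc r) i j * ?tc s k l - ?tc s k l * ?tc (Suc r) i j)
        - (?tc r i j * ?tc (Suc s) k l - ?tc (Suc s) k l * ?tc r i j)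
        = ?tc r k j * ?tc s i l - ?tc s k j * ?tc r i l" for r s
  proof -
    have "(?tc (Suc r) i j * ?tc s k l - ?tc s k l * ?tc (Suc r) i j)
        - (?tc r i j * ?tc (Suc s) k l - ?tc (Suc s) k l * ?tc r i j) =
        ?t *\<^sub>C (quartic (comm (Suc r) s) i k j l - quartic (comm r (Suc s)) i k j l)"
      unfolding bracket by (simp add: scaleC_diff_right)
    also have "\<dots> = quartic (\<lambda>a b d e. ?w s a e * ?w r d b - ?w r a e * ?w s d b) i k j l"
      unfolding quartic_diff comm_telescope quartic_scale
      by (simp add: scaleC_minus_right[symmetric] scaleC_scaleC theta_square scaleC_one)
    also have "(\<lambda>a b d e. ?w s a e * ?w r d b - ?w r a e * ?w s d b) =
      (\<lambda>a b d e. ?w r d b * ?w s a e - ?w s d b * ?w r a e)"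
    proof (intro ext)
      fix a b d e
      show "?w s a e * ?w r d b - ?w r a e * ?w s d b = ?w r d b * ?w s a e - ?w s d b * ?w r a e"
        using comm_symmetric[of r s d b a e] by (simp add: comm_def algebra_simps)
    qed
    also have "quartic (\<lambda>a b d e. ?w r d b * ?w s a e - ?w s d b * ?w r a e) i k j l =
      ?tc r k j * ?tc s i l - ?tc s k j * ?tc r i l"
      unfolding product by (simp add: quartic_diff[symmetric] add.commute[of s r])
    finally show ?thesis .
  qed
  have comm0: "comm r 0 = (\<lambda>a b d e. 0)" "comm 0 r = (\<lambda>a b d e. 0)" for r
    by (simp_all add: fun_eq_iff comm_0 comm_symmetric[of r 0])
  have quartic0: "quartic (\<lambda>a b d e. 0) i k j l = (0 :: ('s, 'm, 'n) A)"
    by (simp add: quartic_def)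
  show ?thesis
  proof (cases r)
    case 0
    then show ?thesis
    proof (cases s)
      case 0
      then show ?thesis using \<open>r = 0\<close> by (auto simp: T_def T_coeff_def mult_if_delta)
    next
      case (Suc s')
      then show ?thesis using \<open>r = 0\<close> bracket[of 0 s'] by (auto simp: T_def T_coeff_def mult_if_delta comm0
          quartic0)
    qed
  next
    case (Suc r')
    then show ?thesis
    proof (cases s)
      case 0
      then show ?thesis using \<open>r = Suc r'\<close> bracket[of r' 0] by (auto simp: T_def T_coeff_def mult_if_delta comm0
          quartic0)
    next
      case (Suc s')
      then show ?thesis using \<open>r = Suc r'\<close> bb[of r' s'] by (simp add: T_def T_coeff_def)
    qed
  qed
qed

lemma yangian_homomorphism:
  shows "\<exists>\<phi> :: 'n Yangian \<Rightarrow> ('s::theta_sign, 'm::finite, 'n) A. alg_hom \<phi> \<and> (\<forall>s i j. \<phi> (Y_T s i j) =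
      T_coeff c s i j)"
proof -
  let ?f = "\<lambda>u :: 'n Y_gen. (case u of T_Gen s i j \<Rightarrow> t_coeff c s i j) :: ('s, 'm, 'n) A"
  have ev: "free_eval ?f (free_T s i j) = T_coeff c s i j" for s i j
    by (cases s) (auto simp: free_T_def T_coeff_def)
  have rels: "free_eval ?f r = 0" if "r \<in> presentation_relations" for r
    using that unfolding presentation_relations_Y_gen_def
    by (auto simp: ev yangian_relation_T_coeff simp del: right_minus_eq)
  have "present_lift ?f (Y_T s i j) = T_coeff c s i j" for s i j
    using alg_homD(4,5)[OF present_lift_alg_hom[of ?f, OF rels]]
    by (cases s) (auto simp: Y_T_def T_coeff_def present_lift_gen[of ?f, OF rels])
  then show ?thesis using present_lift_alg_hom[of ?f, OF rels] by blast
qed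

lemma T_series_nth: "fls_nth (T_series i j) k = (if k < 0 then 0 else Y_T (nat k) i j)"
  by (simp add: T_series_def)

lemma image_series_nth:
  fixes i j :: 'n
  shows "fls_nth (image_series i j :: ('s::theta_sign, 'm::finite, 'n) A fls) k =
    (if k < 0 then 0 else T_coeff (theta TYPE('s) * of_nat CARD('m) / 2) (nat k) i j)"
proof -
  have "k > 0 \<Longrightarrow> nat k = Suc (nat (k - 1))" by simp
  then show ?thesis
    by (auto simp: image_series_def Let_def matrix_inv_shifted_E_matrix fls_nth_sum resolvent_nth
        T_coeff_def t_coeff_def)
qed

section \<open>The filtration by length of words\<close>

text \<open>
  The first argument of \<open>L_gl\<close> is the index that transforms by \<open>g\<close> and the second one the index that
  transforms by the inverse; this is why \<open>letter_val\<close> exchanges them.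
\<close>

datatype ('m, 'n) letter = L_gl 'm 'm | L_x 'm 'n | L_d 'm 'n

primrec letter_val :: "complex \<Rightarrow> ('m, 'n) letter \<Rightarrow> ('s::theta_sign, 'm::finite, 'n) A" where
  "letter_val c (L_gl a b) = w_matrix c (theta TYPE('s)) b a \<otimes> 1"
| "letter_val c (L_x a i) = 1 \<otimes> H_x a i"
| "letter_val c (L_d b j) = 1 \<otimes> H_d b j"

primrec odd_letter :: "('m, 'n) letter \<Rightarrow> bool" where
  "odd_letter (L_gl a b) = False"
| "odd_letter (L_x a i) = True"
| "odd_letter (L_d b j) = True"

primrec odd_word :: "('m, 'n) letter list \<Rightarrow> bool" where
  "odd_word [] = False"
| "odd_word (l # u) = (odd_letter l \<noteq> odd_word u)"

definition word_val :: "complex \<Rightarrow> ('m, 'n) letter list \<Rightarrow> ('s::theta_sign, 'm::finite, 'n) A" where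
  "word_val c u = prod_list (map (letter_val c) u)"

lemma word_val_simps [simp]:
  "word_val c [] = 1" "word_val c (l # u) = letter_val c l * word_val c u" "word_val c (u @ v) = word_val c u *
      word_val c v"
  by (simp_all add: word_val_def)

lemma odd_word_append [simp]: "odd_word (u @ v) = (odd_word u \<noteq> odd_word v)"
  by (induction u) auto

text \<open>
  The bound on the length is strict: the piece with index 0 is zero, and the terms of lower order of
  a product of \<open>d\<close> letters lie in the piece with index \<open>d\<close>.
\<close>

definition filtered :: "complex \<Rightarrow> nat \<Rightarrow> ('s::theta_sign, 'm::finite, 'n) A set" where
  "filtered c d = calg.span {word_val c u | u. length u < d}"

definition parity_filtered :: "complex \<Rightarrow> nat \<Rightarrow> bool \<Rightarrow> ('s::theta_sign, 'm::finite, 'n) A set" where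
  "parity_filtered c d p = calg.span {word_val c u | u. length u < d \<and> odd_word u = p}"

lemma word_val_filtered: "length u < d \<Longrightarrow> word_val c u \<in> filtered c d"
  unfolding filtered_def by (rule calg.span_base) blast

lemma word_val_parity_filtered: "length u < d \<Longrightarrow> word_val c u \<in> parity_filtered c d (odd_word u)"
  unfolding parity_filtered_def by (rule calg.span_base) blast

lemma filtered_closed:
  "0 \<in> filtered c d" "x \<in> filtered c d \<Longrightarrow> y \<in> filtered c d \<Longrightarrow> x + y \<in> filtered c d"
  "x \<in> filtered c d \<Longrightarrow> k *\<^sub>C x \<in> filtered c d" "x \<in> filtered c d \<Longrightarrow> y \<in> filtered c d \<Longrightarrow> x - y \<in> filtered c d"
  "(\<And>i. i \<in> I \<Longrightarrow> f i \<in> filtered c d) \<Longrightarrow> sum f I \<in> filtered c d"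
  unfolding filtered_def
  by (fact calg.span_zero calg.span_add calg.span_scale calg.span_diff calg.span_sum)+

lemma parity_filtered_closed:
  "0 \<in> parity_filtered c d p" "x \<in> parity_filtered c d p \<Longrightarrow> y \<in> parity_filtered c d p \<Longrightarrow> x +
      y \<in> parity_filtered c d p"
  "x \<in> parity_filtered c d p \<Longrightarrow> k *\<^sub>C x \<in> parity_filtered c d p"
  "(\<And>i. i \<in> I \<Longrightarrow> f i \<in> parity_filtered c d p) \<Longrightarrow> sum f I \<in> parity_filtered c d p"
  unfolding parity_filtered_def
  by (fact calg.span_zero calg.span_add calg.span_scale calg.span_sum)+

lemma filtered_mono: "d \<le> e \<Longrightarrow> filtered c d \<subseteq> filtered c e"
  unfolding filtered_def by (rule calg.span_mono) auto

lemma parity_filtered_subset: "parity_filtered c d p \<subseteq> filtered c d"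
  unfolding filtered_def parity_filtered_def by (rule calg.span_mono) auto

lemma span_bilinear:
  fixes A :: "'a::complex_algebra set" and B :: "'b::complex_algebra set" and f :: "'a \<Rightarrow> 'b \<Rightarrow> 'c::complex_algebra"
  assumes x: "x \<in> calg.span A" and y: "y \<in> calg.span B"
    and base: "\<And>a b. a \<in> A \<Longrightarrow> b \<in> B \<Longrightarrow> f a b \<in> S" and S: "calg.subspace S"
    and bilinear: "\<And>a a' b. f (a + a') b = f a b + f a' b" "\<And>k a b. f (k *\<^sub>C a) b = k *\<^sub>C f a b" 
       "\<And>a b b'. f a (b + b') = f a b + f a b'" "\<And>k a b. f a (k *\<^sub>C b) = k *\<^sub>C f a b"
  shows "f x y \<in> S"
proof -
  have zero: "f 0 b = 0" "f a 0 = 0" for a b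
    using bilinear(2)[of 0 0 b] bilinear(4)[of a 0 0] by simp_all
  have 1: "f a y \<in> S" if "a \<in> A" for a
  proof (rule calg.span_induct[OF y])
    show "calg.subspace {y. f a y \<in> S}"
      using S by (simp add: calg.subspace_def bilinear zero)
  qed (use base that in blast)
  show ?thesis
  proof (rule calg.span_induct[OF x])
    show "calg.subspace {x. f x y \<in> S}"
      using S by (simp add: calg.subspace_def bilinear zero)
  qed (use 1 in blast)
qed

lemma filtered_mult_left:
  fixes x y :: "('s::theta_sign, 'm::finite, 'n) A"
  assumes "x \<in> filtered c (Suc a)" "y \<in> filtered c b"
  shows "x * y \<in> filtered c (a + b)"
  using assms(1,2)[unfolded filtered_def]
proof (rule span_bilinear[where f = "(*)"])
  fix x y :: "('s, 'm, 'n) A" assume "x \<in> {word_val c u | u. length u < Suc a}" "y \<in> {word_val c u | u.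
      length u < b}"
  then obtain u v where "x = word_val c u" "y = word_val c v" "length u < Suc a" "length v < b" by blast
  then show "x * y \<in> filtered c (a + b)" using word_val_filtered[of "u @ v" "a + b" c] by simp
qed (simp_all add: filtered_def calg.subspace_span distrib_left distrib_right mult_scaleC_left mult_scaleC_right)

lemma filtered_mult_right:
  fixes x y :: "('s::theta_sign, 'm::finite, 'n) A"
  assumes "x \<in> filtered c a" "y \<in> filtered c (Suc b)"
  shows "x * y \<in> filtered c (a + b)"
  using assms(1,2)[unfolded filtered_def]
proof (rule span_bilinear[where f = "(*)"])
  fix x y :: "('s, 'm, 'n) A" assume "x \<in> {word_val c u | u. length u < a}" "y \<in> {word_val c u | u.
      length u < Suc b}"
  then obtain u v where "x = word_val c u" "y = word_val c v" "length u < a" "length v < Suc b" by blast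
  then show "x * y \<in> filtered c (a + b)" using word_val_filtered[of "u @ v" "a + b" c] by simp
qed (simp_all add: filtered_def calg.subspace_span distrib_left distrib_right mult_scaleC_left mult_scaleC_right)

lemma parity_filtered_mult:
  fixes x y :: "('s::theta_sign, 'm::finite, 'n) A"
  assumes "x \<in> parity_filtered c (Suc a) p" "y \<in> parity_filtered c (Suc b) q"
  shows "x * y \<in> parity_filtered c (Suc (a + b)) (p \<noteq> q)"
  using assms(1,2)[unfolded parity_filtered_def]
proof (rule span_bilinear[where f = "(*)"])
  fix x y :: "('s, 'm, 'n) A" assume "x \<in> {word_val c u | u. length u < Suc a \<and> odd_word u = p}"
     "y \<in> {word_val c u | u. length u < Suc b \<and> odd_word u = q}"
  then obtain u v where "x = word_val c u" "y = word_val c v" "length u < Suc a" "length v < Suc b"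
    "odd_word u = p" "odd_word v = q" by blast
  then show "x * y \<in> parity_filtered c (Suc (a + b)) (p \<noteq> q)"
    using word_val_parity_filtered[of "u @ v" "Suc (a + b)" c] by simp
qed (simp_all add: parity_filtered_def calg.subspace_span distrib_left distrib_right mult_scaleC_left
    mult_scaleC_right)

text \<open>
  For \<open>\<theta> = -1\<close> the Koszul sign of exchanging elements of the given parities; for \<open>\<theta> = 1\<close> it is 1.
\<close>

definition koszul_sign :: "'s::theta_sign itself \<Rightarrow> bool \<Rightarrow> bool \<Rightarrow> complex" where
  "koszul_sign s p q = (if p \<and> q then theta TYPE('s) else 1)"

text \<open>
  In every case the defining relations express the (super)commutator of two letters by at most one
  letter.
\<close>

lemma letter_commutation:
  "letter_val c l * letter_val c k - koszul_sign TYPE('s) (odd_letter l) (odd_letter k) *\<^sub>C (letter_val c k *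
      letter_val c l)
    \<in> (filtered c 2 :: ('s::theta_sign, 'm::finite, 'n) A set)"
proof -
  let ?t = "theta TYPE('s)"
  interpret gl_type_matrix "w_matrix c ?t :: 'm \<Rightarrow> 'm \<Rightarrow> 'm Ugl" ?t
    by (rule gl_type_matrix_w_matrix) (rule theta_square)
  have one: "(1 :: ('s, 'm, 'n) A) \<in> filtered c 2" using word_val_filtered[of "[]" 2 c] by simp
  have gen: "w_matrix c ?t a b \<otimes> 1 \<in> (filtered c 2 :: ('s, 'm, 'n) A set)" for a b
    using word_val_filtered[of "[L_gl b a]" 2 c] by simp
  have zero: "x = y \<Longrightarrow> x - y \<in> filtered c 2" for x y :: "('s, 'm, 'n) A" by (simp add: filtered_closed)
  show ?thesis
  proof (cases l; cases k)
    fix a b e d assume "l = L_gl a b" "k = L_gl e d"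
    then have "letter_val c l * letter_val c k - koszul_sign TYPE('s) (odd_letter l) (odd_letter k)
        *\<^sub>C (letter_val c k * letter_val c l) =
      (- (?t *\<^sub>C ((if b = e then w_matrix c ?t d a else 0) - (if a = d then w_matrix c ?t b e else 0)))) \<otimes> (1 ::
          ('s, 'm, 'n) HU)"
      by (simp only: bracket[symmetric]) (simp add: koszul_sign_def scaleC_one tensor_mult tensor_diff_left)
    also have "\<dots> = (- ?t) *\<^sub>C ((if b = e then w_matrix c ?t d a \<otimes> 1 else 0) - (if a =
        d then w_matrix c ?t b e \<otimes> (1 :: ('s, 'm, 'n) HU) else 0))"
      by (auto simp: tensor_uminus_left scaleC_minus_left tensor_scaleC_left tensor_diff_left)
    also have "\<dots> \<in> filtered c 2" by (rule filtered_closed(3), rule filtered_closed(4))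
        (auto intro: filtered_closed gen)
    finally show ?thesis .
  next
    fix a b j i assume "l = L_x a i" "k = L_d b j"
    then have "letter_val c l * letter_val c k - koszul_sign TYPE('s) (odd_letter l) (odd_letter k)
        *\<^sub>C (letter_val c k * letter_val c l) =
      1 \<otimes> (H_x a i * H_d b j - ?t *\<^sub>C (H_d b j * H_x a i :: ('s, 'm, 'n) HU))"
      by (simp add: koszul_sign_def tensor_mult tensor_scaleC_right tensor_diff_right)
    also have "H_x a i * H_d b j - ?t *\<^sub>C (H_d b j * H_x a i :: ('s, 'm, 'n) HU) = (if a = b \<and> i = j then (- ?t)
        *\<^sub>C 1 else 0)"
      unfolding H_d_H_x by (auto simp: scaleC_add_right scaleC_scaleC theta_square scaleC_one scaleC_minus_left)
    also have "1 \<otimes> (if a = b \<and> i = j then (- ?t) *\<^sub>C 1 else (0 :: ('s, 'm, 'n) HU)) = (if a = b \<and> i = j then (-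
        ?t) *\<^sub>C 1 else 0)"
      by (auto simp: tensor_scaleC_right tensor_uminus_right tensor_one)
    also have "\<dots> \<in> filtered c 2"
    proof (cases "a = b \<and> i = j")
      case True
      show ?thesis unfolding if_P[OF True] by (rule filtered_closed(3)[OF one])
    next
      case False
      show ?thesis unfolding if_not_P[OF False] by (rule filtered_closed(1))
    qed
    finally show ?thesis .
  next
    fix a b j i assume "l = L_d b j" "k = L_x a i"
    then have "letter_val c l * letter_val c k - koszul_sign TYPE('s) (odd_letter l) (odd_letter k)
        *\<^sub>C (letter_val c k * letter_val c l) =
      1 \<otimes> (if a = b \<and> i = j then 1 else (0 :: ('s, 'm, 'n) HU))"
      by (simp add: koszul_sign_def tensor_mult H_d_H_x[of b j] tensor_scaleC_right tensor_add_right)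
    also have "\<dots> = (if a = b \<and> i = j then 1 else 0)"
      by (auto simp: tensor_one)
    also have "\<dots> \<in> filtered c 2" by (auto intro!: filtered_closed one)
    finally show ?thesis .
  next
    fix a b i j assume "l = L_x b j" "k = L_x a i"
    then show ?thesis by (intro zero) (simp add: koszul_sign_def tensor_mult H_x_H_x[of b j] tensor_scaleC_right)
  next
    fix a b i j assume "l = L_d b j" "k = L_d a i"
    then show ?thesis by (intro zero) (simp add: koszul_sign_def tensor_mult H_d_H_d[of b j] tensor_scaleC_right)
  qed (intro zero; simp add: koszul_sign_def tensor_mult scaleC_one)+
qed

lemma letter_word_commutation:
  "letter_val c l * word_val c v - koszul_sign TYPE('s) (odd_letter l) (odd_word v) *\<^sub>C (word_val c v *
      letter_val c l)
    \<in> (filtered c (Suc (length v)) :: ('s::theta_sign, 'm::finite, 'n) A set)"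
proof (induction v)
  case Nil
  show ?case by (simp add: koszul_sign_def scaleC_one filtered_closed)
next
  case (Cons k v)
  let ?L = "letter_val c l :: ('s, 'm, 'n) A" and ?K = "letter_val c k :: ('s, 'm, 'n) A"
    and ?V = "word_val c v :: ('s, 'm, 'n) A"
  let ?e = "koszul_sign TYPE('s) (odd_letter l) (odd_letter k)" and ?f = "koszul_sign TYPE('s) (odd_letter l)
      (odd_word v)"
  have e: "koszul_sign TYPE('s) (odd_letter l) (odd_word (k # v)) = ?e * ?f"
    by (auto simp: koszul_sign_def theta_square)
  have "?L * word_val c (k # v) - koszul_sign TYPE('s) (odd_letter l) (odd_word (k # v)) *\<^sub>C (word_val c (k # v)
      * ?L) =
    (?L * ?K - ?e *\<^sub>C (?K * ?L)) * ?V + ?e *\<^sub>C (?K * (?L * ?V - ?f *\<^sub>C (?V * ?L)))"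
    unfolding e by (simp add: algebra_simps mult_scaleC_left mult_scaleC_right scaleC_diff_right scaleC_scaleC)
  also have "\<dots> \<in> filtered c (Suc (length (k # v)))"
  proof (rule filtered_closed(2))
    show "(?L * ?K - ?e *\<^sub>C (?K * ?L)) * ?V \<in> filtered c (Suc (length (k # v)))"
      using filtered_mult_right[OF letter_commutation word_val_filtered[of v "Suc (length v)"], of c l k] by simp
    show "?e *\<^sub>C (?K * (?L * ?V - ?f *\<^sub>C (?V * ?L))) \<in> filtered c (Suc (length (k # v)))"
      using filtered_mult_left[OF word_val_filtered[of "[k]" "Suc 1"] Cons.IH] by (simp add: filtered_closed(3))
  qed
  finally show ?case .
qed

lemma word_commutation:
  "word_val c u * word_val c v - koszul_sign TYPE('s) (odd_word u) (odd_word v) *\<^sub>C (word_val c v * word_val c u)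
    \<in> (filtered c (length u + length v) :: ('s::theta_sign, 'm::finite, 'n) A set)"
proof (induction u)
  case Nil
  show ?case by (simp add: koszul_sign_def scaleC_one filtered_closed)
next
  case (Cons l u)
  let ?L = "letter_val c l :: ('s, 'm, 'n) A" and ?U = "word_val c u :: ('s, 'm, 'n) A"
    and ?V = "word_val c v :: ('s, 'm, 'n) A"
  let ?e = "koszul_sign TYPE('s) (odd_letter l) (odd_word v)" and ?f = "koszul_sign TYPE('s) (odd_word u)
      (odd_word v)"
  have e: "koszul_sign TYPE('s) (odd_word (l # u)) (odd_word v) = ?e * ?f"
    by (auto simp: koszul_sign_def theta_square)
  have "word_val c (l # u) * ?V - koszul_sign TYPE('s) (odd_word (l # u)) (odd_word v) *\<^sub>C (?V *
      word_val c (l # u)) =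
    ?L * (?U * ?V - ?f *\<^sub>C (?V * ?U)) + ?f *\<^sub>C ((?L * ?V - ?e *\<^sub>C (?V * ?L)) * ?U)"
    unfolding e by (simp add: algebra_simps mult_scaleC_left mult_scaleC_right scaleC_diff_right scaleC_scaleC)
  also have "\<dots> \<in> filtered c (length (l # u) + length v)"
  proof (rule filtered_closed(2))
    show "?L * (?U * ?V - ?f *\<^sub>C (?V * ?U)) \<in> filtered c (length (l # u) + length v)"
      using filtered_mult_left[OF word_val_filtered[of "[l]" "Suc 1"] Cons.IH] by simp
    show "?f *\<^sub>C ((?L * ?V - ?e *\<^sub>C (?V * ?L)) * ?U) \<in> filtered c (length (l # u) + length v)"
      using filtered_mult_right[OF letter_word_commutation[of c l v, where 's =
          's] word_val_filtered[of u "Suc (length u)"]]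
      by (simp add: filtered_closed(3) add.commute)
  qed
  finally show ?case .
qed

text \<open>
  The associated graded algebra of the filtration is (super)commutative.
\<close>

lemma parity_filtered_commutation:
  assumes "x \<in> (parity_filtered c (Suc a) p :: ('s::theta_sign, 'm::finite, 'n) A set)"
      "y \<in> parity_filtered c (Suc b) q"
  shows "x * y - koszul_sign TYPE('s) p q *\<^sub>C (y * x) \<in> filtered c (a + b)"
  using assms(1,2)[unfolded parity_filtered_def]
proof (rule span_bilinear[where f = "\<lambda>x y. x * y - koszul_sign TYPE('s) p q *\<^sub>C (y * x)"])
  fix x y :: "('s, 'm, 'n) A" assume "x \<in> {word_val c u | u. length u < Suc a \<and> odd_word u = p}"
     "y \<in> {word_val c u | u. length u < Suc b \<and> odd_word u = q}"
  then obtain u v where "x = word_val c u" "y = word_val c v" "length u + length v \<le> a + b"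
    "odd_word u = p" "odd_word v = q" by fastforce
  then show "x * y - koszul_sign TYPE('s) p q *\<^sub>C (y * x) \<in> filtered c (a + b)"
    using word_commutation[of c u v, where 's = 's] filtered_mono[of "length u + length v" "a + b" c] by blast
qed (simp_all add: filtered_def calg.subspace_span distrib_left distrib_right mult_scaleC_left mult_scaleC_right
    scaleC_add_right scaleC_diff_right scaleC_scaleC mult.commute)

lemma mpow_parity_filtered: "mpow (w_matrix c (theta TYPE('s))) s a b \<otimes> 1 \<in> (parity_filtered c (Suc s) False ::
    ('s::theta_sign, 'm::finite, 'n) A set)"
proof (induction s arbitrary: a)
  case 0
  have "(1 :: ('s, 'm, 'n) A) \<in> parity_filtered c (Suc 0) False" using word_val_parity_filtered[of "[]" "Suc 0"
      c] by simp
  then show ?case by (auto simp: tensor_one parity_filtered_closed)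
next
  case (Suc s)
  have gen: "w_matrix c (theta TYPE('s)) a b \<otimes> 1 \<in> (parity_filtered c (Suc 1) False :: ('s, 'm, 'n) A set)"
      for a b
    using word_val_parity_filtered[of "[L_gl b a]" "Suc 1" c] by simp
  have "mpow (w_matrix c (theta TYPE('s))) (Suc s) a b \<otimes> 1 =
    (\<Sum>f\<in>UNIV. (w_matrix c (theta TYPE('s)) a f \<otimes> 1) * (mpow (w_matrix c (theta TYPE('s))) s f b \<otimes> (1 :: ('s, 'm,
        'n) HU)))"
    by (simp add: tensor_mult tensor_sum_left)
  then show ?case using parity_filtered_mult[OF gen Suc.IH] by (auto intro!: parity_filtered_closed)
qed

section \<open>Complete contractions\<close>

text \<open>
  A factor of a contraction. Natural numbers are labels of indices that are summed over; \<open>Gl_Slot s \<alpha> \<beta>\<close>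
  is an entry of \<open>w\<^bsup>s\<^esup>\<close> with upper label \<open>\<alpha>\<close> and lower label \<open>\<beta>\<close>, and \<open>X_Slot s \<alpha> i\<close> is \<open>x\<close> multiplied
  by \<open>w\<^bsup>s\<^esup>\<close> in its \<open>GL\<^sub>m\<close>-index. Powers are allowed so that a
  matrix slot can be absorbed by the slot that carries its lower label as an upper one.
\<close>

datatype 'n slot = Gl_Slot nat nat nat | X_Slot nat nat 'n | D_Slot nat 'n

primrec slot_val :: "complex \<Rightarrow> (nat \<Rightarrow> 'm) \<Rightarrow> 'n slot \<Rightarrow> ('s::theta_sign, 'm::finite, 'n) A" where
  "slot_val c f (Gl_Slot s \<alpha> \<beta>) = mpow (w_matrix c (theta TYPE('s))) s (f \<beta>) (f \<alpha>) \<otimes> 1"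
| "slot_val c f (X_Slot s \<alpha> i) = (\<Sum>a\<in>UNIV. mpow (w_matrix c (theta TYPE('s))) s a (f \<alpha>) \<otimes> H_x a i)"
| "slot_val c f (D_Slot \<beta> j) = 1 \<otimes> H_d (f \<beta>) j"

primrec slot_deg :: "'n slot \<Rightarrow> nat" where
  "slot_deg (Gl_Slot s \<alpha> \<beta>) = s"
| "slot_deg (X_Slot s \<alpha> i) = Suc s"
| "slot_deg (D_Slot \<beta> j) = 1"

primrec slot_odd :: "'n slot \<Rightarrow> bool" where
  "slot_odd (Gl_Slot s \<alpha> \<beta>) = False"
| "slot_odd (X_Slot s \<alpha> i) = True"
| "slot_odd (D_Slot \<beta> j) = True"

primrec uppers :: "'n slot \<Rightarrow> nat multiset" where
  "uppers (Gl_Slot s \<alpha> \<beta>) = {#\<alpha>#}"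
| "uppers (X_Slot s \<alpha> i) = {#\<alpha>#}"
| "uppers (D_Slot \<beta> j) = {#}"

primrec lowers :: "'n slot \<Rightarrow> nat multiset" where
  "lowers (Gl_Slot s \<alpha> \<beta>) = {#\<beta>#}"
| "lowers (X_Slot s \<alpha> i) = {#}"
| "lowers (D_Slot \<beta> j) = {#\<beta>#}"

definition slots_val :: "complex \<Rightarrow> 'n slot list \<Rightarrow> (nat \<Rightarrow> 'm) \<Rightarrow> ('s::theta_sign, 'm::finite, 'n) A" where
  "slots_val c ws f = prod_list (map (slot_val c f) ws)"

definition slots_deg :: "'n slot list \<Rightarrow> nat" where
  "slots_deg ws = sum_list (map slot_deg ws)"

definition contract :: "complex \<Rightarrow> nat set \<Rightarrow> 'n slot list \<Rightarrow> ('s::theta_sign, 'm::finite, 'n) A" where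
  "contract c L ws = (\<Sum>f\<in>L \<rightarrow>\<^sub>E UNIV. slots_val c ws f)"

lemma slots_val_simps [simp]:
  "slots_val c [] f = 1" "slots_val c (w # ws) f = slot_val c f w * slots_val c ws f"
  "slots_val c (us @ ws) f = slots_val c us f * slots_val c ws f"
  by (simp_all add: slots_val_def)

lemma slots_deg_simps [simp]:
  "slots_deg [] = 0" "slots_deg (w # ws) = slot_deg w + slots_deg ws" "slots_deg (us @ ws) = slots_deg us +
      slots_deg ws"
  by (simp_all add: slots_deg_def)

lemma slot_val_parity_filtered:
  "slot_val c f w \<in> (parity_filtered c (Suc (slot_deg w)) (slot_odd w) :: ('s::theta_sign, 'm::finite, 'n) A set)"
proof (cases w)
  case (Gl_Slot s \<alpha> \<beta>)
  then show ?thesis using mpow_parity_filtered by simp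
next
  case (X_Slot s \<alpha> i)
  have x: "1 \<otimes> H_x a i \<in> (parity_filtered c (Suc 1) True :: ('s, 'm, 'n) A set)" for a
    using word_val_parity_filtered[of "[L_x a i]" "Suc 1" c] by simp
  have "mpow (w_matrix c (theta TYPE('s))) s a (f \<alpha>) \<otimes> H_x a i \<in> (parity_filtered c (Suc (Suc s)) True :: ('s,
      'm, 'n) A set)" for a
  proof -
    have "(mpow (w_matrix c (theta TYPE('s))) s a (f \<alpha>) \<otimes> 1) * (1 \<otimes> H_x a i) \<in> (parity_filtered c (Suc (s + 1))
        (False \<noteq> True) :: ('s, 'm, 'n) A set)"
      by (rule parity_filtered_mult[OF mpow_parity_filtered x])
    then show ?thesis by (simp add: tensor_mult)
  qed
  then show ?thesis using X_Slot by (auto intro!: parity_filtered_closed)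
next
  case (D_Slot \<beta> j)
  then show ?thesis using word_val_parity_filtered[of "[L_d (f \<beta>) j]" "Suc 1" c] by simp
qed

primrec slots_odd :: "'n slot list \<Rightarrow> bool" where
  "slots_odd [] = False"
| "slots_odd (w # ws) = (slot_odd w \<noteq> slots_odd ws)"

lemma slots_val_parity_filtered: "slots_val c ws f \<in> parity_filtered c (Suc (slots_deg ws)) (slots_odd ws)"
proof (induction ws)
  case Nil
  show ?case using word_val_parity_filtered[of "[]" "Suc 0" c] by simp
next
  case (Cons w ws)
  then show ?case using parity_filtered_mult[OF slot_val_parity_filtered Cons] by simp
qed

lemma slots_val_filtered:
  "slots_val c ws f \<in> (filtered c (Suc (slots_deg ws)) :: ('s::theta_sign, 'm::finite, 'n) A set)"
  using slots_val_parity_filtered parity_filtered_subset by blast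

text \<open>
  The sign depends only on the parities of the slots and not on the values of the labels; hence it
  can be pulled out of the sum.
\<close>

lemma move_to_front:
  "contract c L (us @ [w] @ ws) - koszul_sign TYPE('s) (slots_odd us) (slot_odd w) *\<^sub>C contract c L (w # us @ ws)
    \<in> (filtered c (slots_deg (us @ [w] @ ws)) :: ('s::theta_sign, 'm::finite, 'n) A set)"
proof -
  let ?e = "koszul_sign TYPE('s) (slots_odd us) (slot_odd w)"
  have "slots_val c (us @ [w] @ ws) f - ?e *\<^sub>C slots_val c (w # us @ ws) f
    \<in> (filtered c (slots_deg us + slot_deg w + slots_deg ws) :: ('s, 'm, 'n) A set)" for f
  proof -
    have "slots_val c (us @ [w] @ ws) f - ?e *\<^sub>C slots_val c (w # us @ ws) f =
      (slots_val c us f * slot_val c f w - ?e *\<^sub>C (slot_val c f w * slots_val c us f)) * (slots_val c ws f ::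
          ('s, 'm, 'n) A)"
      by (simp add: left_diff_distrib mult_scaleC_left mult.assoc)
    then show ?thesis
      using filtered_mult_right[OF parity_filtered_commutation[OF slots_val_parity_filtered
          slot_val_parity_filtered] slots_val_filtered] by simp
  qed
  then have "(\<Sum>f\<in>L \<rightarrow>\<^sub>E UNIV. slots_val c (us @ [w] @ ws) f - ?e *\<^sub>C slots_val c (w # us @ ws) f) 
    \<in> (filtered c (slots_deg us + slot_deg w + slots_deg ws) :: ('s, 'm, 'n) A set)"
    by (rule filtered_closed(5))
  then show ?thesis
    by (simp only: contract_def scaleC_sum_right sum_subtractf) (simp add: add.assoc)
qed

lemma sum_PiE_insert:
  fixes F :: "(nat \<Rightarrow> 'm::finite) \<Rightarrow> 'a::comm_monoid_add"
  assumes "x \<notin> L"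
  shows "(\<Sum>f\<in>insert x L \<rightarrow>\<^sub>E UNIV. F f) = (\<Sum>a\<in>UNIV. \<Sum>f\<in>L \<rightarrow>\<^sub>E UNIV. F (f(x := a)))"
  unfolding PiE_insert_eq
  by (subst sum.reindex[OF inj_combinator[OF assms]])
    (simp add: case_prod_unfold sum.cartesian_product o_def)

lemma slot_val_update: "x \<notin># uppers w \<Longrightarrow> x \<notin># lowers w \<Longrightarrow> slot_val c (f(x := a)) w = slot_val c f w"
  by (cases w) auto

definition all_uppers :: "'n slot list \<Rightarrow> nat multiset" where
  "all_uppers ws = sum_list (map uppers ws)"

definition all_lowers :: "'n slot list \<Rightarrow> nat multiset" where
  "all_lowers ws = sum_list (map lowers ws)"

lemma all_uppers_simps [simp]:
  "all_uppers [] = {#}" "all_uppers (w # ws) = uppers w + all_uppers ws" "all_uppers (us @ ws) = all_uppers us +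
      all_uppers ws"
  by (simp_all add: all_uppers_def)

lemma all_lowers_simps [simp]:
  "all_lowers [] = {#}" "all_lowers (w # ws) = lowers w + all_lowers ws" "all_lowers (us @ ws) = all_lowers us +
      all_lowers ws"
  by (simp_all add: all_lowers_def)

lemma slots_val_update:
  "x \<notin># all_uppers ws \<Longrightarrow> x \<notin># all_lowers ws \<Longrightarrow> slots_val c ws (f(x := a)) = slots_val c ws f"
  by (induction ws) (auto simp: slot_val_update)

lemma in_all_uppers: "x \<in># all_uppers ws \<Longrightarrow> \<exists>us w vs. ws = us @ [w] @ vs \<and> x \<in># uppers w"
proof (induction ws)
  case (Cons w ws)
  show ?case
  proof (cases "x \<in># uppers w")
    case True
    then show ?thesis by (intro exI[of _ "[]"]) auto
  next
    case False
    then obtain us w' vs where "ws = us @ [w'] @ vs" "x \<in># uppers w'" using Cons by auto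
    then show ?thesis by (intro exI[of _ "w # us"]) auto
  qed
qed simp

text \<open>
  Comparing multisets states that every label of \<open>L\<close> occurs exactly once as an upper and exactly once
  as a lower label.
\<close>

definition closed_slots :: "nat set \<Rightarrow> 'n slot list \<Rightarrow> bool" where
  "closed_slots L ws \<longleftrightarrow> finite L \<and> all_uppers ws = mset_set L \<and> all_lowers ws = mset_set L"

lemma closed_slots_balanced: "closed_slots L ws \<Longrightarrow> all_uppers ws = all_lowers ws"
  by (simp add: closed_slots_def)

lemma closed_slots_count: "closed_slots L ws \<Longrightarrow> count (all_lowers ws) x \<le> 1"
  by (simp add: closed_slots_def count_mset_set')

lemma closed_slots_move: "closed_slots L (us @ [w] @ ws) \<longleftrightarrow> closed_slots L (w # us @ ws)"
  by (simp add: closed_slots_def ac_simps)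

lemma closed_slots_remove:
  assumes "closed_slots L ws" "all_uppers ws = add_mset x (all_uppers vs)" "all_lowers ws =
      add_mset x (all_lowers vs)"
  shows "closed_slots (L - {x}) vs" "x \<in> L" "x \<notin># all_uppers vs" "x \<notin># all_lowers vs"
proof -
  have fin: "finite L" and u: "add_mset x (all_uppers vs) = mset_set L" and l: "add_mset x (all_lowers vs) =
      mset_set L"
    using assms by (auto simp: closed_slots_def)
  have "x \<in># mset_set L" using u by (metis union_single_eq_member)
  then show x: "x \<in> L" using fin by simp
  have e: "mset_set L = add_mset x (mset_set (L - {x}))" using fin x by (simp add: mset_set.remove)
  have "all_uppers vs = mset_set (L - {x})" "all_lowers vs = mset_set (L - {x})"
    using u l e by (metis add_mset_add_mset_same_iff)+
  then show "closed_slots (L - {x}) vs" "x \<notin># all_uppers vs" "x \<notin># all_lowers vs"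
    using fin by (auto simp: closed_slots_def)
qed

lemma closed_slots_merge:
  assumes cl: "closed_slots L (w # w' # ws)"
    and x: "uppers w = {#x#}" "lowers w' = {#x#}"
    and v: "all_uppers (w' # ws) = all_uppers vs" "all_lowers (w # ws) = all_lowers vs"
  shows "closed_slots (L - {x}) vs" "x \<in> L" "x \<notin># all_uppers vs" "x \<notin># all_lowers vs"
proof -
  have u: "all_uppers (w # w' # ws) = add_mset x (all_uppers vs)" "all_lowers (w # w' # ws) =
      add_mset x (all_lowers vs)"
    using x v by simp_all
  show "closed_slots (L - {x}) vs" "x \<in> L" "x \<notin># all_uppers vs" "x \<notin># all_lowers vs"
    by (rule closed_slots_remove[OF cl u])+
qed

text \<open>
  Summing over the label that links two neighbouring slots turns them into the slots \<open>vs\<close>.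
\<close>

lemma contract_merge:
  assumes cl: "closed_slots L (w # w' # ws)" 
    and x: "uppers w = {#x#}" "lowers w' = {#x#}"
    and v: "all_uppers (w' # ws) = all_uppers vs" "all_lowers (w # ws) = all_lowers vs"
    and merge: "\<And>f. (\<Sum>a\<in>UNIV. slot_val c (f(x := a)) w * slot_val c (f(x := a)) w') * slots_val c ws f =
      (slots_val c vs f :: ('s::theta_sign, 'm::finite, 'n) A)"
  shows "contract c L (w # w' # ws) = (contract c (L - {x}) vs :: ('s, 'm, 'n) A)"
proof -
  note r = closed_slots_merge[OF cl x v]
  have "all_uppers ws \<subseteq># all_uppers vs" "all_lowers ws \<subseteq># all_lowers vs" unfolding v[symmetric] by simp_all
  then have nin: "x \<notin># all_uppers ws" "x \<notin># all_lowers ws" using r(3,4) by (auto dest: mset_subset_eqD)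
  have L: "L = insert x (L - {x})" using r(2) by auto
  have "(contract c L (w # w' # ws) :: ('s, 'm, 'n) A) = (\<Sum>a\<in>UNIV. \<Sum>f\<in>(L - {x}) \<rightarrow>\<^sub>E UNIV.
      slots_val c (w # w' # ws) (f(x := a)))"
    unfolding contract_def by (subst L, rule sum_PiE_insert) simp
  also have "\<dots> = (\<Sum>f\<in>(L - {x}) \<rightarrow>\<^sub>E UNIV. \<Sum>a\<in>UNIV. slots_val c (w # w' # ws) (f(x := a)))"
    by (rule sum.swap)
  also have "\<dots> = (\<Sum>f\<in>(L - {x}) \<rightarrow>\<^sub>E UNIV. slots_val c vs f)"
    unfolding merge[symmetric] by (simp add: slots_val_update[OF nin] sum_distrib_right mult.assoc)
  finally show "contract c L (w # w' # ws) = (contract c (L - {x}) vs :: ('s, 'm, 'n) A)"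
      by (simp add: contract_def)
qed

text \<open>
  The two memberships are what a complete contraction produces: a cycle of matrix letters gives a
  trace, and a chain from an \<open>x\<close> to a \<open>\<partial>\<close> gives the image of a Yangian generator.
\<close>

locale subalgebra_with_generators =
  fixes c :: complex and S :: "('s::theta_sign, 'm::finite, 'n) A set"
  assumes subalgebra: "complex_subalgebra S"
    and trace_in: "(\<Sum>a\<in>UNIV. mpow (w_matrix c (theta TYPE('s))) s a a) \<otimes> 1 \<in> S"
    and t_coeff_in: "t_coeff c s i j \<in> S"
begin

abbreviation contr :: "nat set \<Rightarrow> 'n slot list \<Rightarrow> ('s, 'm, 'n) A" where
  "contr \<equiv> contract c"

text \<open>
  The elements of \<open>S\<close> up to terms of lower order.
\<close>

definition S_plus :: "nat \<Rightarrow> ('s, 'm, 'n) A set" where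
  "S_plus d = {x. \<exists>y\<in>S. x - y \<in> filtered c d}"

lemma S_closed: "1 \<in> S" "x \<in> S \<Longrightarrow> y \<in> S \<Longrightarrow> x + y \<in> S" "x \<in> S \<Longrightarrow> y \<in> S \<Longrightarrow> x * y \<in> S" "x \<in> S \<Longrightarrow> k *\<^sub>C x \<in> S" "0 \<in> S"
proof -
  show *: "1 \<in> S" "x \<in> S \<Longrightarrow> y \<in> S \<Longrightarrow> x + y \<in> S" "x \<in> S \<Longrightarrow> y \<in> S \<Longrightarrow> x * y \<in> S" "x \<in> S \<Longrightarrow> k *\<^sub>C x \<in> S" for x y k
    using subalgebra by (auto simp: complex_subalgebra_def)
  show "0 \<in> S" using *(4)[OF *(1), of 0] by simp
qed

lemma S_plus_I: "y \<in> S \<Longrightarrow> x - y \<in> filtered c d \<Longrightarrow> x \<in> S_plus d"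
  unfolding S_plus_def by blast

lemma S_plus_scale: assumes "x \<in> S_plus d" shows "k *\<^sub>C x \<in> S_plus d"
proof -
  obtain y where y: "y \<in> S" "x - y \<in> filtered c d" using assms unfolding S_plus_def by blast
  show ?thesis
    using filtered_closed(3)[OF y(2), of k] by (intro S_plus_I[OF S_closed(4)[OF y(1), of k]])
        (simp add: scaleC_diff_right)
qed

lemma S_plus_add: assumes "x \<in> S_plus d" "y \<in> S_plus d" shows "x + y \<in> S_plus d"
proof -
  obtain x' y' where "x' \<in> S" "y' \<in> S" "x - x' \<in> filtered c d" "y - y' \<in> filtered c d"
      using assms unfolding S_plus_def by blast
  then have "x' + y' \<in> S" "(x + y) - (x' + y') \<in> filtered c d"
    using filtered_closed(2)[of "x - x'" c d "y - y'"] S_closed(2) by (auto simp: algebra_simps)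
  then show ?thesis unfolding S_plus_def by blast
qed

lemma S_subset_S_plus: "x \<in> S \<Longrightarrow> x \<in> S_plus d"
  by (rule S_plus_I[of x]) (simp_all add: filtered_closed(1))

lemma filtered_subset_S_plus: "x \<in> filtered c d \<Longrightarrow> x \<in> S_plus d"
  by (rule S_plus_I[OF S_closed(5)]) simp

lemma S_plus_sum: "(\<And>i. i \<in> I \<Longrightarrow> f i \<in> S_plus d) \<Longrightarrow> sum f I \<in> S_plus d"
  by (induction I rule: infinite_finite_induct) (simp_all add: S_plus_add S_subset_S_plus S_closed(5))

lemma S_plus_mono: "d \<le> e \<Longrightarrow> S_plus d \<subseteq> S_plus e"
  unfolding S_plus_def using filtered_mono[of d e c] by blast

text \<open>
  The bound on the degree of \<open>x\<close> keeps its product with the error of \<open>y\<close> of lower order.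
\<close>

lemma S_plus_mult: assumes "x \<in> S" "x \<in> filtered c (Suc a)" "y \<in> S_plus b" shows "x * y \<in> S_plus (a + b)"
proof -
  obtain y' where y': "y' \<in> S" "y - y' \<in> filtered c b" using assms(3) unfolding S_plus_def by blast
  have "x * y - x * y' \<in> filtered c (a + b)" using filtered_mult_left[OF assms(2)
      y'(2)] by (simp add: right_diff_distrib)
  then show ?thesis unfolding S_plus_def using S_closed(3)[OF assms(1) y'(1)] by blast
qed

lemma S_plus_cong: assumes "x - k *\<^sub>C y \<in> filtered c d" "y \<in> S_plus d" shows "x \<in> S_plus d"
  using S_plus_add[OF filtered_subset_S_plus[OF assms(1)] S_plus_scale[OF assms(2), of k]] by simp

lemma S_plus_move:
  assumes "contr L (w # us @ ws) \<in> S_plus (slots_deg (us @ [w] @ ws))"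
  shows "contr L (us @ [w] @ ws) \<in> S_plus (slots_deg (us @ [w] @ ws))"
  using S_plus_cong[of "contr L (us @ [w] @ ws)" "koszul_sign TYPE('s) (slots_odd us) (slot_odd w)"
      "contr L (w # us @ ws)"]
    move_to_front[of c L us w ws, where 's = 's and 'm = 'm] assms by blast

text \<open>
  Induction on the number of slots, with the degree fixed. A matrix slot is either closed upon itself
  and splits off a trace, or it is absorbed by the slot that carries its lower label as an upper one.
  If only \<open>x\<close> and \<open>\<partial>\<close> slots are left, each \<open>\<partial>\<close> is paired with an \<open>x\<close>, and the pair splits off a
  Yangian generator.
\<close>

lemma contract_in_S_plus: "closed_slots L ws \<Longrightarrow> contr L ws \<in> S_plus (slots_deg ws)"
proof (induction "length ws" arbitrary: L ws rule: less_induct)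
  case less
  have IH: "contr L' vs \<in> S_plus (slots_deg vs)" if "length vs < length ws" "closed_slots L' vs" for L' vs
    by (rule less.hyps[OF that])
  show ?case
  proof (cases "\<exists>s \<alpha> \<beta>. Gl_Slot s \<alpha> \<beta> \<in> set ws")
    case True
    then obtain s \<alpha> \<beta> where mem: "Gl_Slot s \<alpha> \<beta> \<in> set ws" by blast
    obtain us vs where "ws = us @ Gl_Slot s \<alpha> \<beta> # vs" using split_list[OF mem] by blast
    then have ws: "ws = us @ [Gl_Slot s \<alpha> \<beta>] @ vs" by simp
    let ?g = "Gl_Slot s \<alpha> \<beta>" and ?r = "us @ vs"
    have cl: "closed_slots L (?g # ?r)" using less(2) unfolding ws closed_slots_move .
    have "contr L (?g # ?r) \<in> S_plus (slots_deg ws)"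
    proof (cases "\<alpha> = \<beta>")
      case True
      have u: "all_uppers (?g # ?r) = add_mset \<alpha> (all_uppers ?r)" "all_lowers (?g # ?r) =
          add_mset \<alpha> (all_lowers ?r)"
        using True by simp_all
      note r = closed_slots_remove[OF cl u]
      have L: "L = insert \<alpha> (L - {\<alpha>})" using r(2) by auto
      let ?tr = "(\<Sum>a\<in>UNIV. mpow (w_matrix c (theta TYPE('s))) s a a) \<otimes> 1 :: ('s, 'm, 'n) A"
      have "contr L (?g # ?r) = (\<Sum>a\<in>UNIV. \<Sum>f\<in>(L - {\<alpha>}) \<rightarrow>\<^sub>E UNIV. slots_val c (?g # ?r) (f(\<alpha> := a)))"
        unfolding contract_def by (subst L, rule sum_PiE_insert) simp
      also have "\<dots> = (\<Sum>a\<in>UNIV. \<Sum>f\<in>(L - {\<alpha>}) \<rightarrow>\<^sub>E UNIV. (mpow (w_matrix c (theta TYPE('s))) s a a \<otimes> 1) *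
          slots_val c ?r f)"
        unfolding slots_val_simps(2) slots_val_update[OF r(3,4)] using True by simp
      also have "\<dots> = ?tr * contr (L - {\<alpha>}) ?r"
        unfolding contract_def tensor_sum_left sum_distrib_left sum_distrib_right by (rule sum.swap)
      finally have e: "contr L (?g # ?r) = ?tr * contr (L - {\<alpha>}) ?r" .
      have tr: "?tr \<in> filtered c (Suc s)"
        unfolding tensor_sum_left by (intro filtered_closed(5)
            subsetD[OF parity_filtered_subset mpow_parity_filtered])
      have "contr (L - {\<alpha>}) ?r \<in> S_plus (slots_deg ?r)" by (rule IH) (simp_all add: ws r(1))
      from S_plus_mult[OF trace_in tr this] show ?thesis unfolding e by (simp add: ws ac_simps)
    next
      case False
      have "\<beta> \<in># all_lowers (?g # ?r)" by simp
      then have "\<beta> \<in># all_uppers (?g # ?r)" unfolding closed_slots_balanced[OF cl] .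
      then have "\<beta> \<in># all_uppers ?r" using False by simp
      then obtain us' w vs' where r: "?r = us' @ [w] @ vs'" "\<beta> \<in># uppers w" using in_all_uppers by blast
      have len: "length us + length vs = length us' + Suc (length vs')"
        using arg_cong[OF r(1), of length] by simp
      have deg: "slots_deg us + slots_deg vs = slots_deg us' + (slot_deg w + slots_deg vs')"
        using arg_cong[OF r(1), of slots_deg] by simp
      have cl2: "closed_slots L (w # ?g # us' @ vs')"
        using cl closed_slots_move[of L "?g # us'" w vs'] unfolding r(1) by simp
      have "contr L (w # ?g # us' @ vs') \<in> S_plus (slots_deg ws)"
      proof (cases w)
        case (Gl_Slot s' \<alpha>' \<beta>')
        then have "\<alpha>' = \<beta>" using r(2) by simp
        have "\<beta>' \<noteq> \<beta>"
        proof
          assume "\<beta>' = \<beta>"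
          then have "count (all_lowers (w # ?g # us' @ vs')) \<beta> \<ge> 2" using Gl_Slot by simp
          then show False using closed_slots_count[OF cl2, of \<beta>] by linarith
        qed
        \<comment> \<open>The two powers of \<open>w\<close> are multiplied along the label \<open>\<beta>\<close>.\<close>
        let ?v = "Gl_Slot (s' + s) \<alpha> \<beta>' # us' @ vs'"
        have merge: "contr L (w # ?g # us' @ vs') = contr (L - {\<beta>}) ?v"
          using \<open>\<beta>' \<noteq> \<beta>\<close> False Gl_Slot \<open>\<alpha>' = \<beta>\<close>
          by (intro contract_merge[OF cl2, of \<beta> ?v c]) (simp_all add: mpow_add tensor_mult tensor_sum_left)
        have cl': "closed_slots (L - {\<beta>}) ?v"
          by (rule closed_slots_merge[OF cl2]) (use Gl_Slot \<open>\<alpha>' = \<beta>\<close> in simp_all)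
        have "length ?v < length ws" "slots_deg ?v = slots_deg ws"
          using ws Gl_Slot len deg by simp_all
        then show ?thesis using IH[OF _ cl'] merge by simp
      next
        case (X_Slot s' \<alpha>' i)
        then have "\<alpha>' = \<beta>" using r(2) by simp
        \<comment> \<open>The power of \<open>w\<close> is absorbed into the \<open>x\<close> slot.\<close>
        let ?v = "X_Slot (s' + s) \<alpha> i # us' @ vs'"
        have "(\<Sum>b\<in>UNIV. (\<Sum>a\<in>UNIV. mpow (w_matrix c (theta TYPE('s))) s' a b \<otimes> H_x a i) *
            (mpow (w_matrix c (theta TYPE('s))) s b d \<otimes> 1)) =
           (\<Sum>a\<in>UNIV. mpow (w_matrix c (theta TYPE('s))) (s' + s) a d \<otimes> (H_x a i :: ('s, 'm, 'n) HU))" for d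
          unfolding sum_distrib_right by (subst sum.swap) (simp add: mpow_add tensor_mult tensor_sum_left)
        then have merge: "contr L (w # ?g # us' @ vs') = contr (L - {\<beta>}) ?v"
          using False X_Slot \<open>\<alpha>' = \<beta>\<close>
          by (intro contract_merge[OF cl2, of \<beta> ?v c]) simp_all
        have cl': "closed_slots (L - {\<beta>}) ?v"
          by (rule closed_slots_merge[OF cl2]) (use X_Slot \<open>\<alpha>' = \<beta>\<close> in simp_all)
        have "length ?v < length ws" "slots_deg ?v = slots_deg ws"
          using ws X_Slot len deg by simp_all
        then show ?thesis using IH[OF _ cl'] merge by simp
      qed (use r(2) in simp)
      then show ?thesis
        using S_plus_move[of L w "?g # us'" vs'] r(1) ws deg by (simp add: ac_simps)
    qed
    then show ?thesis using S_plus_move[of L ?g us vs] unfolding ws by simp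
  next
    case noG: False
    show ?thesis
    proof (cases "all_lowers ws")
      case empty
      then have "all_uppers ws = {#}" using less(2) by (simp add: closed_slots_def)
      then have "ws = []" using empty by (cases ws; cases "hd ws") auto
      moreover have "L = {}" using empty less(2) by (auto simp: closed_slots_def mset_set_empty_iff)
      ultimately show ?thesis using S_subset_S_plus[OF S_closed(1)] by (simp add: contract_def)
    next
      case (add \<beta> M)
      then have "\<beta> \<in># all_lowers ws" by simp
      then have "\<exists>w\<in>set ws. \<beta> \<in># lowers w" by (induction ws) auto
      then obtain w where w: "w \<in> set ws" "\<beta> \<in># lowers w" by blast
      obtain j where "w = D_Slot \<beta> j" by (cases w; use w noG in auto)
      then obtain us vs where "ws = us @ D_Slot \<beta> j # vs" using split_list[OF w(1)] by blast
      then have ws: "ws = us @ [D_Slot \<beta> j] @ vs" by simp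
      let ?g = "D_Slot \<beta> j" and ?r = "us @ vs"
      have cl: "closed_slots L (?g # ?r)" using less(2) unfolding ws closed_slots_move .
      have "\<beta> \<in># all_lowers (?g # ?r)" by simp
      then have "\<beta> \<in># all_uppers (?g # ?r)" unfolding closed_slots_balanced[OF cl] .
      then have "\<beta> \<in># all_uppers ?r" by simp
      then obtain us' w vs' where r: "?r = us' @ [w] @ vs'" "\<beta> \<in># uppers w" using in_all_uppers by blast
      have len: "length us + length vs = length us' + Suc (length vs')"
        using arg_cong[OF r(1), of length] by simp
      have deg: "slots_deg us + slots_deg vs = slots_deg us' + (slot_deg w + slots_deg vs')"
        using arg_cong[OF r(1), of slots_deg] by simp
      have "w \<in> set ws" using arg_cong[OF r(1), of set] ws by auto
      obtain s i where wX: "w = X_Slot s \<beta> i" by (cases w; use \<open>w \<in> set ws\<close> noG r(2) in auto)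
      have cl2: "closed_slots L (w # ?g # us' @ vs')"
        using cl closed_slots_move[of L "?g # us'" w vs'] unfolding r(1) by simp
      have u: "all_uppers (w # ?g # us' @ vs') = add_mset \<beta> (all_uppers (us' @ vs'))"
        "all_lowers (w # ?g # us' @ vs') = add_mset \<beta> (all_lowers (us' @ vs'))"
        using wX by simp_all
      note rr = closed_slots_remove[OF cl2 u]
      have L: "L = insert \<beta> (L - {\<beta>})" using rr(2) by auto
      have t: "t_coeff c s i j = (\<Sum>b\<in>UNIV. (\<Sum>a\<in>UNIV. mpow (w_matrix c (theta TYPE('s))) s a b \<otimes> H_x a i) *
          (1 \<otimes> H_d b j :: ('s, 'm, 'n) A))"
        unfolding sum_distrib_right t_coeff_def by (subst sum.swap) (simp add: tensor_mult)
      have "contr L (w # ?g # us' @ vs') = (\<Sum>b\<in>UNIV. \<Sum>f\<in>(L - {\<beta>}) \<rightarrow>\<^sub>E UNIV. slots_val c (w # ?g # us' @ vs')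
          (f(\<beta> := b)))"
        unfolding contract_def by (subst L, rule sum_PiE_insert) simp
      also have "\<dots> = (\<Sum>b\<in>UNIV. \<Sum>f\<in>(L - {\<beta>}) \<rightarrow>\<^sub>E UNIV.
          ((\<Sum>a\<in>UNIV. mpow (w_matrix c (theta TYPE('s))) s a b \<otimes> H_x a i) * (1 \<otimes> H_d b j)) *
              slots_val c (us' @ vs') f)"
        unfolding slots_val_simps(2) slots_val_update[OF rr(3,4)] mult.assoc[symmetric] wX by simp
      also have "\<dots> = t_coeff c s i j * contr (L - {\<beta>}) (us' @ vs')"
        unfolding t contract_def by (simp only: sum_distrib_left sum_distrib_right) (rule sum.swap)
      finally have e: "contr L (w # ?g # us' @ vs') = t_coeff c s i j * contr (L - {\<beta>}) (us' @ vs')" .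
      have "contr (L - {\<beta>}) (us' @ vs') \<in> S_plus (slots_deg (us' @ vs'))"
        using rr(1) ws len by (intro IH) simp_all
      moreover have "t_coeff c s i j \<in> (filtered c (Suc (s + 2)) :: ('s, 'm, 'n) A set)"
      proof -
        have "slot_val c (\<lambda>_. b) (X_Slot s 0 i) * slot_val c (\<lambda>_. b) (D_Slot 0 j) \<in> (filtered c (Suc (Suc s) +
            Suc 0) :: ('s, 'm, 'n) A set)" for b
          using slots_val_filtered[of c "[X_Slot s 0 i, D_Slot 0 j]" "\<lambda>_. b", where 's = 's] by simp
        then show ?thesis unfolding t by (intro filtered_closed) simp
      qed
      ultimately have "contr L (w # ?g # us' @ vs') \<in> S_plus (s + 2 + slots_deg (us' @ vs'))"
        unfolding e by (intro S_plus_mult t_coeff_in)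
      then have "contr L (?g # us' @ [w] @ vs') \<in> S_plus (slots_deg ws)"
        using S_plus_move[of L w "?g # us'" vs'] ws wX deg by (simp add: ac_simps)
      then show ?thesis using S_plus_move[of L ?g us vs] unfolding ws r(1)[symmetric] by simp
    qed
  qed
qed

end

section \<open>The action of \<open>GL\<^sub>m\<close> on letters, traces and images\<close>

lemma gl_incl_expand: "gl_incl M = (\<Sum>a\<in>UNIV. \<Sum>b\<in>UNIV. (M $ a $ b) *\<^sub>C U_E a b)"
proof -
  have gl0: "gl_incl 0 = 0" using gl_incl_add[of 0 0] by simp
  have sum: "gl_incl (\<Sum>i\<in>K. f i) = (\<Sum>i\<in>K. gl_incl (f i))" for K :: "'k set" and f :: "'k \<Rightarrow> complex^'a^'a"
    by (induction K rule: infinite_finite_induct) (simp_all add: gl0 gl_incl_add)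
  have "M = (\<Sum>a\<in>UNIV. \<Sum>b\<in>UNIV. scale_mat (M $ a $ b) (mat_unit a b))"
  proof -
    have "(\<Sum>a\<in>UNIV. \<Sum>b\<in>UNIV. scale_mat (M $ a $ b) (mat_unit a b)) $ i $ j = M $ i $ j" for i j
    proof -
      have "(\<Sum>a\<in>UNIV. \<Sum>b\<in>UNIV. scale_mat (M $ a $ b) (mat_unit a b)) $ i $ j =
        (\<Sum>a\<in>UNIV. \<Sum>b\<in>UNIV. scale_mat (M $ a $ b) (mat_unit a b) $ i $ j)"
        by simp
      also have "\<dots> = (\<Sum>a\<in>UNIV. \<Sum>b\<in>UNIV. if a = i then (if b = j then M $ a $ b else 0) else 0)"
        by (intro sum.cong refl) (simp add: scale_mat_def mat_unit_def)
      also have "\<dots> = (\<Sum>a\<in>UNIV. if a = i then (\<Sum>b\<in>UNIV. if b = j then M $ a $ b else 0) else 0)"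
        by (intro sum.cong refl) simp
      finally show ?thesis by simp
    qed
    then show ?thesis by (simp add: vec_eq_iff)
  qed
  then have "gl_incl M = gl_incl (\<Sum>a\<in>UNIV. \<Sum>b\<in>UNIV. scale_mat (M $ a $ b) (mat_unit a b))" by simp
  also have "\<dots> = (\<Sum>a\<in>UNIV. \<Sum>b\<in>UNIV. (M $ a $ b) *\<^sub>C U_E a b)"
    unfolding sum gl_incl_scale U_E_def ..
  finally show ?thesis .
qed

lemma matrix_inv_both:
  fixes g :: "complex^'m^'m"
  assumes "invertible g"
  shows "matrix_inv g ** g = mat 1" "g ** matrix_inv g = mat 1"
  using assms unfolding invertible_def matrix_inv_def by (metis (mono_tags, lifting) someI_ex)+

lemma inverse_entries:
  fixes g :: "complex^'m::finite^'m"
  assumes "invertible g"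
  shows "(\<Sum>c\<in>UNIV. matrix_inv g $ a $ c * g $ c $ b) = (if a = b then 1 else 0)"
    "(\<Sum>c\<in>UNIV. g $ a $ c * matrix_inv g $ c $ b) = (if a = b then 1 else 0)"
proof -
  have "(matrix_inv g ** g) $ a $ b = mat 1 $ a $ b" "(g ** matrix_inv g) $ a $ b = mat 1 $ a $ b"
    by (simp_all add: matrix_inv_both[OF assms])
  then show "(\<Sum>c\<in>UNIV. matrix_inv g $ a $ c * g $ c $ b) = (if a = b then 1 else 0)"
    "(\<Sum>c\<in>UNIV. g $ a $ c * matrix_inv g $ c $ b) = (if a = b then 1 else 0)"
    by (simp_all add: matrix_matrix_mult_def mat_def)
qed

text \<open>
  The group acts on the matrix \<open>w\<close> by conjugation with \<open>g\<close>. The scalar part is compatible because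
  scalar matrices are fixed by conjugation.
\<close>

lemma act_w_matrix:
  fixes g :: "complex^'m::finite^'m"
  assumes g: "invertible g"
  shows "act_Ugl g (w_matrix c t a b) = (\<Sum>d\<in>UNIV. \<Sum>e\<in>UNIV. (matrix_inv g $ a $ d * g $ e $ b)
      *\<^sub>C w_matrix c t d e)"
proof -
  let ?h = "matrix_inv g"
  note hom = act_Ugl_alg_hom[OF g]
  have entry: "(g ** mat_unit b a ** ?h) $ e $ d = g $ e $ b * ?h $ a $ d" for d e
  proof -
    have "(\<Sum>k\<in>UNIV. (\<Sum>l\<in>UNIV. g $ e $ l * mat_unit b a $ l $ k) * ?h $ k $ d) =
      (\<Sum>k\<in>UNIV. if k = a then g $ e $ b * ?h $ k $ d else 0)"
    proof (rule sum.cong[OF refl])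
      fix k
      have "(\<Sum>l\<in>UNIV. g $ e $ l * mat_unit b a $ l $ k) = (\<Sum>l\<in>UNIV. if l = b then (if k =
          a then g $ e $ l else 0) else 0)"
        by (rule sum.cong) (auto simp: mat_unit_def)
      then show "(\<Sum>l\<in>UNIV. g $ e $ l * mat_unit b a $ l $ k) * ?h $ k $ d = (if k = a then g $ e $ b *
          ?h $ k $ d else 0)"
        by simp
    qed
    then show ?thesis by (simp add: matrix_matrix_mult_def)
  qed
  have "act_Ugl g (U_E b a) = (\<Sum>e\<in>UNIV. \<Sum>d\<in>UNIV. (g $ e $ b * ?h $ a $ d) *\<^sub>C U_E e d)"
    unfolding U_E_def[of b a] act_Ugl_gl_incl[OF g] gl_incl_expand[of "g ** mat_unit b a ** ?h"] entry ..
  also have "\<dots> = (\<Sum>d\<in>UNIV. \<Sum>e\<in>UNIV. (?h $ a $ d * g $ e $ b) *\<^sub>C U_E e d)"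
    by (subst sum.swap) (simp add: mult.commute)
  finally have U: "act_Ugl g (U_E b a) = (\<Sum>d\<in>UNIV. \<Sum>e\<in>UNIV. (?h $ a $ d * g $ e $ b) *\<^sub>C U_E e d)" .
  have S: "(\<Sum>d\<in>UNIV. \<Sum>e\<in>UNIV. (?h $ a $ d * g $ e $ b) *\<^sub>C (if d = e then c *\<^sub>C 1 else 0)) =
     (if a = b then c *\<^sub>C (1 :: 'm Ugl) else 0)"
  proof -
    have "(\<Sum>d\<in>UNIV. \<Sum>e\<in>UNIV. (?h $ a $ d * g $ e $ b) *\<^sub>C (if d = e then c *\<^sub>C 1 else 0)) =
       (\<Sum>d\<in>UNIV. (?h $ a $ d * g $ d $ b) *\<^sub>C c *\<^sub>C (1 :: 'm Ugl))"
      by (intro sum.cong refl) (simp add: if_distrib[of "\<lambda>x. _ *\<^sub>C x"] cong: if_cong)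
    also have "\<dots> = (\<Sum>d\<in>UNIV. ?h $ a $ d * g $ d $ b) *\<^sub>C c *\<^sub>C 1" by (simp only: scaleC_sum_left)
    finally show ?thesis by (auto simp: inverse_entries[OF g] scaleC_one)
  qed
  have "act_Ugl g (w_matrix c t a b) = - ((if a = b then c *\<^sub>C 1 else 0) + t *\<^sub>C act_Ugl g (U_E b a))"
    by (auto simp: w_matrix_def alg_hom_uminus[OF hom] alg_hom_diff[OF hom] alg_homD[OF hom])
  also have "\<dots> = (\<Sum>d\<in>UNIV. \<Sum>e\<in>UNIV. (?h $ a $ d * g $ e $ b) *\<^sub>C w_matrix c t d e)"
    unfolding U S[symmetric]
    by (simp add: w_matrix_def scaleC_sum_right scaleC_scaleC scaleC_diff_right scaleC_minus_right
        scaleC_add_right sum_negf sum.distrib sum_subtractf mult_ac)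
  finally show ?thesis .
qed

text \<open>
  Between the two factors \<open>g\<close> and its inverse \<open>h\<close> cancel; their entries are complex numbers, which can
  be moved past the noncommuting entries of \<open>x\<close> and \<open>y\<close>.
\<close>

lemma conjugation_mult:
  fixes x y :: "'m::finite \<Rightarrow> 'm \<Rightarrow> 'a::complex_algebra"
  assumes gh: "\<And>e i. (\<Sum>f\<in>UNIV. g e f * h f i) = (if e = i then 1 else 0)"
  shows "(\<Sum>f\<in>UNIV. (\<Sum>d\<in>UNIV. \<Sum>e\<in>UNIV. (h a d * g e f) *\<^sub>C x d e) * (\<Sum>i\<in>UNIV. \<Sum>j\<in>UNIV. (h f i * g j b)
      *\<^sub>C y i j)) =
    (\<Sum>d\<in>UNIV. \<Sum>j\<in>UNIV. (h a d * g j b) *\<^sub>C (\<Sum>e\<in>UNIV. x d e * y e j))"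
proof -
  define P where "P e = (\<Sum>d\<in>UNIV. h a d *\<^sub>C x d e)" for e
  define Q where "Q i = (\<Sum>j\<in>UNIV. g j b *\<^sub>C y i j)" for i
  have P: "(\<Sum>d\<in>UNIV. \<Sum>e\<in>UNIV. (h a d * g e f) *\<^sub>C x d e) = (\<Sum>e\<in>UNIV. g e f *\<^sub>C P e)" for f
    unfolding P_def scaleC_sum_right scaleC_scaleC by (subst sum.swap) (simp add: mult.commute)
  have Q: "(\<Sum>i\<in>UNIV. \<Sum>j\<in>UNIV. (h f i * g j b) *\<^sub>C y i j) = (\<Sum>i\<in>UNIV. h f i *\<^sub>C Q i)" for f
    unfolding Q_def scaleC_sum_right scaleC_scaleC ..
  have "(\<Sum>f\<in>UNIV. (\<Sum>e\<in>UNIV. g e f *\<^sub>C P e) * (\<Sum>i\<in>UNIV. h f i *\<^sub>C Q i)) =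
    (\<Sum>f\<in>UNIV. \<Sum>e\<in>UNIV. \<Sum>i\<in>UNIV. (g e f * h f i) *\<^sub>C (P e * Q i))"
    by (simp add: sum_product mult_scaleC_left mult_scaleC_right scaleC_scaleC mult.commute)
  also have "\<dots> = (\<Sum>e\<in>UNIV. \<Sum>i\<in>UNIV. \<Sum>f\<in>UNIV. (g e f * h f i) *\<^sub>C (P e * Q i))"
    by (rule trans[OF sum.swap sum.cong[OF refl sum.swap]])
  also have "\<dots> = (\<Sum>e\<in>UNIV. \<Sum>i\<in>UNIV. if i = e then P e * Q i else 0)"
    by (intro sum.cong refl) (auto simp: scaleC_sum_left[symmetric] gh scaleC_one)
  also have "\<dots> = (\<Sum>e\<in>UNIV. \<Sum>d\<in>UNIV. \<Sum>j\<in>UNIV. (h a d * g j b) *\<^sub>C (x d e * y e j))"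
    by (simp add: P_def Q_def sum_product mult_scaleC_left mult_scaleC_right scaleC_scaleC mult.commute)
  also have "\<dots> = (\<Sum>d\<in>UNIV. \<Sum>j\<in>UNIV. \<Sum>e\<in>UNIV. (h a d * g j b) *\<^sub>C (x d e * y e j))"
    by (rule trans[OF sum.swap sum.cong[OF refl sum.swap]])
  finally show ?thesis unfolding P Q scaleC_sum_right .
qed

lemma act_mpow:
  fixes g :: "complex^'m::finite^'m"
  assumes g: "invertible g"
  shows "act_Ugl g (mpow (w_matrix c t) s a b) = (\<Sum>d\<in>UNIV. \<Sum>e\<in>UNIV. (matrix_inv g $ a $ d * g $ e $ b)
      *\<^sub>C mpow (w_matrix c t) s d e)"
proof (induction s arbitrary: a)
  case 0
  have "(\<Sum>d\<in>UNIV. \<Sum>e\<in>UNIV. (matrix_inv g $ a $ d * g $ e $ b) *\<^sub>C mpow (w_matrix c t) 0 d e) =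
     (\<Sum>d\<in>UNIV. (matrix_inv g $ a $ d * g $ d $ b) *\<^sub>C (1 :: 'm Ugl))"
    by (intro sum.cong refl) (simp add: if_distrib[of "\<lambda>x. _ *\<^sub>C x"] cong: if_cong)
  also have "\<dots> = (\<Sum>d\<in>UNIV. matrix_inv g $ a $ d * g $ d $ b) *\<^sub>C 1" by (simp only: scaleC_sum_left)
  also have "\<dots> = act_Ugl g (mpow (w_matrix c t) 0 a b)"
    using alg_homD(4,5)[OF act_Ugl_alg_hom[OF g]] by (simp add: inverse_entries[OF g] scaleC_one)
  finally show ?case ..
next
  case (Suc s)
  let ?h = "matrix_inv g" and ?w = "w_matrix c t :: 'm \<Rightarrow> 'm \<Rightarrow> 'm Ugl"
  note hom = act_Ugl_alg_hom[OF g]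
  have "act_Ugl g (mpow ?w (Suc s) a b) = (\<Sum>f\<in>UNIV. act_Ugl g (?w a f) * act_Ugl g (mpow ?w s f b))"
    by (simp add: alg_hom_sum[OF hom] alg_homD[OF hom])
  also have "\<dots> = (\<Sum>d\<in>UNIV. \<Sum>j\<in>UNIV. (?h $ a $ d * g $ j $ b) *\<^sub>C mpow ?w (Suc s) d j)"
    unfolding act_w_matrix[OF g] Suc.IH mpow.simps
    by (rule conjugation_mult[where h = "\<lambda>i j. ?h $ i $ j" and g = "\<lambda>i j. g $ i $ j"])
        (rule inverse_entries(2)[OF g])
  finally show ?case .
qed


lemma act_trace:
  fixes g :: "complex^'m::finite^'m"
  assumes g: "invertible g"
  shows "act_Ugl g (\<Sum>a\<in>UNIV. mpow (w_matrix c t) s a a) = (\<Sum>a\<in>UNIV. mpow (w_matrix c t) s a a)"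
proof -
  have "act_Ugl g (\<Sum>a\<in>UNIV. mpow (w_matrix c t) s a a) =
    (\<Sum>a\<in>UNIV. \<Sum>d\<in>UNIV. \<Sum>e\<in>UNIV. (g $ e $ a * matrix_inv g $ a $ d) *\<^sub>C mpow (w_matrix c t) s d e)"
    by (simp add: alg_hom_sum[OF act_Ugl_alg_hom[OF g]] act_mpow[OF g] mult.commute)
  also have "\<dots> = (\<Sum>d\<in>UNIV. \<Sum>e\<in>UNIV. \<Sum>a\<in>UNIV. (g $ e $ a * matrix_inv g $ a $ d) *\<^sub>C mpow (w_matrix c t) s d e)"
    by (rule trans[OF sum.swap sum.cong[OF refl sum.swap]])
  also have "\<dots> = (\<Sum>d\<in>UNIV. \<Sum>e\<in>UNIV. if e = d then mpow (w_matrix c t) s d e else 0)"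
    by (intro sum.cong refl) (auto simp: scaleC_sum_left[symmetric] inverse_entries[OF g] scaleC_one)
  finally show ?thesis by simp
qed

lemma act_t_coeff:
  fixes g :: "complex^'m::finite^'m"
  assumes g: "invertible g"
  shows "act_A g (t_coeff c s i j :: ('s::theta_sign, 'm, 'n) A) = t_coeff c s i j"
proof -
  let ?h = "matrix_inv g" and ?w = "mpow (w_matrix c (theta TYPE('s))) s :: 'm \<Rightarrow> 'm \<Rightarrow> 'm Ugl"
  let ?F = "\<lambda>a b d e d' e'. ((g $ d' $ a * ?h $ a $ d) * (g $ e $ b * ?h $ b $ e')) *\<^sub>C
      (?w d e \<otimes> (H_x d' i * H_d e' j :: ('s, 'm, 'n) HU))"
  let ?K = "\<lambda>d e d' e'. if d' = d then (if e' = e then ?w d e \<otimes> (H_x d' i * H_d e' j) else 0)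
      else (0 :: ('s, 'm, 'n) A)"
  have "act_A g (t_coeff c s i j :: ('s, 'm, 'n) A) =
    (\<Sum>a\<in>UNIV. \<Sum>b\<in>UNIV. act_Ugl g (?w a b) \<otimes> (act_H g (H_x a i) * act_H g (H_d b j)))"
    by (simp add: t_coeff_def alg_hom_sum[OF act_A_alg_hom[OF g]] act_A_pure_tensor[OF g] alg_homD[OF
        act_H_alg_hom[OF g]])
  also have "\<dots> = (\<Sum>a\<in>UNIV. \<Sum>b\<in>UNIV. \<Sum>d'\<in>UNIV. \<Sum>e'\<in>UNIV. \<Sum>d\<in>UNIV. \<Sum>e\<in>UNIV.
      ?F a b d e d' e')"
    unfolding act_mpow[OF g] act_H_x[OF g] act_H_d[OF g] sum_product
    by (simp add: tensor_sum_left tensor_sum_right tensor_scaleC_left tensor_scaleC_right mult_scaleC_left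
        mult_scaleC_right
        scaleC_sum_right scaleC_scaleC mult_ac)
  also have "\<dots> = (\<Sum>a\<in>UNIV. \<Sum>b\<in>UNIV. \<Sum>d\<in>UNIV. \<Sum>e\<in>UNIV. \<Sum>d'\<in>UNIV. \<Sum>e'\<in>UNIV.
      ?F a b d e d' e')"
    by (intro sum.cong refl sum_swap_pairs)
  also have "\<dots> = (\<Sum>d\<in>UNIV. \<Sum>e\<in>UNIV. \<Sum>d'\<in>UNIV. \<Sum>e'\<in>UNIV. \<Sum>a\<in>UNIV. \<Sum>b\<in>UNIV. 
      ?F a b d e d' e')"
    by (rule trans[OF sum_swap_pairs sum.cong[OF refl sum.cong[OF refl sum_swap_pairs]]])
  also have "\<dots> = (\<Sum>d\<in>UNIV. \<Sum>e\<in>UNIV. \<Sum>d'\<in>UNIV. \<Sum>e'\<in>UNIV. 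
     ?K d e d' e')"
  proof (intro sum.cong refl)
    fix d e d' e'
    have "(\<Sum>a\<in>UNIV. \<Sum>b\<in>UNIV. (g $ d' $ a * ?h $ a $ d) * (g $ e $ b * ?h $ b $ e')) =
      (if d' = d then 1 else 0) * (if e = e' then 1 else 0)"
      unfolding inverse_entries(2)[OF g, symmetric] by (simp only: sum_product)
    then show "(\<Sum>a\<in>UNIV. \<Sum>b\<in>UNIV. ?F a b d e d' e') =
      ?K d e d' e'"
      by (auto simp only: scaleC_sum_left[symmetric]) (auto simp: scaleC_one)
  qed
  also have "\<dots> = t_coeff c s i j"
  proof -
    have "(\<Sum>d'\<in>UNIV. \<Sum>e'\<in>UNIV. ?K d e d' e') =
      (?w d e \<otimes> (H_x d i * H_d e j) :: ('s, 'm, 'n) A)" for d e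
    proof -
      have "(\<Sum>d'\<in>UNIV. \<Sum>e'\<in>UNIV. ?K d e d' e') =
        (\<Sum>d'\<in>UNIV. if d' = d then (\<Sum>e'\<in>UNIV. if e' = e then ?w d e \<otimes> (H_x d' i * H_d e' j) else 0) else (0 ::
            ('s, 'm, 'n) A))"
        by (intro sum.cong refl) auto
      then show ?thesis by simp
    qed
    then show ?thesis by (simp add: t_coeff_def)
  qed
  finally show ?thesis .
qed

lemma act_letter:
  fixes g :: "complex^'m::finite^'m"
  assumes g: "invertible g"
  shows "act_A g (letter_val c (L_gl a b)) = (\<Sum>d\<in>UNIV. \<Sum>e\<in>UNIV. (g $ d $ a * matrix_inv g $ b $ e)
      *\<^sub>C (letter_val c (L_gl d e) :: ('s::theta_sign, 'm, 'n) A))" (is ?gl)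
    and "act_A g (letter_val c (L_x a i)) = (\<Sum>d\<in>UNIV. (g $ d $ a) *\<^sub>C (letter_val c (L_x d i) :: ('s, 'm, 'n)
        A))" (is ?x)
    and "act_A g (letter_val c (L_d b i)) = (\<Sum>d\<in>UNIV. (matrix_inv g $ b $ d) *\<^sub>C (letter_val c (L_d d i) :: ('s,
        'm, 'n) A))" (is ?d)
proof -
  note hu = alg_homD[OF act_Ugl_alg_hom[OF g]] and hh = alg_homD[OF act_H_alg_hom[OF g]]
  show ?gl
    by (subst sum.swap)
      (simp add: act_A_pure_tensor[OF g] hh act_w_matrix[OF g] tensor_sum_left tensor_scaleC_left mult.commute)
  show ?x
    ?d
    by (simp_all add: act_A_pure_tensor[OF g] hu act_H_x[OF g] act_H_d[OF g] tensor_sum_right tensor_scaleC_right)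
qed

section \<open>Invariants as combinations of complete contractions\<close>

text \<open>
  The shape of a letter, with its \<open>GL\<^sub>m\<close>-indices removed.
\<close>

datatype 'n kind = K_gl | K_x 'n | K_d 'n

instance kind :: (finite) finite
proof
  have "(UNIV :: 'a kind set) = insert K_gl (range K_x \<union> range K_d)"
  proof (intro equalityI subsetI)
    fix x :: "'a kind"
    show "x \<in> insert K_gl (range K_x \<union> range K_d)" by (cases x) auto
  qed simp
  then show "finite (UNIV :: 'a kind set)" by (metis finite.insertI finite_Un finite_imageI finite)
qed

primrec num_upper :: "'n kind list \<Rightarrow> nat" where
  "num_upper [] = 0"
| "num_upper (k # s) = (case k of K_d j \<Rightarrow> num_upper s | _ \<Rightarrow> Suc (num_upper s))"

primrec num_lower :: "'n kind list \<Rightarrow> nat" where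
  "num_lower [] = 0"
| "num_lower (k # s) = (case k of K_x i \<Rightarrow> num_lower s | _ \<Rightarrow> Suc (num_lower s))"

text \<open>
  The word of shape \<open>s\<close> whose letters take their upper indices in turn from \<open>I\<close> and their lower
  indices from \<open>J\<close>.
\<close>

primrec monomial :: "complex \<Rightarrow> 'n kind list \<Rightarrow> 'm list \<Rightarrow> 'm list \<Rightarrow> ('s::theta_sign, 'm::finite, 'n) A" where
  "monomial c [] I J = 1"
| "monomial c (k # s) I J = (case k of
      K_gl \<Rightarrow> letter_val c (L_gl (hd I) (hd J)) * monomial c s (tl I) (tl J)
    | K_x i \<Rightarrow> letter_val c (L_x (hd I) i) * monomial c s (tl I) J
    | K_d j \<Rightarrow> letter_val c (L_d (hd J) j) * monomial c s I (tl J))"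

lemma word_val_monomial:
  "\<exists>s I J. length s = length u \<and> I \<in> tuples (num_upper s) \<and> J \<in> tuples (num_lower s) \<and>
    word_val c u = (monomial c s I J :: ('s::theta_sign, 'm::finite, 'n) A)"
proof (induction u)
  case Nil
  show ?case by (intro exI[of _ "[]"]) simp
next
  case (Cons l u)
  then obtain s I J where sIJ: "length s = length u" "I \<in> tuples (num_upper s)" "J \<in> tuples (num_lower s)"
    "word_val c u = (monomial c s I J :: ('s, 'm, 'n) A)" by blast
  show ?case
  proof (cases l)
    case (L_gl a b)
    then show ?thesis using sIJ by (intro exI[of _ "K_gl # s"] exI[of _ "a # I"] exI[of _ "b # J"])
        (simp add: tuples_def)
  next
    case (L_x a i)
    then show ?thesis using sIJ by (intro exI[of _ "K_x i # s"] exI[of _ "a # I"] exI[of _ J])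
        (simp add: tuples_def)
  next
    case (L_d b j)
    then show ?thesis using sIJ by (intro exI[of _ "K_d j # s"] exI[of _ I] exI[of _ "b # J"])
        (simp add: tuples_def)
  qed
qed

definition shapes :: "nat \<Rightarrow> 'n::finite kind list set" where
  "shapes d = {s. length s < d}"

lemma finite_shapes [simp]: "finite (shapes d)"
proof -
  have "shapes d \<subseteq> {s :: 'a kind list. set s \<subseteq> UNIV \<and> length s \<le> d}" by (auto simp: shapes_def)
  then show ?thesis using finite_lists_length_le[of "UNIV :: 'a kind set" d] finite_subset by auto
qed

text \<open>
  The basis of the representation \<open>V\<close> of words shorter than \<open>d\<close> with free indices.
\<close>

definition indices :: "nat \<Rightarrow> ('n::finite kind list \<times> 'm::finite list \<times> 'm list) set" where
  "indices d = (SIGMA s:shapes d. tuples (num_upper s) \<times> tuples (num_lower s))"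

lemma finite_indices [simp]: "finite (indices d)"
  by (simp add: indices_def)

lemma sum_indices:
  "(\<Sum>x\<in>indices d. f x) = (\<Sum>s\<in>shapes d. \<Sum>I\<in>tuples (num_upper s). \<Sum>J\<in>tuples (num_lower s). f (s, I, J))"
proof -
  have "(\<Sum>x\<in>indices d. f x) = (\<Sum>s\<in>shapes d. \<Sum>IJ\<in>tuples (num_upper s) \<times> tuples (num_lower s). f (s, IJ))"
    unfolding indices_def by (subst sum.Sigma) (simp_all add: case_prod_unfold)
  then show ?thesis by (simp add: sum.cartesian_product')
qed

text \<open>
  The map from \<open>V\<close> to \<open>A\<close>.
\<close>

definition realize :: "complex \<Rightarrow> nat \<Rightarrow> ('n kind list \<times> 'm list \<times> 'm list \<Rightarrow> complex) \<Rightarrow> ('s::theta_sign,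
    'm::finite, 'n::finite) A" where
  "realize c d z = (\<Sum>x\<in>indices d. z x *\<^sub>C (case x of (s, I, J) \<Rightarrow> monomial c s I J))"

lemma realize_linear:
  "realize c d (\<lambda>x. y x + z x) = realize c d y + realize c d z"
  "realize c d (\<lambda>x. k * y x) = k *\<^sub>C realize c d y"
  "realize c d (\<lambda>x. y x - z x) = realize c d y - realize c d z"
  "realize c d (\<lambda>x. 0) = 0"
  by (simp_all add: realize_def scaleC_add_left sum.distrib scaleC_sum_right scaleC_scaleC
      calg.scale_left_diff_distrib sum_subtractf)

lemma realize_surj:
  fixes v :: "('s::theta_sign, 'm::finite, 'n::finite) A"
  assumes "v \<in> filtered c d"
  shows "\<exists>z. v = realize c d z"
  using assms[unfolded filtered_def]
proof (rule calg.span_induct)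
  show "calg.subspace {v. \<exists>z. v = (realize c d z :: ('s, 'm, 'n) A)}"
    unfolding calg.subspace_def
  proof (intro conjI ballI allI)
    show "0 \<in> {v. \<exists>z. v = (realize c d z :: ('s, 'm, 'n) A)}"
      by (metis (mono_tags) mem_Collect_eq realize_linear(4))
  qed (auto simp: realize_linear[symmetric])
next
  fix v :: "('s, 'm, 'n) A" assume "v \<in> {word_val c u | u. length u < d}"
  then obtain u where u: "v = word_val c u" "length u < d" by blast
  obtain s I J where sIJ: "length s = length u" "I \<in> tuples (num_upper s)" "J \<in> tuples (num_lower s)"
      "word_val c u = (monomial c s I J :: ('s, 'm, 'n) A)"
    using word_val_monomial by blast
  have "(s, I, J) \<in> indices d" using sIJ u by (simp add: indices_def shapes_def)
  have "realize c d (\<lambda>x. if x = (s, I, J) then 1 else 0) =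
     (\<Sum>x\<in>indices d. if x = (s, I, J) then (case x of (s, I, J) \<Rightarrow> monomial c s I J) else (0 :: ('s, 'm, 'n) A))"
    unfolding realize_def by (intro sum.cong refl) (simp add: scaleC_one)
  also have "\<dots> = v" using \<open>(s, I, J) \<in> indices d\<close> sIJ(4) u(1) by simp
  finally show "\<exists>z. v = realize c d z" by metis
qed

lemma sum_product_double:
  fixes f :: "'i \<Rightarrow> 'a::ring"
  shows "(\<Sum>i\<in>I. f i) * (\<Sum>j\<in>J. \<Sum>k\<in>K. g j k) = (\<Sum>i\<in>I. \<Sum>j\<in>J. \<Sum>k\<in>K. f i * g j k)"
  by (simp only: sum_distrib_right) (simp only: sum_distrib_left)

lemma act_monomial:
  fixes g :: "complex^'m::finite^'m"
  assumes g: "invertible g"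
  shows "I \<in> tuples (num_upper s) \<Longrightarrow> J \<in> tuples (num_lower s) \<Longrightarrow> act_A g (monomial c s I J :: ('s::theta_sign, 'm,
      'n) A) =
    (\<Sum>A\<in>tuples (num_upper s). \<Sum>B\<in>tuples (num_lower s). (tpow g A I * tpow (matrix_inv g) J B)
        *\<^sub>C monomial c s A B)"
proof (induction s arbitrary: I J)
  case Nil
  then show ?case by (simp add: alg_homD[OF act_A_alg_hom[OF g]] scaleC_one)
next
  case (Cons k s)
  let ?h = "matrix_inv g"
  note hom = alg_homD[OF act_A_alg_hom[OF g]]
  show ?case
  proof (cases k)
    case K_gl
    then obtain a I' b J' where IJ: "I = a # I'" "J = b # J'" "I' \<in> tuples (num_upper s)"
        "J' \<in> tuples (num_lower s)"
      using Cons.prems by (auto simp: tuples_def length_Suc_conv)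
    have "act_A g (monomial c (k # s) I J :: ('s, 'm, 'n) A) = 
      (\<Sum>d\<in>UNIV. \<Sum>e\<in>UNIV. (g $ d $ a * ?h $ b $ e) *\<^sub>C letter_val c (L_gl d e)) *
      (\<Sum>A\<in>tuples (num_upper s). \<Sum>B\<in>tuples (num_lower s). (tpow g A I' * tpow ?h J' B) *\<^sub>C monomial c s A B)"
      using K_gl IJ(1,2) by (simp only: monomial.simps kind.case list.sel hom act_letter[OF g] Cons.IH[OF
          IJ(3,4)])
    also have "\<dots> = (\<Sum>d\<in>UNIV. \<Sum>e\<in>UNIV. \<Sum>A\<in>tuples (num_upper s). \<Sum>B\<in>tuples (num_lower s).
       (g $ d $ a * tpow g A I' * (?h $ b $ e * tpow ?h J' B)) *\<^sub>C (letter_val c (L_gl d e) * monomial c s A B))"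
      unfolding sum_distrib_left sum_distrib_right
      by (subst sum_swap_pairs) (simp add: mult_scaleC_left mult_scaleC_right scaleC_scaleC mult_ac)
    also have "\<dots> = (\<Sum>d\<in>UNIV. \<Sum>A\<in>tuples (num_upper s). \<Sum>e\<in>UNIV. \<Sum>B\<in>tuples (num_lower s).
       (g $ d $ a * tpow g A I' * (?h $ b $ e * tpow ?h J' B)) *\<^sub>C (letter_val c (L_gl d e) * monomial c s A B))"
      by (intro sum.cong refl sum.swap)
    finally show ?thesis using K_gl IJ(1,2) by (simp add: sum_tuples_Suc)
  next
    case (K_x i)
    then obtain a I' where IJ: "I = a # I'" "I' \<in> tuples (num_upper s)" "J \<in> tuples (num_lower s)"
      using Cons.prems by (auto simp: tuples_def length_Suc_conv)
    have "act_A g (monomial c (k # s) I J :: ('s, 'm, 'n) A) = 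
      (\<Sum>d\<in>UNIV. (g $ d $ a) *\<^sub>C letter_val c (L_x d i)) *
      (\<Sum>A\<in>tuples (num_upper s). \<Sum>B\<in>tuples (num_lower s). (tpow g A I' * tpow ?h J B) *\<^sub>C monomial c s A B)"
      using K_x IJ(1) by (simp only: monomial.simps kind.case list.sel hom act_letter[OF g] Cons.IH[OF IJ(2,3)])
    also have "\<dots> = (\<Sum>d\<in>UNIV. \<Sum>A\<in>tuples (num_upper s). \<Sum>B\<in>tuples (num_lower s).
       (g $ d $ a * tpow g A I' * tpow ?h J B) *\<^sub>C (letter_val c (L_x d i) * monomial c s A B))"
      unfolding sum_product_double
      by (intro sum.cong refl) (simp add: mult_scaleC_left mult_scaleC_right scaleC_scaleC mult_ac)
    finally show ?thesis using K_x IJ(1) by (simp add: sum_tuples_Suc)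
  next
    case (K_d j)
    then obtain b J' where IJ: "J = b # J'" "I \<in> tuples (num_upper s)" "J' \<in> tuples (num_lower s)"
      using Cons.prems by (auto simp: tuples_def length_Suc_conv)
    have "act_A g (monomial c (k # s) I J :: ('s, 'm, 'n) A) = 
      (\<Sum>e\<in>UNIV. (?h $ b $ e) *\<^sub>C letter_val c (L_d e j)) *
      (\<Sum>A\<in>tuples (num_upper s). \<Sum>B\<in>tuples (num_lower s). (tpow g A I * tpow ?h J' B) *\<^sub>C monomial c s A B)"
      using K_d IJ(1) by (simp only: monomial.simps kind.case list.sel hom act_letter[OF g] Cons.IH[OF IJ(2,3)])
    also have "\<dots> = (\<Sum>e\<in>UNIV. \<Sum>A\<in>tuples (num_upper s). \<Sum>B\<in>tuples (num_lower s).
       (tpow g A I * (?h $ b $ e * tpow ?h J' B)) *\<^sub>C (letter_val c (L_d e j) * monomial c s A B))"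
      unfolding sum_product_double
      by (intro sum.cong refl) (simp add: mult_scaleC_left mult_scaleC_right scaleC_scaleC mult_ac)
    also have "\<dots> = (\<Sum>A\<in>tuples (num_upper s). \<Sum>e\<in>UNIV. \<Sum>B\<in>tuples (num_lower s).
       (tpow g A I * (?h $ b $ e * tpow ?h J' B)) *\<^sub>C (letter_val c (L_d e j) * monomial c s A B))"
      by (rule sum.swap)
    finally show ?thesis using K_d IJ(1) by (simp add: sum_tuples_Suc)
  qed
qed

text \<open>
  The matrix by which \<open>g\<close> acts on \<open>V\<close>.
\<close>

definition index_rep :: "complex^'m^'m \<Rightarrow> 'n kind list \<times> 'm list \<times> 'm list \<Rightarrow> 'n kind list \<times> 'm list \<times> 'm list \<Rightarrow>
    complex" where
  "index_rep g x y = (case x of (s, A, B) \<Rightarrow> case y of (s', I, J) \<Rightarrow>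
     if s = s' then tpow g A I * tpow (matrix_inv g) J B else 0)"

lemma sum_index_rep:
  assumes "s \<in> shapes d"
  shows "(\<Sum>y\<in>indices d. index_rep g (s, A, B) y * z y) =
    (\<Sum>I\<in>tuples (num_upper s). \<Sum>J\<in>tuples (num_lower s). tpow g A I * tpow (matrix_inv g) J B * z (s, I, J))"
proof -
  have "(\<Sum>y\<in>indices d. index_rep g (s, A, B) y * z y) =
    (\<Sum>s'\<in>shapes d. if s' = s then \<Sum>I\<in>tuples (num_upper s'). \<Sum>J\<in>tuples (num_lower s'). tpow g A I *
        tpow (matrix_inv g) J B * z (s', I, J) else 0)"
    unfolding sum_indices by (intro sum.cong refl) (auto simp: index_rep_def)
  then show ?thesis using assms by simp
qed

lemma realize_index_rep:
  fixes g :: "complex^'m::finite^'m"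
  assumes g: "invertible g"
  shows "realize c d (\<lambda>x. \<Sum>y\<in>indices d. index_rep g x y * z y) = act_A g (realize c d z :: ('s::theta_sign, 'm,
      'n::finite) A)"
proof -
  let ?h = "matrix_inv g"
  note hom = act_A_alg_hom[OF g]
  have "realize c d (\<lambda>x. \<Sum>y\<in>indices d. index_rep g x y * z y) =
    (\<Sum>s\<in>shapes d. \<Sum>A\<in>tuples (num_upper s). \<Sum>B\<in>tuples (num_lower s). \<Sum>I\<in>tuples (num_upper s).
        \<Sum>J\<in>tuples (num_lower s).
       (tpow g A I * tpow ?h J B * z (s, I, J)) *\<^sub>C (monomial c s A B :: ('s, 'm, 'n) A))"
    unfolding realize_def sum_indices[of _ d] by (intro sum.cong refl)
        (simp add: sum_index_rep[unfolded sum_indices] scaleC_sum_left)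
  also have "\<dots> = (\<Sum>s\<in>shapes d. \<Sum>I\<in>tuples (num_upper s). \<Sum>J\<in>tuples (num_lower s). \<Sum>A\<in>tuples (num_upper s).
      \<Sum>B\<in>tuples (num_lower s). 
       (tpow g A I * tpow ?h J B * z (s, I, J)) *\<^sub>C monomial c s A B)"
    by (intro sum.cong refl sum_swap_pairs)
  also have "\<dots> = (\<Sum>s\<in>shapes d. \<Sum>I\<in>tuples (num_upper s). \<Sum>J\<in>tuples (num_lower s). z (s, I, J)
      *\<^sub>C act_A g (monomial c s I J))"
    by (intro sum.cong refl) (simp add: act_monomial[OF g] scaleC_sum_right scaleC_scaleC mult_ac)
  also have "\<dots> = act_A g (realize c d z)"
    by (simp add: realize_def sum_indices alg_hom_sum[OF hom] alg_homD[OF hom])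
  finally show ?thesis .
qed

definition adjoint_mat :: "complex^'m^'m \<Rightarrow> complex^'m^'m" where
  "adjoint_mat g = (\<chi> i j. cnj (g $ j $ i))"

lemma adjoint_mat_mult: "adjoint_mat (g ** h) = adjoint_mat h ** adjoint_mat g"
  by (simp add: adjoint_mat_def matrix_matrix_mult_def vec_eq_iff mult.commute)

lemma adjoint_mat_one: "adjoint_mat (mat 1) = mat 1"
  by (simp add: adjoint_mat_def mat_def vec_eq_iff) 

lemma matrix_inv_unique_complex:
  fixes g h :: "complex^'m^'m"
  assumes "g ** h = mat 1" "h ** g = mat 1"
  shows "invertible g" "matrix_inv g = h"
proof -
  show inv: "invertible g" using assms unfolding invertible_def by blast
  have "matrix_inv g = matrix_inv g ** (g ** h)" using assms by simp
  also have "\<dots> = h" using matrix_inv_both[OF inv] by (simp add: matrix_mul_assoc)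
  finally show "matrix_inv g = h" .
qed

lemma adjoint_mat_inverse:
  assumes "invertible g"
  shows "invertible (adjoint_mat g)" "matrix_inv (adjoint_mat g) = adjoint_mat (matrix_inv g)"
proof -
  have "adjoint_mat g ** adjoint_mat (matrix_inv g) = mat 1" "adjoint_mat (matrix_inv g) ** adjoint_mat g = mat 1"
    using matrix_inv_both[OF assms] by (simp_all add: adjoint_mat_mult[symmetric] adjoint_mat_one)
  from matrix_inv_unique_complex[OF this]
  show "invertible (adjoint_mat g)" "matrix_inv (adjoint_mat g) = adjoint_mat (matrix_inv g)" .
qed

lemma tpow_adjoint: "length I = length J \<Longrightarrow> tpow (adjoint_mat g) I J = cnj (tpow g J I)"
  by (induction I J rule: list_induct2) (simp_all add: adjoint_mat_def)

text \<open>
  This makes \<open>invariant_lift\<close> applicable to all of \<open>GL\<^sub>m\<close>, which is closed under conjugate transposes.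
\<close>

lemma index_rep_adjoint:
  assumes "invertible g" "x \<in> indices d" "y \<in> indices d"
  shows "index_rep (adjoint_mat g) x y = cnj (index_rep g y x)"
  using assms(2,3)
  by (auto simp: index_rep_def indices_def tuples_def adjoint_mat_inverse[OF assms(1)] tpow_adjoint)

lemma invariant_coefficients:
  fixes v :: "('s::theta_sign, 'm::finite, 'n::finite) A"
  assumes v: "v \<in> filtered c d" and inv: "v \<in> GL_invariants act_A"
  shows "\<exists>z. v = realize c d z \<and> (\<forall>g. invertible g \<longrightarrow> (\<forall>s\<in>shapes d. \<forall>A\<in>tuples (num_upper s).
      \<forall>B\<in>tuples (num_lower s).
     (\<Sum>I\<in>tuples (num_upper s). \<Sum>J\<in>tuples (num_lower s). tpow g A I * tpow (matrix_inv g) J B * z (s, I, J)) =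
         z (s, A, B)))"
proof -
  obtain w where w: "v = realize c d w" using realize_surj[OF v] by blast
  let ?M = "{z. realize c d z = (0 :: ('s, 'm, 'n) A)}"
  have "\<exists>z. (\<lambda>x. w x - z x) \<in> ?M \<and> (\<forall>g\<in>{g. invertible g}. \<forall>x\<in>indices d. (\<Sum>y\<in>indices d. index_rep g x y * z y) =
      z x)"
  proof (rule invariant_lift)
    fix g :: "complex^'m^'m" assume g: "g \<in> {g. invertible g}"
    show "\<exists>h\<in>{g. invertible g}. \<forall>x\<in>indices d. \<forall>y\<in>indices d. index_rep h x y = cnj (index_rep g y x)"
      using g by (intro bexI[of _ "adjoint_mat g"]) (auto simp: index_rep_adjoint adjoint_mat_inverse)
    show "(\<lambda>x. \<Sum>y\<in>indices d. index_rep g x y * u y) \<in> ?M" if "u \<in> ?M" for u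
      using that g by (simp add: realize_index_rep alg_homD[OF act_A_alg_hom])
    show "(\<lambda>x. (\<Sum>y\<in>indices d. index_rep g x y * w y) - w x) \<in> ?M"
      using g inv by (simp add: realize_linear realize_index_rep w[symmetric] GL_invariants_def)
  qed (simp_all add: realize_linear)
  then obtain z where z: "realize c d (\<lambda>x. w x - z x) = (0 :: ('s, 'm, 'n) A)"
    "\<And>g x. invertible g \<Longrightarrow> x \<in> indices d \<Longrightarrow> (\<Sum>y\<in>indices d. index_rep g x y * z y) = z x" by blast
  have "v = realize c d z" using z(1) by (simp add: realize_linear w)
  moreover have "(\<Sum>I\<in>tuples (num_upper s). \<Sum>J\<in>tuples (num_lower s). tpow g A I * tpow (matrix_inv g) J B * z (s,
      I, J)) = z (s, A, B)"
    if "invertible g" "s \<in> shapes d" "A \<in> tuples (num_upper s)" "B \<in> tuples (num_lower s)" for g s A B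
    using z(2)[OF that(1), of "(s, A, B)"] that(2-4) sum_index_rep[OF that(2),
        of g A B z] by (simp add: indices_def)
  ultimately show ?thesis by blast
qed

text \<open>
  The scalar matrix 2 acts on such a tensor by \<open>2\<^bsup>N - M\<^esup>\<close>.
\<close>

lemma balanced_or_zero:
  fixes z :: "'m::finite list \<Rightarrow> 'm list \<Rightarrow> complex"
  assumes inv: "\<And>g A B. invertible g \<Longrightarrow> A \<in> tuples N \<Longrightarrow> B \<in> tuples M \<Longrightarrow>
     (\<Sum>I\<in>tuples N. \<Sum>J\<in>tuples M. tpow g A I * tpow (matrix_inv g) J B * z I J) = z A B"
    and "N \<noteq> M" "A \<in> tuples N" "B \<in> tuples M"
  shows "z A B = 0"
proof -
  \<comment> \<open>The inverse of the scalar matrix 2.\<close>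
  have two: "mat 2 ** mat (1/2) = (mat 1 :: complex^'m^'m)" "mat (1/2) ** mat 2 = (mat 1 :: complex^'m^'m)"
    by (simp_all add: matrix_matrix_mult_def mat_def vec_eq_iff if_distrib[of "\<lambda>x. x * _"] cong: if_cong)
  note i = matrix_inv_unique_complex[OF two]
  have "z A B = (\<Sum>I\<in>tuples N. \<Sum>J\<in>tuples M. if I = A then (if J = B then 2 ^ N * (1/2) ^ M * z I J else 0) else 0)"
    unfolding inv[OF i(1) assms(3,4), symmetric] i(2)
    using assms(3,4) by (intro sum.cong refl) (simp add: tuples_def tpow_scalar)
  also have "\<dots> = (\<Sum>I\<in>tuples N. if I = A then (\<Sum>J\<in>tuples M. if J = B then 2 ^ N * (1/2) ^ M * z I J else 0)
      else 0)"
    by (intro sum.cong refl) simp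
  also have "\<dots> = 2 ^ N * (1/2) ^ M * z A B" using assms(3,4) by simp
  finally have "(2 ^ N - 2 ^ M) * z A B = 0" by (auto simp: field_simps)
  moreover have "(2::complex) ^ N - 2 ^ M \<noteq> 0"
    using assms(2) by (metis eq_iff_diff_eq_0 of_nat_eq_iff of_nat_numeral of_nat_power power_inject_exp
        one_less_numeral_iff semiring_norm(76))
  ultimately show ?thesis by simp
qed

text \<open>
  Invariance under conjugation with \<open>g \<otimes> \<dots> \<otimes> g\<close> means commuting with it.
\<close>

lemma invariants_are_permutations:
  fixes z :: "'m::finite list \<Rightarrow> 'm list \<Rightarrow> complex"
  assumes inv: "\<And>g A B. invertible g \<Longrightarrow> A \<in> tuples N \<Longrightarrow> B \<in> tuples N \<Longrightarrow>
     (\<Sum>I\<in>tuples N. \<Sum>J\<in>tuples N. tpow g A I * tpow (matrix_inv g) J B * z I J) = z A B"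
  shows "\<exists>c. \<forall>A\<in>tuples N. \<forall>B\<in>tuples N.
    z A B = (\<Sum>\<pi> | \<pi> permutes {..<N}. if A = permute N \<pi> B then c \<pi> else 0)"
proof (rule tensor_first_fundamental_theorem)
  fix g :: "complex^'m^'m" assume g: "invertible g"
  let ?h = "matrix_inv g"
  show "commutes_on (tuples N) z (tpow g)"
    unfolding commutes_on_def
  proof (intro ballI)
    fix A B :: "'m list" assume A: "A \<in> tuples N" and B: "B \<in> tuples N"
    have "(\<Sum>K\<in>tuples N. z A K * tpow g K B) =
      (\<Sum>K\<in>tuples N. (\<Sum>I\<in>tuples N. \<Sum>J\<in>tuples N. tpow g A I * tpow ?h J K * z I J) * tpow g K B)"
      by (intro sum.cong refl) (simp add: inv[OF g A])
    also have "\<dots> = (\<Sum>K\<in>tuples N. \<Sum>I\<in>tuples N. \<Sum>J\<in>tuples N. tpow g A I * z I J * (tpow ?h J K * tpow g K B))"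
      unfolding sum_distrib_right by (simp add: mult_ac)
    also have "\<dots> = (\<Sum>I\<in>tuples N. \<Sum>J\<in>tuples N. \<Sum>K\<in>tuples N. tpow g A I * z I J * (tpow ?h J K * tpow g K B))"
      by (rule trans[OF sum.swap sum.cong[OF refl sum.swap]])
    also have "\<dots> = (\<Sum>I\<in>tuples N. \<Sum>J\<in>tuples N. if J = B then tpow g A I * z I J else 0)"
    proof (intro sum.cong refl)
      fix I J :: "'m list" assume J: "J \<in> tuples N"
      have len: "length J = N" "length B = N" using J B by (simp_all add: tuples_def)
      show "(\<Sum>K\<in>tuples N. tpow g A I * z I J * (tpow ?h J K * tpow g K B)) = (if J = B then tpow g A I *
          z I J else 0)"
        unfolding sum_distrib_left[symmetric] tpow_mult[OF len] matrix_inv_both[OF g] tpow_scalar[OF len] by simp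
    qed
    also have "\<dots> = (\<Sum>I\<in>tuples N. tpow g A I * z I B)" using B by simp
    finally show "(\<Sum>K\<in>tuples N. z A K * tpow g K B) = (\<Sum>I\<in>tuples N. tpow g A I * z I B)" .
  qed
qed

text \<open>
  The monomial with labels in place of values of indices. Single letters are slots with \<open>w\<^bsup>1\<^esup>\<close> for
  matrix letters and with \<open>w\<^bsup>0\<^esup>\<close> for the letters \<open>x\<close>.
\<close>

primrec slots_of :: "'n kind list \<Rightarrow> nat list \<Rightarrow> nat list \<Rightarrow> 'n slot list" where
  "slots_of [] us ls = []"
| "slots_of (k # s) us ls = (case k of
      K_gl \<Rightarrow> Gl_Slot 1 (hd us) (hd ls) # slots_of s (tl us) (tl ls)
    | K_x i \<Rightarrow> X_Slot 0 (hd us) i # slots_of s (tl us) ls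
    | K_d j \<Rightarrow> D_Slot (hd ls) j # slots_of s us (tl ls))"

lemma slots_of_properties:
  "us \<in> tuples (num_upper s) \<Longrightarrow> ls \<in> tuples (num_lower s) \<Longrightarrow>
    monomial c s (map f us) (map f ls) = (slots_val c (slots_of s us ls) f :: ('s::theta_sign, 'm::finite, 'n)
        A) \<and>
    all_uppers (slots_of s us ls) = mset us \<and> all_lowers (slots_of s us ls) = mset ls \<and>
        slots_deg (slots_of s us ls) = length s"
proof (induction s arbitrary: us ls)
  case Nil
  then show ?case by simp
next
  case (Cons k s)
  show ?case
  proof (cases k)
    case K_gl
    then obtain a us' b ls' where "us = a # us'" "ls = b # ls'" "us' \<in> tuples (num_upper s)"
        "ls' \<in> tuples (num_lower s)"
      using Cons.prems by (auto simp: tuples_def length_Suc_conv)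
    then show ?thesis using K_gl Cons.IH[of us' ls'] by (simp del: mpow.simps)
  next
    case (K_x i)
    then obtain a us' where *: "us = a # us'" "us' \<in> tuples (num_upper s)" "ls \<in> tuples (num_lower s)"
      using Cons.prems by (auto simp: tuples_def length_Suc_conv)
    have "mpow (w_matrix c (theta TYPE('s))) 0 b (f a) \<otimes> H_x b i = (if b = f a then 1 \<otimes> H_x b i else (0 :: ('s,
        'm, 'n) A))" for b
      by simp
    then have "slot_val c f (X_Slot 0 a i) = (1 \<otimes> H_x (f a) i :: ('s, 'm, 'n) A)"
      by (simp only: slot_val.simps) (simp del: mpow.simps)
    then show ?thesis using * K_x Cons.IH[of us' ls] by (simp del: slot_val.simps)
  next
    case (K_d j)
    then obtain b ls' where "ls = b # ls'" "us \<in> tuples (num_upper s)" "ls' \<in> tuples (num_lower s)"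
      using Cons.prems by (auto simp: tuples_def length_Suc_conv)
    then show ?thesis using K_d Cons.IH[of us ls'] by simp
  qed
qed

lemma sum_tuples_functions:
  "(\<Sum>B\<in>tuples N. F B) = (\<Sum>f\<in>{..<N} \<rightarrow>\<^sub>E (UNIV :: 'm::finite set). F (map f [0..<N]))"
proof (rule sum.reindex_bij_witness[of _ "\<lambda>f. map f [0..<N]" "\<lambda>B. restrict (\<lambda>i. B ! i) {..<N}"])
  fix B :: "'m list" assume B: "B \<in> tuples N"
  show e: "map (restrict ((!) B) {..<N}) [0..<N] = B"
    using B by (intro nth_equalityI) (auto simp: tuples_def)
  show "F (map (restrict ((!) B) {..<N}) [0..<N]) = F B" by (simp only: e)
  show "restrict ((!) B) {..<N} \<in> {..<N} \<rightarrow>\<^sub>E UNIV" by simp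
next
  fix f :: "nat \<Rightarrow> 'm" assume f: "f \<in> {..<N} \<rightarrow>\<^sub>E UNIV"
  show "restrict ((!) (map f [0..<N])) {..<N} = f"
    using f by (auto simp: fun_eq_iff PiE_def extensional_def)
  show "map f [0..<N] \<in> tuples N" by (simp add: tuples_def)
qed

text \<open>
  The tensor of a permutation identifies the upper indices with the permuted lower ones.
\<close>

lemma permutation_sum_contract:
  assumes \<pi>: "\<pi> permutes {..<N}" and s: "num_upper s = N" "num_lower s = N"
  defines "ws \<equiv> slots_of s (map \<pi> [0..<N]) [0..<N]"
  shows "(\<Sum>B\<in>tuples N. monomial c s (permute N \<pi> B) B :: ('s::theta_sign, 'm::finite, 'n) A) =
      contract c {..<N} ws"
    and "closed_slots {..<N} ws" and "slots_deg ws = length s"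
proof -
  note p = slots_of_properties[of "map \<pi> [0..<N]" s "[0..<N]", where 's = 's and 'm = 'm, folded ws_def]
  have l: "map \<pi> [0..<N] \<in> tuples (num_upper s)" "[0..<N] \<in> tuples (num_lower s)"
      using s by (simp_all add: tuples_def)
  have perm: "permute N \<pi> (map f [0..<N]) = map f (map \<pi> [0..<N])" for f :: "nat \<Rightarrow> 'm"
    using permutes_in_image[OF \<pi>] by (auto simp: permute_def)
  show "(\<Sum>B\<in>tuples N. monomial c s (permute N \<pi> B) B :: ('s, 'm, 'n) A) = contract c {..<N} ws"
    unfolding sum_tuples_functions contract_def perm using p[OF l] by simp
  have "mset (map \<pi> [0..<N]) = image_mset \<pi> (mset_set {..<N})"
    by (simp add: lessThan_atLeast0)
  also have "\<dots> = mset_set (\<pi> ` {..<N})"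
    using permutes_inj_on[OF \<pi>] by (simp add: image_mset_mset_set)
  finally show "closed_slots {..<N} ws"
    using p[OF l] permutes_image[OF \<pi>] by (simp add: closed_slots_def lessThan_atLeast0)
  show "slots_deg ws = length s" using p[OF l] by simp
qed

text \<open>
  The filtration exhausts \<open>A\<close>: the union of its pieces is a subalgebra, and it contains the generators
  of both tensor factors. The matrix units are recovered from \<open>w\<close> by means of \<open>\<theta>\<^sup>2 = 1\<close>.
\<close>

lemma filtered_exhausts:
  fixes v :: "('s::theta_sign, 'm::finite, 'n) A"
  shows "\<exists>d. v \<in> filtered c d"
proof -
  let ?t = "theta TYPE('s)"
  define F where "F = {v :: ('s, 'm, 'n) A. \<exists>d. v \<in> filtered c d}"
  have one: "1 \<in> F" unfolding F_def using word_val_filtered[of "[]" 1 c] by auto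
  have add: "x + y \<in> F" if xy: "x \<in> F" "y \<in> F" for x y
  proof -
    obtain a b where ab: "x \<in> filtered c a" "y \<in> filtered c b" using xy unfolding F_def by blast
    have "x \<in> filtered c (max a b)" "y \<in> filtered c (max a b)"
      using ab filtered_mono[of a "max a b" c] filtered_mono[of b "max a b" c] by auto
    then show ?thesis unfolding F_def using filtered_closed(2) by blast
  qed
  have scale: "k *\<^sub>C x \<in> F" if x: "x \<in> F" for k x
    using x unfolding F_def using filtered_closed(3) by blast
  have mult: "x * y \<in> F" if xy: "x \<in> F" "y \<in> F" for x y
  proof -
    obtain a b where ab: "x \<in> filtered c a" "y \<in> filtered c b" using xy unfolding F_def by blast
    have "x \<in> filtered c (Suc a)" using ab(1) filtered_mono[of a "Suc a" c] by auto
    then show ?thesis unfolding F_def using filtered_mult_left ab(2) by blast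
  qed
  have zero: "0 \<in> F" using scale[OF one, of 0] by simp
  have sub: "calg.subspace F" unfolding calg.subspace_def using zero add scale by blast
  have sum: "sum f I \<in> F" if "\<And>i. i \<in> I \<Longrightarrow> f i \<in> F" for f and I :: "'m set"
    using that by (induction I rule: infinite_finite_induct) (auto intro: zero add)
  have letter: "letter_val c l \<in> F" for l
    unfolding F_def using word_val_filtered[of "[l]" 2 c] by auto
  \<comment> \<open>Solve the definition of \<open>w\<close> for \<open>E\<close>.\<close>
  have U: "U_E a b \<otimes> 1 \<in> F" for a b
  proof -
    have "?t *\<^sub>C U_E a b = - ((if a = b then c *\<^sub>C 1 else 0) + w_matrix c ?t b a)" by (auto simp: w_matrix_def)
    then have "?t *\<^sub>C ?t *\<^sub>C U_E a b = ?t *\<^sub>C (- ((if a = b then c *\<^sub>C 1 else 0) + w_matrix c ?t b a))" by simp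
    then have "U_E a b = (- ?t) *\<^sub>C ((if a = b then c else 0) *\<^sub>C 1 + w_matrix c ?t b a)"
      by (auto simp: scaleC_scaleC theta_square scaleC_one scaleC_minus_right scaleC_minus_left scaleC_add_right
          scaleC_diff_right)
    then have "U_E a b \<otimes> (1 :: ('s, 'm, 'n) HU) = (- ?t) *\<^sub>C ((if a = b then c else 0) *\<^sub>C 1 +
        w_matrix c ?t b a \<otimes> 1)"
      by (simp only: tensor_scaleC_left tensor_add_left tensor_one)
    moreover have "w_matrix c ?t b a \<otimes> 1 \<in> F" using letter[of "L_gl a b"] by simp
    ultimately show ?thesis by (metis scale add one)
  qed
  have gl: "gl_incl M \<otimes> 1 \<in> F" for M
    unfolding gl_incl_expand[of M] tensor_sum_left tensor_scaleC_left by (intro sum scale U)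
  have Uword: "prod_list (map gen gs) \<otimes> 1 \<in> F" for gs :: "'m gl_gen list"
  proof (induction gs)
    case Nil
    show ?case using one by (simp add: tensor_one)
  next
    case (Cons u gs)
    obtain M where "u = GL_Gen M" by (cases u)
    have "prod_list (map gen (u # gs)) \<otimes> 1 = (gen u \<otimes> 1) * (prod_list (map gen gs) \<otimes> (1 :: ('s, 'm, 'n) HU))"
      by (simp add: tensor_mult)
    then show ?case using mult[OF gl[of M] Cons.IH] \<open>u = GL_Gen M\<close> by (simp add: gl_incl_def)
  qed
  have left: "u \<otimes> 1 \<in> F" for u :: "'m Ugl"
  proof (rule calg.span_induct[OF presented_in_span_words[of u]])
    show "calg.subspace {u. u \<otimes> 1 \<in> F}"
      unfolding calg.subspace_def using zero add scale by (simp add: tensor_add_left tensor_scaleC_left)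
  qed (use Uword in auto)
  have Hword: "1 \<otimes> prod_list (map gen gs) \<in> F" for gs :: "('s, 'm, 'n) H_gen list"
  proof (induction gs)
    case Nil
    show ?case using one by (simp add: tensor_one)
  next
    case (Cons u gs)
    have "1 \<otimes> gen u \<in> F"
    proof (cases u)
      case (X_Gen a i)
      then show ?thesis using letter[of "L_x a i"] by (simp add: H_x_def)
    next
      case (D_Gen a i)
      then show ?thesis using letter[of "L_d a i"] by (simp add: H_d_def)
    qed
    from mult[OF this Cons.IH] show ?case by (simp add: tensor_mult)
  qed
  have right: "1 \<otimes> h \<in> F" for h
  proof (rule calg.span_induct[OF presented_in_span_words[of h]])
    show "calg.subspace {h. 1 \<otimes> h \<in> F}"
      unfolding calg.subspace_def using zero add scale by (simp add: tensor_add_right tensor_scaleC_right)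
  qed (use Hword in auto)
  have pure: "u \<otimes> h \<in> F" for u h
    using mult[OF left[of u] right[of h]] by (simp add: tensor_mult)
  have "v \<in> F"
  proof (rule calg.span_induct[OF alg_quot_in_span_basis[of v]])
    show "calg.subspace {v. v \<in> F}" using sub by simp
    fix x assume "x \<in> range (basis_elem :: ('m Ugl, ('s, 'm, 'n) HU) tensor_pair \<Rightarrow> ('s, 'm, 'n) A)"
    then obtain p where "x = basis_elem p" by blast
    moreover obtain u h where "p = Tensor_Pair u h" by (cases p)
    ultimately show "x \<in> F" using pure[of u h] by (simp add: pure_tensor_def)
  qed
  then show ?thesis by (simp add: F_def)
qed

section \<open>The invariants are generated by the centre and the Yangian\<close>

lemma GL_invariants_act_A_subalgebra: "complex_subalgebra (GL_invariants (act_A :: complex^'m::finite^'m \<Rightarrow>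
    ('s::theta_sign, 'm, 'n) A \<Rightarrow> _))"
  by (auto simp: complex_subalgebra_def GL_invariants_def alg_homD[OF act_A_alg_hom])

text \<open>
  The induction on the degree. By \<open>invariant_coefficients\<close>, an invariant \<open>v\<close> is a combination of
  complete contractions, hence the sum of some \<open>y \<in> S\<close> and terms of lower order; as \<open>S\<close> consists of
  invariants, \<open>v - y\<close> is again invariant.
\<close>

lemma invariants_in_subalgebra:
  fixes S :: "('s::theta_sign, 'm::finite, 'n::finite) A set"
  assumes "subalgebra_with_generators c S" and inv: "S \<subseteq> GL_invariants act_A"
    and v: "v \<in> filtered c d" "v \<in> GL_invariants act_A"
  shows "v \<in> S"
proof -
  interpret subalgebra_with_generators c S by fact
  show ?thesis using v
  proof (induction d arbitrary: v)
    case 0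
    then show ?case using S_closed(5) by (simp add: filtered_def)
  next
    case (Suc d)
    obtain z where z: "v = realize c (Suc d) z"
      "\<And>g s A B. invertible g \<Longrightarrow> s \<in> shapes (Suc d) \<Longrightarrow> A \<in> tuples (num_upper s) \<Longrightarrow> B \<in> tuples (num_lower s) \<Longrightarrow>
       (\<Sum>I\<in>tuples (num_upper s). \<Sum>J\<in>tuples (num_lower s). tpow g A I * tpow (matrix_inv g) J B * z (s, I, J)) =
           z (s, A, B)"
      using invariant_coefficients[OF Suc.prems] by blast
    have "v = (\<Sum>s\<in>shapes (Suc d). \<Sum>A\<in>tuples (num_upper s). \<Sum>B\<in>tuples (num_lower s). z (s, A, B)
        *\<^sub>C monomial c s A B)"
      unfolding z(1) realize_def sum_indices by simp
    also have "\<dots> \<in> S_plus d"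
    proof (rule S_plus_sum)
      fix s :: "'n kind list" assume s: "s \<in> shapes (Suc d)"
      show "(\<Sum>A\<in>tuples (num_upper s). \<Sum>B\<in>tuples (num_lower s). z (s, A, B) *\<^sub>C monomial c s A B) \<in> S_plus d"
      proof (cases "num_upper s = num_lower s")
        case False
        have "z (s, A, B) = 0" if "A \<in> tuples (num_upper s)" "B \<in> tuples (num_lower s)" for A B
          by (rule balanced_or_zero[of "num_upper s" "num_lower s" "\<lambda>A B. z (s, A, B)",
              OF z(2)[OF _ s] False that])
        then show ?thesis using S_subset_S_plus[OF S_closed(5)] by simp
      next
        case True
        define N where "N = num_lower s"
        have N: "num_upper s = N" "num_lower s = N" using True N_def by auto
        obtain k where k: "\<And>A B. A \<in> tuples N \<Longrightarrow> B \<in> tuples N \<Longrightarrow>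
            z (s, A, B) = (\<Sum>\<pi> | \<pi> permutes {..<N}. if A = permute N \<pi> B then k \<pi> else 0)"
          using invariants_are_permutations[of N "\<lambda>A B. z (s, A, B)", OF z(2)[OF _ s, unfolded N]] by blast
        have "(\<Sum>A\<in>tuples N. \<Sum>B\<in>tuples N. z (s, A, B) *\<^sub>C monomial c s A B) =
          (\<Sum>A\<in>tuples N. \<Sum>B\<in>tuples N. \<Sum>\<pi> | \<pi> permutes {..<N}. (if A =
              permute N \<pi> B then k \<pi> *\<^sub>C monomial c s A B else (0 :: ('s, 'm, 'n) A)))"
          by (intro sum.cong refl) (simp add: k scaleC_sum_left if_distrib[of "\<lambda>x. x *\<^sub>C _"] cong: if_cong)
        also have "\<dots> = (\<Sum>B\<in>tuples N. \<Sum>\<pi> | \<pi> permutes {..<N}. \<Sum>A\<in>tuples N. (if A =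
            permute N \<pi> B then k \<pi> *\<^sub>C monomial c s A B else 0))"
          by (rule trans[OF sum.swap sum.cong[OF refl sum.swap]])
        also have "\<dots> = (\<Sum>B\<in>tuples N. \<Sum>\<pi> | \<pi> permutes {..<N}. k \<pi> *\<^sub>C monomial c s (permute N \<pi> B) B)"
          by simp
        also have "\<dots> = (\<Sum>\<pi> | \<pi> permutes {..<N}. k \<pi> *\<^sub>C (\<Sum>B\<in>tuples N. monomial c s (permute N \<pi> B) B))"
          by (subst sum.swap) (simp add: scaleC_sum_right)
        also have "\<dots> \<in> S_plus d"
        proof (rule S_plus_sum, rule S_plus_scale)
          fix \<pi> assume "\<pi> \<in> {\<pi>. \<pi> permutes {..<N}}"
          then have \<pi>: "\<pi> permutes {..<N}" by simp
          note p = permutation_sum_contract[OF \<pi> N]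
          have "length s \<le> d" using s by (simp add: shapes_def)
          then show "(\<Sum>B\<in>tuples N. monomial c s (permute N \<pi> B) B :: ('s, 'm, 'n) A) \<in> S_plus d"
            unfolding p(1) using contract_in_S_plus[OF p(2)] S_plus_mono unfolding p(3) by blast
        qed
        finally show ?thesis unfolding N .
      qed
    qed
    finally obtain y where y: "y \<in> S" "v - y \<in> filtered c d" unfolding S_plus_def by blast
    have "v - y \<in> GL_invariants act_A"
      using y(1) inv Suc.prems(2) by (auto simp: GL_invariants_def alg_hom_diff[OF act_A_alg_hom])
    with y have "v - y \<in> S" by (intro Suc.IH)
    from S_closed(2)[OF this y(1)] show ?case by simp
  qed
qed

theorem proposition4p1:
  shows "\<exists>\<phi> :: 'n::finite Yangian \<Rightarrow> ('s::theta_sign, 'm::finite, 'n) A.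
    alg_hom \<phi> \<and>
    (\<forall>i j k. \<phi> (fls_nth (T_series i j) k) = fls_nth (image_series i j) k) \<and>
    (\<forall>\<psi>. alg_hom \<psi> \<and>
         (\<forall>i j k. \<psi> (fls_nth (T_series i j) k) = fls_nth (image_series i j) k) \<longrightarrow> \<psi> = \<phi>) \<and>
    GL_invariants (act_A :: complex^'m^'m \<Rightarrow> ('s, 'm, 'n) A \<Rightarrow> ('s, 'm, 'n) A) =
      complex_subalgebra hull
        ({z \<otimes> 1 | z. z \<in> GL_invariants (act_Ugl :: complex^'m^'m \<Rightarrow> 'm Ugl \<Rightarrow> 'm Ugl)} \<union> range \<phi>)"
proof -
  define c where "c = theta TYPE('s) * of_nat CARD('m) / 2"
  obtain \<phi> :: "'n Yangian \<Rightarrow> ('s, 'm, 'n) A" where \<phi>: "alg_hom \<phi>" "\<And>s i j. \<phi> (Y_T s i j) = T_coeff c s i j"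
    using yangian_homomorphism by metis
  have gen_T: "gen (T_Gen r i j) = Y_T (Suc r) i j" for r and i j :: 'n by (simp add: Y_T_def)
  have series: "\<phi> (fls_nth (T_series i j) k) = fls_nth (image_series i j) k" for i j k
    by (simp add: T_series_nth image_series_nth \<phi>(2) alg_homD(5)[OF \<phi>(1)] c_def)
  have unique: "\<psi> = \<phi>" if \<psi>: "alg_hom \<psi>" "\<And>i j k. \<psi> (fls_nth (T_series i j) k) = fls_nth (image_series i j) k"
      for \<psi>
  proof (rule alg_hom_presented_eqI[OF \<psi>(1) \<phi>(1)])
    fix u :: "'n Y_gen"
    obtain r i j where u: "u = T_Gen r i j" by (cases u)
    have "gen u = fls_nth (T_series i j) (int (Suc r))" unfolding u gen_T T_series_nth by (simp del: of_nat_Suc)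
    then show "\<psi> (gen u) = \<phi> (gen u)" using \<psi>(2) series by simp
  qed
  let ?X = "{z \<otimes> 1 | z. z \<in> GL_invariants (act_Ugl :: complex^'m^'m \<Rightarrow> 'm Ugl \<Rightarrow> 'm Ugl)} \<union> range \<phi>"
  let ?S = "complex_subalgebra hull ?X"
  have S: "complex_subalgebra ?S" by (rule hull_in) (auto simp: complex_subalgebra_def)
  have X: "?X \<subseteq> ?S" by (rule hull_subset)
  have range_inv: "\<phi> x \<in> GL_invariants act_A" for x
  proof -
    have eq: "(\<lambda>x. act_A g (\<phi> x)) = \<phi>" if g: "invertible g" for g
    proof (rule alg_hom_presented_eqI[OF alg_hom_compose[OF act_A_alg_hom[OF g] \<phi>(1)] \<phi>(1)])
      fix u :: "'n Y_gen"
      obtain r i j where u: "u = T_Gen r i j" by (cases u)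
      show "act_A g (\<phi> (gen u)) = \<phi> (gen u)"
        unfolding u gen_T \<phi>(2) by (simp add: T_coeff_def act_t_coeff[OF g])
    qed
    have "act_A g (\<phi> x) = \<phi> x" if "invertible g" for g
      using fun_cong[OF eq[OF that], of x] by simp
    then show ?thesis unfolding GL_invariants_def by blast
  qed
  have S_inv: "?S \<subseteq> GL_invariants act_A"
  proof (rule hull_minimal)
    show "?X \<subseteq> GL_invariants act_A"
      using range_inv by (auto simp: GL_invariants_def act_A_pure_tensor alg_homD[OF act_H_alg_hom])
  qed (rule GL_invariants_act_A_subalgebra)
  interpret subalgebra_with_generators c ?S
  proof
    show "(\<Sum>a\<in>UNIV. mpow (w_matrix c (theta TYPE('s))) s a a) \<otimes> 1 \<in> ?S" for s
    proof (rule subsetD[OF X])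
      have "(\<Sum>a\<in>UNIV. mpow (w_matrix c (theta TYPE('s))) s a a) \<in> GL_invariants (act_Ugl :: complex^'m^'m \<Rightarrow>
          'm Ugl \<Rightarrow> 'm Ugl)"
        by (simp add: GL_invariants_def act_trace)
      then show "(\<Sum>a\<in>UNIV. mpow (w_matrix c (theta TYPE('s))) s a a) \<otimes> 1 \<in> ?X" by blast
    qed
    show "t_coeff c s i j \<in> ?S" for s i j
    proof (rule subsetD[OF X])
      have "t_coeff c s i j = \<phi> (Y_T (Suc s) i j)" by (simp add: \<phi>(2) T_coeff_def)
      then show "t_coeff c s i j \<in> ?X" by blast
    qed
  qed (rule S)
  have "GL_invariants (act_A :: complex^'m^'m \<Rightarrow> ('s, 'm, 'n) A \<Rightarrow> ('s, 'm, 'n) A) \<subseteq> ?S"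
    using invariants_in_subalgebra[OF subalgebra_with_generators_axioms S_inv] filtered_exhausts[of _ c] by blast
  with S_inv have "GL_invariants (act_A :: complex^'m^'m \<Rightarrow> ('s, 'm, 'n) A \<Rightarrow> ('s, 'm, 'n) A) = ?S" by blast
  then show ?thesis using \<phi>(1) series unique by (intro exI[of _ \<phi>]) blast
qed

end
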